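(* (1) The following decision problem can be decided in nondeterministic space $\mathcal{O}\big(n(1+\log|Q|)+|u|(1+\log|\Sigma|)\big)$, where $n=|Q^*\circ u|\le|\Sigma|^{|u|}$. Input: a $G$-automaton $\mathcal{T}=(Q,\Sigma,\delta)$ and a word $u\in\Sigma^*$. Question: is $u$ expandable with respect to $\mathcal{T}$? (2) For every fixed $G$-automaton $\mathcal{T}=(Q,\Sigma,\delta)$ (a constant, not part of the input), the following decision problem can be decided in nondeterministic space $2^{\mathcal{O}(|u|)}$. Input: a word $u\in\Sigma^*$. Question: is $u$ expandable with respect to $\mathcal{T}$?
   Context: An alphabet is a non-empty finite set; $\Sigma^*$ is the set of finite words over $\Sigma$, including the empty word $\varepsilon$; $|u|$ is the length of $u$. An automaton is a triple $\mathcal{T}=(Q,\Sigma,\delta)$ with a finite set $Q$ of states, an alphabet $\Sigma$ and $\delta\subseteq Q\times\Sigma\times\Sigma\times Q$; a transition $(q,a,b,p)$ goes from $q$ to $p$, reads $a$ and outputs $b$. A $G$-automaton is an automaton such that for all $q\in Q$ and $a\in\Sigma$ there is exactly one transition of the form $(q,a,b,p)\in\delta$ (complete and deterministic), and for all $q\in Q$ and $b\in\Sigma$ there is at most one transition of the form $(q,a,b,p)\in\delta$ (invertible, i.e. the automaton obtained by swapping inputs and outputs is deterministic). Each $q\in Q$ induces a length-preserving bijection $q\circ\colon\Sigma^*\to\Sigma^*$ mapping $u$ to the output of the unique run starting in $q$ with input $u$. For $\boldsymbol q=q_\ell\dots q_1\in Q^*$, $\boldsymbol q\circ$ is the composition applying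 $q_1\circ$ first and $q_\ell\circ$ last; $\varepsilon\circ$ is the identity. The orbit of $u$ is $Q^*\circ u=\{\boldsymbol q\circ u\mid\boldsymbol q\in Q^*\}$. The word $u$ is expandable (with respect to $\mathcal{T}$) if there is $x\in\Sigma^*$ with $|Q^*\circ ux|>|Q^*\circ u|$. Nondeterministic space is the usual notion for nondeterministic Turing machines with a read-only input tape. *)

theory Defs
  imports Complex_Main "HOL-Library.Landau_Symbols" "HOL-Library.Log_Nat"
begin

section \<open>Automata, orbits, expandable words\<close>

record ('q, 'a) automaton =
  aut_states :: "'q set"
  aut_alphabet :: "'a set"
  aut_trans :: "('q \<times> 'a \<times> 'a \<times> 'q) set"

definition automaton :: "('q, 'a) automaton \<Rightarrow> bool" where
  "automaton T \<longleftrightarrow>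
     finite (aut_states T) \<and> finite (aut_alphabet T) \<and> aut_alphabet T \<noteq> {} \<and>
     aut_trans T \<subseteq> aut_states T \<times> aut_alphabet T \<times> aut_alphabet T \<times> aut_states T"

definition G_automaton :: "('q, 'a) automaton \<Rightarrow> bool" where
  "G_automaton T \<longleftrightarrow>
     automaton T \<and>
     (\<forall>q\<in>aut_states T. \<forall>a\<in>aut_alphabet T. \<exists>!t. t \<in> aut_trans T \<and> (\<exists>b p. t = (q, a, b, p))) \<and>
     (\<forall>q\<in>aut_states T. \<forall>b\<in>aut_alphabet T. \<exists>\<^sub>\<le>\<^sub>1t. t \<in> aut_trans T \<and> (\<exists>a p. t = (q, a, b, p)))"

text \<open>\<open>aut_run T q u v p\<close>: some run goes from \<open>q\<close> to \<open>p\<close>, reads \<open>u\<close> and outputs \<open>v\<close>.\<close>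

inductive aut_run :: "('q, 'a) automaton \<Rightarrow> 'q \<Rightarrow> 'a list \<Rightarrow> 'a list \<Rightarrow> 'q \<Rightarrow> bool"
  for T where
  Nil: "q \<in> aut_states T \<Longrightarrow> aut_run T q [] [] q"
| Cons: "(q, a, b, r) \<in> aut_trans T \<Longrightarrow> aut_run T r u v p \<Longrightarrow> aut_run T q (a # u) (b # v) p"

definition state_act :: "('q, 'a) automaton \<Rightarrow> 'q \<Rightarrow> 'a list \<Rightarrow> 'a list" where
  "state_act T q u = (THE v. \<exists>p. aut_run T q u v p)"

text \<open>A state sequence is written as in \<open>q\<^sub>l \<dots> q\<^sub>1\<close>: the last list entry acts first.\<close>

definition act :: "('q, 'a) automaton \<Rightarrow> 'q list \<Rightarrow> 'a list \<Rightarrow> 'a list" where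
  "act T qs u = foldr (state_act T) qs u"

definition orbit :: "('q, 'a) automaton \<Rightarrow> 'a list \<Rightarrow> 'a list set" where
  "orbit T u = {act T qs u | qs. qs \<in> lists (aut_states T)}"

definition expandable :: "('q, 'a) automaton \<Rightarrow> 'a list \<Rightarrow> bool" where
  "expandable T u \<longleftrightarrow>
     (\<exists>x\<in>lists (aut_alphabet T). card (orbit T (u @ x)) > card (orbit T u))"

section \<open>Nondeterministic Turing machines with a read-only input tape\<close>

text \<open>
  A machine has a two-way read-only input tape delimited by end markers and a fixed number of
  read-write work tapes, infinite to the right. Control states and work symbols are natural
  numbers; the work symbol \<open>0\<close> is the blank. An instruction \<open>(s, i, gs, s', d, ws)\<close> is applicable
  in control state \<open>s\<close> if \<open>i\<close> is scanned on the input tape and \<open>gs\<close> on the work tapes; the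
  machine then enters \<open>s'\<close>, moves the input head in direction \<open>d\<close>, and on each work tape writes
  the symbol and moves in the direction given by \<open>ws\<close>. Finiteness of the instruction set makes
  the sets of control states and of work symbols finite.
\<close>

datatype move = Stay | Left | Right

datatype 'i input_cell = Left_End | Right_End | Cell 'i

record 'i ntm =
  ntm_tapes :: nat
  ntm_start :: nat
  ntm_accept :: nat
  ntm_instrs :: "(nat \<times> 'i input_cell \<times> nat list \<times> nat \<times> move \<times> (nat \<times> move) list) set"

definition ntm :: "'i ntm \<Rightarrow> bool" where
  "ntm M \<longleftrightarrow>
     finite (ntm_instrs M) \<and>
     (\<forall>(s, i, gs, s', d, ws) \<in> ntm_instrs M. length gs = ntm_tapes M \<and> length ws = ntm_tapes M)"

text \<open>
  A work tape is a pair of the list of contents of the cells visited so far, which are the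
  leftmost cells of the tape, and the head position.
\<close>

type_synonym work_tape = "nat list \<times> nat"

fun work_read :: "work_tape \<Rightarrow> nat" where
  "work_read (cs, h) = cs ! h"

fun work_step :: "nat \<times> move \<Rightarrow> work_tape \<Rightarrow> work_tape" where
  "work_step (g, Stay) (cs, h) = (cs[h := g], h)"
| "work_step (g, Left) (cs, h) = (cs[h := g], h - 1)"
| "work_step (g, Right) (cs, h) =
     (if Suc h < length cs then cs[h := g] else cs[h := g] @ [0], Suc h)"

text \<open>The input \<open>w\<close> occupies the positions \<open>1, \<dots>, length w\<close> between the two end markers.\<close>

definition input_read :: "'i list \<Rightarrow> nat \<Rightarrow> 'i input_cell" where
  "input_read w k =
     (if k = 0 then Left_End else if k \<le> length w then Cell (w ! (k - 1)) else Right_End)"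

fun input_move :: "'i list \<Rightarrow> move \<Rightarrow> nat \<Rightarrow> nat" where
  "input_move w Stay k = k"
| "input_move w Left k = k - 1"
| "input_move w Right k = min (Suc k) (Suc (length w))"

type_synonym config = "nat \<times> nat \<times> work_tape list"

definition ntm_init :: "'i ntm \<Rightarrow> config" where
  "ntm_init M = (ntm_start M, 0, replicate (ntm_tapes M) ([0], 0))"

inductive ntm_step :: "'i ntm \<Rightarrow> 'i list \<Rightarrow> config \<Rightarrow> config \<Rightarrow> bool"
  for M w where
  "(s, input_read w k, map work_read ts, s', d, ws) \<in> ntm_instrs M \<Longrightarrow>
   ntm_step M w (s, k, ts) (s', input_move w d k, map2 work_step ws ts)"

definition ntm_reachable :: "'i ntm \<Rightarrow> 'i list \<Rightarrow> config \<Rightarrow> bool" where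
  "ntm_reachable M w c \<longleftrightarrow> (ntm_step M w)\<^sup>*\<^sup>* (ntm_init M) c"

definition ntm_accepts :: "'i ntm \<Rightarrow> 'i list \<Rightarrow> bool" where
  "ntm_accepts M w \<longleftrightarrow> (\<exists>k ts. ntm_reachable M w (ntm_accept M, k, ts))"

fun config_space :: "config \<Rightarrow> nat" where
  "config_space (s, k, ts) = (\<Sum>(cs, h)\<leftarrow>ts. length cs)"

text \<open>
  A decision problem is given by its set of instances, the relation \<open>code x w\<close> stating that the
  string \<open>w\<close> represents the instance \<open>x\<close>, and the set of positive instances. The space bound is a
  function of the instance and applies to every computation, accepting or not. Strings that
  represent no instance are not constrained. As usual for nondeterministic space, acceptance means
  existence of an accepting computation, and computations that do not accept need not halt.
\<close>

definition decidable_in_nspace ::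
  "'x set \<Rightarrow> ('x \<Rightarrow> 'i list \<Rightarrow> bool) \<Rightarrow> ('x \<Rightarrow> bool) \<Rightarrow> ('x \<Rightarrow> real) \<Rightarrow> bool" where
  "decidable_in_nspace inst code yes bound \<longleftrightarrow>
     (\<exists>M. ntm M \<and>
       (\<forall>x\<in>inst. \<forall>w. code x w \<longrightarrow>
          (ntm_accepts M w \<longleftrightarrow> yes x) \<and>
          (\<forall>c. ntm_reachable M w c \<longrightarrow> real (config_space c) \<le> bound x)))"

section \<open>Encoding an automaton and a word as an input string\<close>

text \<open>
  States and letters are numbered from \<open>0\<close> and written as binary blocks of fixed width. The label
  \<open>a/b\<close> of a transition is written on two tracks, so that \<open>Bit2 x y\<close> holds corresponding bits of
  \<open>a\<close> and \<open>b\<close>. This matters only for the empty word \<open>u\<close>, where the space bound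
  contains no term for the size of the alphabet and two consecutive blocks could
  therefore not be compared. The order of the transitions and the numberings are arbitrary.
\<close>

datatype symbol = Bit bool | Bit2 bool bool | Comma | Semicolon | Hash

definition binary :: "nat \<Rightarrow> nat \<Rightarrow> bool list" where
  "binary m i = map (bit i) [0..<ceillog2 m]"

fun encode_trans :: "nat \<Rightarrow> nat \<Rightarrow> nat \<times> nat \<times> nat \<times> nat \<Rightarrow> symbol list" where
  "encode_trans m k (q, a, b, p) =
     map Bit (binary m q) @ [Comma] @ map2 Bit2 (binary k a) (binary k b) @ [Comma] @
     map Bit (binary m p) @ [Semicolon]"

definition encode_letter :: "nat \<Rightarrow> nat \<Rightarrow> symbol list" where
  "encode_letter k a = map Bit (binary k a) @ [Comma]"

definition encodes :: "('q, 'a) automaton \<times> 'a list \<Rightarrow> symbol list \<Rightarrow> bool" where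
  "encodes = (\<lambda>(T, u) w. \<exists>f g ts.
     let m = card (aut_states T); k = card (aut_alphabet T) in
     bij_betw f (aut_states T) {..<m} \<and> bij_betw g (aut_alphabet T) {..<k} \<and>
     distinct ts \<and> set ts = aut_trans T \<and>
     w = concat (map (\<lambda>(q, a, b, p). encode_trans m k (f q, g a, g b, f p)) ts) @ [Hash] @
         concat (map (\<lambda>a. encode_letter k (g a)) u))"

end

(*
  The states act on the orbit of u by permutations, so u is expandable iff some word v of the orbit
  has a cycle qs (that is, qs fixes v) with qs (v @ x) different from v @ x for some x. A shortest such
  cycle visits no word of the orbit twice, hence has length at most n, the size of the orbit. A
  nondeterministic machine guesses v by a random walk in the orbit, then the cycle, stored as a list
  of n states, and then x piecewise: feeding a piece through the list replaces every state by its
  section, so the pieces already read need not be stored. The length of the list must not exceed n in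
  any computation. To ensure this, the machine adds an entry only when its random walk has reached a
  word of the orbit that is lexicographically larger than all words counted so far.

  The machine is written as a regular program over three tapes. For the empty word the machine only
  looks for a transition with different input and output letters. For a fixed automaton the encoding
  of (T, u) is a constant followed by the image of u under a homomorphism, and a machine on the input
  u can simulate the head on this encoding in its control state.
*)

theory Submission
  imports Defs "HOL-Library.List_Lexorder" "HOL-Library.Nat_Bijection"
begin

text \<open>The obstacle is that \<open>n\<close> is not part of the input, while the space bound
  must hold for every run, failing ones included. So the length of the list is never guessed: each
  entry is paid for by a larger orbit word, and the list is at most as long as the rank of the last
  word counted. Runs that skip words end with a shorter list. This is harmless for soundness, since
  any list that passes the tests proves expandability, and one run that counts in order from the
  least word does reach length \<open>n\<close>. No counter bounds the length of a walk or of
  \<open>x\<close>, as computations need not halt. Regular programs are used because the set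
  \<open>post\<close> of outcomes settles acceptance, while \<open>safe\<close> speaks about the
  intermediate configurations that determine space. No position on the input is ever stored:
  transitions are found by a nondeterministic jump, and a wrong guess fails the test that
  follows.\<close>

lemma aut_run_length: "aut_run T q u v p \<Longrightarrow> length v = length u"
  by (induction rule: aut_run.induct) auto

lemma aut_run_append:
  "aut_run T q u v r \<Longrightarrow> aut_run T r x y p \<Longrightarrow> aut_run T q (u @ x) (v @ y) p"
  by (induction rule: aut_run.induct) (auto intro: aut_run.Cons)

inductive_cases aut_run_NilE: "aut_run T q [] v p"
inductive_cases aut_run_ConsE: "aut_run T q (a # u) v p"

lemma take_append_of_length: "length v = n \<Longrightarrow> take n (v @ y) = v"
  by auto

section \<open>Runs of a G-automaton and the action of state sequences on words\<close>

locale G_aut =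
  fixes T :: "('q, 'a) automaton"
  assumes G: "G_automaton T"
begin

abbreviation Q where "Q \<equiv> aut_states T"
abbreviation \<Sigma> where "\<Sigma> \<equiv> aut_alphabet T"

lemma trans_in: "(q, a, b, p) \<in> aut_trans T \<Longrightarrow> q \<in> Q \<and> a \<in> \<Sigma> \<and> b \<in> \<Sigma> \<and> p \<in> Q"
  using G unfolding G_automaton_def automaton_def by blast

lemma finite_\<Sigma>: "finite \<Sigma>" and finite_Q: "finite Q" and \<Sigma>_nonempty: "\<Sigma> \<noteq> {}"
  using G unfolding G_automaton_def automaton_def by auto

lemma trans_ex: "q \<in> Q \<Longrightarrow> a \<in> \<Sigma> \<Longrightarrow> \<exists>b p. (q, a, b, p) \<in> aut_trans T"
  using G unfolding G_automaton_def by blast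

lemma trans_det:
  assumes "(q, a, b, p) \<in> aut_trans T" "(q, a, b', p') \<in> aut_trans T"
  shows "b = b' \<and> p = p'"
proof -
  have "q \<in> Q" "a \<in> \<Sigma>"
    using assms trans_in by auto
  then have "\<exists>!t. t \<in> aut_trans T \<and> (\<exists>b p. t = (q, a, b, p))"
    using G unfolding G_automaton_def by blast
  then have "(q, a, b, p) = (q, a, b', p')"
    using assms by blast
  then show ?thesis
    by simp
qed

lemma trans_inv:
  assumes "(q, a, b, p) \<in> aut_trans T" "(q, a', b, p') \<in> aut_trans T"
  shows "a = a' \<and> p = p'"
proof -
  have "q \<in> Q" "b \<in> \<Sigma>"
    using assms trans_in by auto
  then have "\<exists>\<^sub>\<le>\<^sub>1t. t \<in> aut_trans T \<and> (\<exists>a p. t = (q, a, b, p))"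
    using G unfolding G_automaton_def by blast
  then have "(q, a, b, p) = (q, a', b, p')"
    unfolding Uniq_def using assms by blast
  then show ?thesis
    by simp
qed

lemma aut_run_in:
  "aut_run T q u v p \<Longrightarrow> q \<in> Q \<and> p \<in> Q \<and> u \<in> lists \<Sigma> \<and> v \<in> lists \<Sigma>"
  by (induction rule: aut_run.induct) (auto dest: trans_in)

lemma aut_run_det: "aut_run T q u v p \<Longrightarrow> aut_run T q u v' p' \<Longrightarrow> v = v' \<and> p = p'"
proof (induction arbitrary: v' p' rule: aut_run.induct)
  case (Nil q)
  then show ?case
    by (auto elim: aut_run_NilE)
next
  case (Cons q a b r u v p)
  from Cons.prems show ?case
    by (rule aut_run_ConsE) (use Cons trans_det in blast)
qed

text \<open>Invertibility passes from letters to words, because equal outputs force equal successor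
  states as well.\<close>

lemma aut_run_inj: "aut_run T q u v p \<Longrightarrow> aut_run T q u' v p' \<Longrightarrow> u = u'"
proof (induction arbitrary: u' p' rule: aut_run.induct)
  case (Nil q)
  then show ?case
    by (auto dest: aut_run_length)
next
  case (Cons q a b r u v p)
  from Cons.prems show ?case
    by cases (use Cons trans_inv in blast)
qed

lemma aut_run_ex: "u \<in> lists \<Sigma> \<Longrightarrow> q \<in> Q \<Longrightarrow> \<exists>v p. aut_run T q u v p"
proof (induction u arbitrary: q)
  case Nil
  then show ?case
    using aut_run.Nil by fast
next
  case (Cons a u)
  then obtain b r where "(q, a, b, r) \<in> aut_trans T"
    using trans_ex by force
  then have "r \<in> Q"
    using trans_in by blast
  moreover have "u \<in> lists \<Sigma>"
    using Cons.prems by simp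
  ultimately obtain v p where "aut_run T r u v p"
    using Cons.IH by blast
  then show ?case
    using aut_run.Cons[OF \<open>(q, a, b, r) \<in> aut_trans T\<close>] by blast
qed

lemma state_act_eq: "aut_run T q u v p \<Longrightarrow> state_act T q u = v"
  unfolding state_act_def by (rule the_equality) (auto dest: aut_run_det)

lemma state_act_run: "u \<in> lists \<Sigma> \<Longrightarrow> q \<in> Q \<Longrightarrow> \<exists>p. aut_run T q u (state_act T q u) p"
  using aut_run_ex state_act_eq by metis

lemma act_Nil [simp]: "act T [] u = u"
  and act_Cons: "act T (q # qs) u = state_act T q (act T qs u)"
  and act_append: "act T (qs @ rs) u = act T qs (act T rs u)"
  by (auto simp: act_def)

lemma act_in:
  assumes "u \<in> lists \<Sigma>" "qs \<in> lists Q"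
  shows "act T qs u \<in> lists \<Sigma> \<and> length (act T qs u) = length u"
  using assms(2)
proof (induction qs)
  case (Cons q qs)
  then show ?case
    using state_act_run aut_run_in aut_run_length assms(1) by (metis act_Cons listsE)
qed (use assms in auto)

lemma act_inj:
  assumes "u \<in> lists \<Sigma>" "v \<in> lists \<Sigma>" "qs \<in> lists Q" "act T qs u = act T qs v"
  shows "u = v"
  using assms(3,4)
proof (induction qs)
  case (Cons q qs)
  then show ?case
    using state_act_run aut_run_inj assms(1,2) act_in by (metis act_Cons listsE)
qed auto

text \<open>A run on \<open>u @ x\<close> has produced its output for \<open>u\<close> before it
  reads \<open>x\<close>, so the action respects prefixes. This makes it meaningful to ask what a
  cycle at \<open>u\<close> does to extensions of \<open>u\<close>.\<close>

lemma act_prefix: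
  assumes "u \<in> lists \<Sigma>" "x \<in> lists \<Sigma>" "qs \<in> lists Q"
  shows "\<exists>y\<in>lists \<Sigma>. length y = length x \<and> act T qs (u @ x) = act T qs u @ y"
  using assms(3)
proof (induction qs)
  case Nil
  then show ?case
    using assms by auto
next
  case (Cons q qs)
  then obtain y where y: "y \<in> lists \<Sigma>" "length y = length x" "act T qs (u @ x) = act T qs u @ y"
    by auto
  have "act T qs u \<in> lists \<Sigma>" "q \<in> Q"
    using act_in Cons assms by auto
  then obtain p where p: "aut_run T q (act T qs u) (state_act T q (act T qs u)) p"
    using state_act_run by blast
  then obtain z p' where z: "aut_run T p y z p'"
    using aut_run_in y aut_run_ex by meson
  have "aut_run T q (act T qs u @ y) (state_act T q (act T qs u) @ z) p'"
    using aut_run_append p z by fast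
  then have "act T (q # qs) (u @ x) = act T (q # qs) u @ z"
    using state_act_eq y by (simp add: act_Cons)
  then show ?case
    using z aut_run_in aut_run_length y by metis
qed

section \<open>Orbits and criteria for expandability\<close>

lemma orbit_act: "qs \<in> lists Q \<Longrightarrow> act T qs u \<in> orbit T u"
  by (auto simp: orbit_def)

lemma orbit_self: "u \<in> orbit T u"
  using orbit_act[of "[]"] by simp

lemma orbit_in: "u \<in> lists \<Sigma> \<Longrightarrow> v \<in> orbit T u \<Longrightarrow> v \<in> lists \<Sigma> \<and> length v = length u"
  unfolding orbit_def using act_in by auto

lemma orbit_trans: "v \<in> orbit T u \<Longrightarrow> z \<in> orbit T v \<Longrightarrow> z \<in> orbit T u"
proof -
  assume "v \<in> orbit T u" "z \<in> orbit T v"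
  then obtain qs rs where "qs \<in> lists Q" "rs \<in> lists Q" "v = act T qs u" "z = act T rs v"
    by (auto simp: orbit_def)
  then show ?thesis
    using orbit_act[of "rs @ qs"] by (simp add: act_append)
qed

lemma orbit_subset_words:
  "u \<in> lists \<Sigma> \<Longrightarrow> orbit T u \<subseteq> {v. set v \<subseteq> \<Sigma> \<and> length v = length u}"
proof
  fix v
  assume "u \<in> lists \<Sigma>" "v \<in> orbit T u"
  then show "v \<in> {v. set v \<subseteq> \<Sigma> \<and> length v = length u}"
    using orbit_in[of u v] by auto
qed

lemma finite_orbit: "u \<in> lists \<Sigma> \<Longrightarrow> finite (orbit T u)"
  using finite_subset[OF orbit_subset_words finite_lists_length_eq[OF finite_\<Sigma>]] .

lemma card_orbit_le: "u \<in> lists \<Sigma> \<Longrightarrow> card (orbit T u) \<le> card \<Sigma> ^ length u"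
  using card_mono[OF finite_lists_length_eq[OF finite_\<Sigma>] orbit_subset_words]
  by (simp add: card_lists_length_eq finite_\<Sigma>)

lemma card_orbit_pos: "u \<in> lists \<Sigma> \<Longrightarrow> card (orbit T u) > 0"
  using finite_orbit orbit_self card_gt_0_iff by blast

text \<open>Inverses come from finiteness: some power of a permutation of the orbit returns to its start.\<close>

lemma orbit_sym_step:
  assumes u: "u \<in> lists \<Sigma>" and q: "q \<in> Q"
  shows "u \<in> orbit T (state_act T q u)"
proof -
  let ?f = "\<lambda>n. act T (replicate n q) u"
  have rep: "replicate n q \<in> lists Q" for n
    using q by auto
  have "range ?f \<subseteq> orbit T u"
    using rep orbit_act by blast
  then have "finite (range ?f)"
    using finite_orbit[OF u] finite_subset by blast
  then have "\<not> inj ?f"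
    using finite_imageD by fastforce
  then obtain m n where "m < n" "?f m = ?f n"
    unfolding inj_def by (metis nat_neq_iff)
  moreover from this(1) obtain d where "n = m + Suc d"
    using less_iff_Suc_add by (metis add_Suc_right)
  ultimately have eq: "?f m = ?f (m + Suc d)"
    by simp
  have "act T (replicate m q) u = act T (replicate m q) (act T (replicate (Suc d) q) u)"
    using eq by (simp only: replicate_add act_append)
  then have "u = act T (replicate (Suc d) q) u"
    using act_inj[OF u _ rep] act_in[OF u rep] by blast
  \<comment> \<open>The copy of \<open>q\<close> that acts first is split off at the right end; the
    remaining \<open>d\<close> copies are the inverse on this word.\<close>
  also have "\<dots> = act T (replicate d q @ [q]) u"
    by (simp add: replicate_append_same)
  finally have "u = act T (replicate d q) (state_act T q u)"
    by (simp only: act_append act_Cons act_Nil)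
  then show ?thesis
    using orbit_act[OF rep] by metis
qed

lemma orbit_sym:
  assumes u: "u \<in> lists \<Sigma>" and "v \<in> orbit T u"
  shows "u \<in> orbit T v"
proof -
  obtain qs where qs: "qs \<in> lists Q" "v = act T qs u"
    using assms by (auto simp: orbit_def)
  have "u \<in> orbit T (act T qs u)"
    using qs(1)
  proof (induction qs)
    case (Cons q qs)
    have "act T qs u \<in> orbit T (state_act T q (act T qs u))"
      using orbit_sym_step act_in u Cons by auto
    then show ?case
      using Cons orbit_trans by (auto simp: act_Cons)
  qed (use orbit_self in auto)
  then show ?thesis
    using qs by simp
qed

lemma orbit_eq:
  assumes "u \<in> lists \<Sigma>" "v \<in> orbit T u"
  shows "orbit T v = orbit T u"
  using orbit_trans orbit_sym assms by blast

lemma orbit_prefix: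
  assumes "u \<in> lists \<Sigma>" "x \<in> lists \<Sigma>"
  shows "take (length u) ` orbit T (u @ x) = orbit T u"
proof -
  have "take (length u) (act T qs (u @ x)) = act T qs u" if "qs \<in> lists Q" for qs
    using act_prefix[OF assms that] act_in assms that by fastforce
  then show ?thesis
    unfolding orbit_def by (auto simp: image_iff) (metis in_listsI)
qed

text \<open>Truncation maps the orbit of \<open>u @ x\<close> onto the orbit of \<open>u\<close>;
  between these finite sets, a larger cardinality means exactly that truncation is not
  injective.\<close>

lemma expandable_iff_not_inj:
  assumes u: "u \<in> lists \<Sigma>"
  shows "expandable T u \<longleftrightarrow> (\<exists>x\<in>lists \<Sigma>. \<not> inj_on (take (length u)) (orbit T (u @ x)))"
proof -
  have "card (orbit T (u @ x)) > card (orbit T u) \<longleftrightarrow> \<not> inj_on (take (length u)) (orbit T (u @ x))"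
    if x: "x \<in> lists \<Sigma>" for x
  proof -
    have fin: "finite (orbit T (u @ x))"
      using finite_orbit u x by simp
    have "card (orbit T u) \<le> card (orbit T (u @ x))"
      using card_image_le[OF fin, of "take (length u)"] unfolding orbit_prefix[OF u x] .
    moreover have "inj_on (take (length u)) (orbit T (u @ x)) \<longleftrightarrow>
        card (orbit T u) = card (orbit T (u @ x))"
      using inj_on_iff_eq_card[OF fin, of "take (length u)"] unfolding orbit_prefix[OF u x] .
    ultimately show ?thesis
      by linarith
  qed
  then show ?thesis
    unfolding expandable_def by blast
qed

text \<open>The cycle sits at \<open>v\<close>, not at \<open>u\<close>. A sequence that takes
  \<open>v\<close> to \<open>u\<close> takes \<open>v @ x\<close> to some \<open>u @ z\<close>, and
  the orbit of \<open>u @ z\<close> then contains two words with the same prefix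
  \<open>v\<close>.\<close>

lemma expandableI:
  assumes u: "u \<in> lists \<Sigma>" and v: "v \<in> orbit T u" and qs: "qs \<in> lists Q" and x: "x \<in> lists \<Sigma>"
    and "act T qs v = v" "act T qs (v @ x) \<noteq> v @ x"
  shows "expandable T u"
proof -
  have v_in: "v \<in> lists \<Sigma>" "length v = length u"
    using orbit_in u v by auto
  obtain y where y: "length y = length x" "act T qs (v @ x) = v @ y"
    using act_prefix[OF v_in(1) x qs] assms by auto
  obtain rs where rs: "rs \<in> lists Q" "u = act T rs v"
    using orbit_sym[OF u v] by (auto simp: orbit_def)
  obtain z where z: "z \<in> lists \<Sigma>" "act T rs (v @ x) = u @ z"
    using act_prefix[OF v_in(1) x rs(1)] rs(2) by metis
  have "u @ z \<in> orbit T (v @ x)"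
    using z(2) rs orbit_act by metis
  then have "orbit T (u @ z) = orbit T (v @ x)"
    using orbit_eq[of "v @ x"] v_in x by simp
  moreover have "v @ x \<in> orbit T (v @ x)" "v @ y \<in> orbit T (v @ x)"
    using orbit_self orbit_act qs y by metis+
  moreover have "take (length u) (v @ x) = take (length u) (v @ y)" "v @ x \<noteq> v @ y"
    using v_in assms y by simp_all
  ultimately have "\<not> inj_on (take (length u)) (orbit T (u @ z))"
    unfolding inj_on_def by blast
  then show ?thesis
    using expandable_iff_not_inj u z by blast
qed

text \<open>Two different words with a common prefix in one orbit are connected by a state sequence;
  it fixes the prefix and moves the extension.\<close>

lemma expandableD:
  assumes u: "u \<in> lists \<Sigma>" and "expandable T u"
  shows "\<exists>v\<in>orbit T u. \<exists>qs\<in>lists Q. \<exists>x\<in>lists \<Sigma>. act T qs v = v \<and> act T qs (v @ x) \<noteq> v @ x"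
proof -
  obtain x where x: "x \<in> lists \<Sigma>" "\<not> inj_on (take (length u)) (orbit T (u @ x))"
    using expandable_iff_not_inj assms by blast
  then obtain a b where ab: "a \<in> orbit T (u @ x)" "b \<in> orbit T (u @ x)"
    "take (length u) a = take (length u) b" "a \<noteq> b"
    by (auto simp: inj_on_def)
  have ux: "u @ x \<in> lists \<Sigma>"
    using u x by simp
  define v where "v = take (length u) a"
  define y where "y = drop (length u) a"
  have a: "a = v @ y" "length a = length u + length x" "a \<in> lists \<Sigma>"
    using v_def y_def orbit_in[OF ux ab(1)] by auto
  moreover have "set v \<subseteq> set a" "set y \<subseteq> set a"
    by (simp_all add: v_def y_def set_take_subset set_drop_subset)
  ultimately have vy: "v \<in> lists \<Sigma>" "y \<in> lists \<Sigma>" "length v = length u"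
    using v_def by auto
  have "v \<in> orbit T u"
    using v_def ab orbit_prefix[OF u x(1)] by blast
  moreover have "b \<in> orbit T a"
    using ab orbit_eq[OF ux] by blast
  then obtain qs where qs: "qs \<in> lists Q" "b = act T qs a"
    by (auto simp: orbit_def)
  moreover have "act T qs v = v"
  proof -
    obtain z where "act T qs (v @ y) = act T qs v @ z"
      using act_prefix vy qs by blast
    then have "take (length u) b = act T qs v"
      using qs a vy act_in by (metis take_append_of_length)
    then show ?thesis
      using ab v_def by simp
  qed
  ultimately show ?thesis
    using ab a vy by metis
qed

text \<open>A shortest nontrivial cycle visits no vertex twice: a repetition splits off a shorter
  cycle, which acts trivially by minimality and can be cut out.\<close>

lemma expandable_short_cycle:
  assumes u: "u \<in> lists \<Sigma>" and "expandable T u"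
  shows "\<exists>v\<in>orbit T u. \<exists>qs\<in>lists Q. \<exists>x\<in>lists \<Sigma>.
    length qs \<le> card (orbit T u) \<and> act T qs v = v \<and> act T qs (v @ x) \<noteq> v @ x"
proof -
  \<comment> \<open>The base point is quantified inside \<open>C\<close>, so minimality also applies
    to a cycle that is split off at a different word of the orbit.\<close>
  define C where "C qs \<longleftrightarrow> qs \<in> lists Q \<and>
    (\<exists>v\<in>orbit T u. \<exists>x\<in>lists \<Sigma>. act T qs v = v \<and> act T qs (v @ x) \<noteq> v @ x)" for qs
  obtain qs where "C qs" and least: "\<And>rs. C rs \<Longrightarrow> length qs \<le> length rs"
  proof -
    from expandableD[OF assms] obtain v qs0 x where "v \<in> orbit T u" "qs0 \<in> lists Q"
      "x \<in> lists \<Sigma>" "act T qs0 v = v" "act T qs0 (v @ x) \<noteq> v @ x"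
      by (elim bexE conjE)
    then have "C qs0"
      unfolding C_def by (intro conjI bexI)
    then show ?thesis
      using ex_has_least_nat[of C qs0 length] that by blast
  qed
  then obtain v x where qs: "qs \<in> lists Q" and v: "v \<in> orbit T u" and x: "x \<in> lists \<Sigma>"
    and fixed: "act T qs v = v" and moved: "act T qs (v @ x) \<noteq> v @ x"
    unfolding C_def by blast
  have v_in: "v \<in> lists \<Sigma>"
    using orbit_in u v by blast
  have orb: "orbit T v = orbit T u"
    using orbit_eq u v by blast
  \<comment> \<open>\<open>suf i\<close> consists of the \<open>i\<close> entries that act first, so
    \<open>act T (suf i) v\<close> is the vertex reached after \<open>i\<close> steps of the
    cycle.\<close>
  define suf where "suf i = drop (length qs - i) qs" for i
  have suf_in: "suf i \<in> lists Q" for i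
    using qs by (auto simp: suf_def dest: in_set_dropD)
  have "length qs \<le> card (orbit T u)"
  proof (rule ccontr)
    assume long: "\<not> ?thesis"
    have "(\<lambda>i. act T (suf i) v) ` {..<length qs} \<subseteq> orbit T u"
      using orbit_act[OF suf_in, of _ v] orb by blast
    then have "card ((\<lambda>i. act T (suf i) v) ` {..<length qs}) \<le> card (orbit T u)"
      using card_mono[OF finite_orbit[OF u]] by blast
    then have "card ((\<lambda>i. act T (suf i) v) ` {..<length qs}) < card {..<length qs}"
      using long by simp
    then have "\<not> inj_on (\<lambda>i. act T (suf i) v) {..<length qs}"
      using pigeonhole by blast
    then obtain i j where ij: "i < j" "j < length qs" "act T (suf i) v = act T (suf j) v"
      unfolding inj_on_def by (metis lessThan_iff nat_neq_iff)
    define a where "a = suf i"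
    define b where "b = take (j - i) (suf j)"
    define c where "c = take (length qs - j) qs"
    have "suf j = b @ drop (j - i) (suf j)"
      by (simp add: b_def)
    moreover have "drop (j - i) (suf j) = a"
      using ij by (simp add: a_def suf_def)
    ultimately have sufj: "suf j = b @ a"
      by simp
    then have split: "qs = c @ b @ a"
      by (metis append_take_drop_id c_def suf_def)
    have "length b = j - i"
      using ij by (simp add: b_def suf_def)
    moreover have "length qs = length c + length b + length a"
      unfolding split by simp
    ultimately have len: "length qs = length c + length b + length a" "length b > 0"
      "length b < length qs"
      using ij by auto
    have lists: "a \<in> lists Q" "b \<in> lists Q" "c \<in> lists Q"
      using qs split by auto
    define v' where "v' = act T a v"
    have v': "v' \<in> orbit T u" "v' \<in> lists \<Sigma>" "act T b v' = v'"
    proof -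
      show orb': "v' \<in> orbit T u"
        using orbit_act[OF lists(1), of v] orb unfolding v'_def by blast
      show "v' \<in> lists \<Sigma>"
        using orbit_in[OF u orb'] by blast
      show "act T b v' = v'"
        using ij(3) unfolding sufj v'_def a_def[symmetric] act_append by simp
    qed
    obtain y where y: "y \<in> lists \<Sigma>" "act T a (v @ x) = v' @ y"
      using act_prefix[OF v_in x lists(1)] v'_def by auto
    have "\<not> C b"
      using least len(3) leD by blast
    then have "act T b (v' @ y) = v' @ y"
      using C_def lists v' y by blast
    then have "act T (c @ a) (v @ x) = act T qs (v @ x)"
      by (simp only: split act_append y)
    moreover have "act T (c @ a) v = act T qs v"
      by (simp only: split act_append v'_def[symmetric] v')
    moreover have "c @ a \<in> lists Q"
      using lists by simp
    ultimately have "C (c @ a)"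
      unfolding C_def using v x fixed moved by metis
    then have "length qs \<le> length (c @ a)"
      by (rule least)
    then show False
      using len by simp
  qed
  then show ?thesis
    using v qs x fixed moved by blast
qed

text \<open>At the empty word every sequence is a cycle, and if no transition changes its letter,
  then every state acts as the identity.\<close>

lemma expandable_Nil_iff: "expandable T [] \<longleftrightarrow> (\<exists>(q, a, b, p)\<in>aut_trans T. a \<noteq> b)"
proof
  assume "expandable T []"
  then obtain v qs x where v: "v \<in> orbit T []" and qs: "qs \<in> lists Q" and x: "x \<in> lists \<Sigma>"
    and moved: "act T qs (v @ x) \<noteq> v @ x"
    using expandableD[of "[]"] by auto
  show "\<exists>(q, a, b, p)\<in>aut_trans T. a \<noteq> b"
  proof (rule ccontr)
    assume none: "\<not> ?thesis"
    have "aut_run T q u w p \<Longrightarrow> w = u" for q u w p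
      by (induction rule: aut_run.induct) (use none in auto)
    then have id: "state_act T q u = u" if "q \<in> Q" "u \<in> lists \<Sigma>" for q u
      using state_act_run that by metis
    have "act T qs u = u" if "u \<in> lists \<Sigma>" for u
      using qs by (induction qs) (use that in \<open>auto simp: act_Cons id\<close>)
    then show False
      using moved v x orbit_in[of "[]"] by auto
  qed
next
  assume "\<exists>(q, a, b, p)\<in>aut_trans T. a \<noteq> b"
  then obtain q a b p where t: "(q, a, b, p) \<in> aut_trans T" "a \<noteq> b"
    by auto
  have in_Q: "q \<in> Q" "a \<in> \<Sigma>" "p \<in> Q"
    using trans_in t by blast+
  have "aut_run T q [a] [b] p" "aut_run T q [] [] q"
    using t in_Q by (auto intro: aut_run.intros)
  then have "act T [q] [a] = [b]" "act T [q] [] = []"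
    using state_act_eq by (auto simp: act_Cons)
  then show "expandable T []"
    using expandableI[of "[]" "[]" "[q]" "[a]"] t in_Q orbit_self by auto
qed

end

section \<open>Feeding a word through a list of states\<close>

inductive feed ::
  "('q, 'a) automaton \<Rightarrow> (bool \<times> 'q) list \<Rightarrow> 'a list \<Rightarrow> (bool \<times> 'q) list \<Rightarrow> 'a list \<Rightarrow> bool"
  for T where
  Nil: "feed T [] u [] u"
| Skip: "feed T W u W' v \<Longrightarrow> feed T ((False, q) # W) u ((False, q) # W') v"
| Run: "aut_run T q u v p \<Longrightarrow> feed T W v W' x \<Longrightarrow> feed T ((True, q) # W) u ((True, p) # W') x"

text \<open>In a flagged list the head acts first, the reverse of the order in \<open>act\<close>,
  hence the \<open>rev\<close> in \<open>feed_act\<close>. Entries with flag \<open>False\<close>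
  are idle, so that a list of fixed length can represent every shorter sequence.\<close>

definition active :: "(bool \<times> 'q) list \<Rightarrow> 'q list" where
  "active W = map snd (filter fst W)"

lemma active_simps [simp]:
  "active [] = []" "active ((True, q) # W) = q # active W" "active ((False, q) # W) = active W"
  by (auto simp: active_def)

lemma feed_append:
  "feed T W u W' v \<Longrightarrow> feed T W' x W'' y \<Longrightarrow> feed T W (u @ x) W'' (v @ y)"
proof (induction arbitrary: W'' x y rule: feed.induct)
  case Nil
  then show ?case
    by (auto elim: feed.cases intro: feed.intros)
next
  case (Skip W u W' v q)
  from Skip.prems show ?case
    by cases (auto intro: feed.intros Skip.IH)
next
  case (Run q u v p W W' z)
  from Run.prems show ?case
    by cases (auto intro: feed.intros Run.IH aut_run_append[OF Run.hyps(1)])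
qed

context G_aut
begin

text \<open>If no entry is active, \<open>u\<close> may be any list at all. The final disjunction
  records that a word which is changed must be over the alphabet: this certifies guessed letters
  afterwards.\<close>

lemma feed_act:
  "feed T W u W' v \<Longrightarrow>
    v = act T (rev (active W)) u \<and> active W \<in> lists Q \<and> active W' \<in> lists Q \<and>
    (v = u \<or> u \<in> lists \<Sigma>)"
  by (induction rule: feed.induct)
    (auto simp: act_append act_Cons state_act_eq dest: aut_run_in)

lemma feed_ex: "u \<in> lists \<Sigma> \<Longrightarrow> active W \<in> lists Q \<Longrightarrow> \<exists>W' v. feed T W u W' v"
proof (induction W arbitrary: u)
  case Nil
  then show ?case
    using feed.Nil by fast
next
  case (Cons fq W)
  obtain f q where fq: "fq = (f, q)"
    by force
  show ?case
  proof (cases f)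
    case True
    then have "q \<in> Q" "active W \<in> lists Q"
      using Cons.prems fq by auto
    moreover from this obtain v p where run: "aut_run T q u v p"
      using aut_run_ex Cons.prems by blast
    moreover obtain W' x where "feed T W v W' x"
      using Cons.IH calculation aut_run_in[OF run] by blast
    ultimately show ?thesis
      using True unfolding fq by (auto intro: feed.Run)
  next
    case False
    then have "active W \<in> lists Q"
      using Cons.prems fq by simp
    then obtain W' x where "feed T W u W' x"
      using Cons.IH Cons.prems by blast
    then show ?thesis
      using False unfolding fq by (auto intro: feed.Skip)
  qed
qed

end

section \<open>Regular programs over three tapes\<close>

text \<open>A work tape of a machine has no end marker, so \<open>Margin\<close> is written into its
  first cell; the first \<open>Blank\<close> marks the end of the contents. \<open>Duo\<close>
  carries one bit on each of two tracks.\<close>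

datatype cell = Blank | Margin | Separator | Flag bool | Digit bool | Duo bool bool

lemma UNIV_cell: "UNIV = {Blank, Margin, Separator} \<union> range Flag \<union> range Digit \<union> range (\<lambda>(x, y). Duo x y)"
proof (intro UNIV_eq_I)
  fix c
  show "c \<in> {Blank, Margin, Separator} \<union> range Flag \<union> range Digit \<union> range (\<lambda>(x, y). Duo x y)"
    by (cases c) auto
qed

instance cell :: finite
  by standard (simp add: UNIV_cell)

lemma UNIV_symbol: "UNIV = {Comma, Semicolon, Hash} \<union> range Bit \<union> range (\<lambda>(x, y). Bit2 x y)"
proof (intro UNIV_eq_I)
  fix c
  show "c \<in> {Comma, Semicolon, Hash} \<union> range Bit \<union> range (\<lambda>(x, y). Bit2 x y)"
    by (cases c) auto
qed

instance symbol :: finite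
  by standard (simp add: UNIV_symbol)

lemma UNIV_input_cell: "UNIV = {Left_End, Right_End} \<union> range Cell"
proof (intro UNIV_eq_I)
  fix c :: "'i input_cell"
  show "c \<in> {Left_End, Right_End} \<union> range Cell"
    by (cases c) auto
qed

instance input_cell :: (finite) finite
  by standard (simp add: UNIV_input_cell)

lemma UNIV_move: "UNIV = {Stay, Left, Right}"
proof (intro UNIV_eq_I)
  fix c
  show "c \<in> {Stay, Left, Right}"
    by (cases c) auto
qed

instance move :: finite
  by standard (simp add: UNIV_move)

text \<open>A tape with a head: the cells left of the head, nearest first, and the cells from the head
  on, of which there is at least one.\<close>

type_synonym 'x zip = "'x list \<times> 'x list"
type_synonym icell = "symbol input_cell"
type_synonym tapes = "cell zip \<times> cell zip"
type_synonym cfg = "icell zip \<times> tapes"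
type_synonym action = "icell \<Rightarrow> cell \<Rightarrow> cell \<Rightarrow> (move \<times> (cell \<times> move) \<times> (cell \<times> move)) set"

fun go :: "move \<Rightarrow> 'x zip \<Rightarrow> 'x zip" where
  "go Stay z = z"
| "go Left (l, r) = (case l of [] \<Rightarrow> (l, r) | x # l' \<Rightarrow> (l', x # r))"
| "go Right (l, r) = (if tl r = [] then (l, r) else (hd r # l, tl r))"

fun upd :: "cell \<times> move \<Rightarrow> cell zip \<Rightarrow> cell zip" where
  "upd (g, Stay) (l, r) = (l, g # tl r)"
| "upd (g, Left) (l, r) = (case l of [] \<Rightarrow> (l, g # tl r) | x # l' \<Rightarrow> (l', x # g # tl r))"
| "upd (g, Right) (l, r) = (g # l, if tl r = [] then [Blank] else tl r)"

datatype prog = Prim action | Seq prog prog | Alt prog prog | Star prog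

fun post :: "prog \<Rightarrow> cfg \<Rightarrow> cfg set" where
  "post (Prim a) (z, t, s) =
     {(go d z, upd gm t, upd hm s) | d gm hm. (d, gm, hm) \<in> a (hd (snd z)) (hd (snd t)) (hd (snd s))}"
| "post (Seq P Q) c = (\<Union>c'\<in>post P c. post Q c')"
| "post (Alt P Q) c = post P c \<union> post Q c"
| "post (Star P) c = {c'. (c, c') \<in> {(x, y). y \<in> post P x}\<^sup>*}"

lemma post_Star_unfold: "post (Star P) c = insert c (\<Union>c'\<in>post P c. post (Star P) c')"
  by (auto intro: converse_rtrancl_into_rtrancl elim: converse_rtranclE)

text \<open>A loop followed by its exit either exits now or makes one more round. Loops over a tape
  are evaluated by this equation and induction on the cells still ahead.\<close>

lemma post_Seq_Star:
  "post (Seq (Star P) Q) c = post Q c \<union> (\<Union>c'\<in>post P c. post (Seq (Star P) Q) c')"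
  by (subst post.simps(2), subst post_Star_unfold) auto

text \<open>\<open>safe S P c\<close>: all configurations in runs of \<open>P\<close> from \<open>c\<close>, except possibly the last ones,
  belong to \<open>S\<close>.\<close>

fun safe :: "cfg set \<Rightarrow> prog \<Rightarrow> cfg \<Rightarrow> bool" where
  "safe S (Prim a) c \<longleftrightarrow> c \<in> S"
| "safe S (Seq P Q) c \<longleftrightarrow> safe S P c \<and> (\<forall>c'\<in>post P c. safe S Q c')"
| "safe S (Alt P Q) c \<longleftrightarrow> safe S P c \<and> safe S Q c"
| "safe S (Star P) c \<longleftrightarrow> (\<forall>c'\<in>post (Star P) c. c' \<in> S \<and> safe S P c')"

lemma safe_start: "safe S P c \<Longrightarrow> c \<in> S"
  by (induction P arbitrary: c) auto

section \<open>Programs as Turing machines\<close>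

text \<open>The control state of the machine is the stack of programs that remain to be run.\<close>

definition nop :: action where
  "nop = (\<lambda>i g h. {(Stay, (g, Stay), (h, Stay))})"

inductive ctrl :: "prog list \<Rightarrow> action \<Rightarrow> prog list \<Rightarrow> bool" where
  "ctrl (Prim a # K) a K"
| "ctrl (Seq P Q # K) nop (P # Q # K)"
| "ctrl (Alt P Q # K) nop (P # K)"
| "ctrl (Alt P Q # K) nop (Q # K)"
| "ctrl (Star P # K) nop (P # Star P # K)"
| "ctrl (Star P # K) nop K"

text \<open>A finite set that contains all stacks occurring while \<open>P\<close> runs on top of
  \<open>K\<close>; it gives the machine finitely many control states although programs are
  recursive.\<close>

fun conts :: "prog \<Rightarrow> prog list \<Rightarrow> prog list set" where
  "conts (Prim a) K = {Prim a # K, K}"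
| "conts (Seq P Q) K = insert (Seq P Q # K) (conts P (Q # K) \<union> conts Q K)"
| "conts (Alt P Q) K = insert (Alt P Q # K) (conts P K \<union> conts Q K)"
| "conts (Star P) K = {Star P # K, K} \<union> conts P (Star P # K)"

lemma finite_conts: "finite (conts P K)"
  by (induction P arbitrary: K) auto

lemma conts_start: "P # K \<in> conts P K" and conts_end: "K \<in> conts P K"
  by (induction P arbitrary: K) auto

text \<open>The stack \<open>K\<close> is excluded as a source because a step from \<open>K\<close>
  would start the continuation itself, which is not described by \<open>conts P K\<close>.\<close>

lemma conts_closed: "ctrl L a L' \<Longrightarrow> L \<in> conts P K \<Longrightarrow> L \<noteq> K \<Longrightarrow> L' \<in> conts P K"
proof (induction P arbitrary: K)
  case (Prim b)
  then show ?case
    by (auto elim: ctrl.cases)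
next
  case (Seq P Q)
  then show ?case
    using conts_start conts_end by (auto elim: ctrl.cases) metis+
next
  case (Alt P Q)
  then show ?case
    using conts_start by (auto elim: ctrl.cases)
next
  case (Star P)
  show ?case
  proof (cases "L = Star P # K")
    case True
    then show ?thesis
      using Star.prems(1) conts_start[of P "Star P # K"] by (auto elim: ctrl.cases)
  next
    case False
    then show ?thesis
      using Star by simp
  qed
qed

definition state_no :: "prog \<Rightarrow> prog list \<Rightarrow> nat" where
  "state_no P = (SOME f. inj_on f (conts P []))"

lemma state_no_inj: "inj_on (state_no P) (conts P [])"
  unfolding state_no_def using finite_imp_inj_to_nat_seg[OF finite_conts, of P "[]"]
  by (metis someI_ex)

text \<open>\<open>Blank\<close> has to become \<open>0\<close>, the symbol that
  \<open>work_step\<close> puts into a cell visited for the first time.\<close>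

fun cell_no :: "cell \<Rightarrow> nat" where
  "cell_no Blank = 0"
| "cell_no Margin = 1"
| "cell_no Separator = 2"
| "cell_no (Flag x) = 3 + of_bool x"
| "cell_no (Digit x) = 5 + of_bool x"
| "cell_no (Duo x y) = 7 + 2 * of_bool x + of_bool y"

lemma cell_no_inj: "inj cell_no"
proof (rule injI)
  fix x y
  show "cell_no x = cell_no y \<Longrightarrow> x = y"
    by (cases x; cases y) (auto simp: of_bool_def split: if_splits)
qed

text \<open>The empty stack is the accepting state, so a machine accepts iff some run of the program
  ends, that is, iff \<open>post\<close> is nonempty.\<close>

definition machine :: "prog \<Rightarrow> symbol ntm" where
  "machine P = \<lparr>ntm_tapes = 2, ntm_start = state_no P [P], ntm_accept = state_no P [],
     ntm_instrs =
       {(state_no P K, i, [cell_no g, cell_no h], state_no P K', d,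
         [(cell_no g', m), (cell_no h', n)]) | K a K' i g h d g' m h' n.
        K \<in> conts P [] \<and> ctrl K a K' \<and> (d, (g', m), (h', n)) \<in> a i g h}\<rparr>"

lemma finite_ctrl: "finite {(a, K'). ctrl K a K'}"
proof (cases K)
  case Nil
  then have "{(a, K'). ctrl K a K'} = {}"
    by (auto elim: ctrl.cases)
  then show ?thesis
    by simp
next
  case (Cons R L)
  have "{(a, K'). ctrl (R # L) a K'} \<subseteq> (case R of Prim a \<Rightarrow> {(a, L)} | Seq P Q \<Rightarrow> {(nop, P # Q # L)}
      | Alt P Q \<Rightarrow> {(nop, P # L), (nop, Q # L)} | Star P \<Rightarrow> {(nop, P # Star P # L), (nop, L)})"
    by (auto elim: ctrl.cases)
  moreover have "finite \<dots>"
    by (simp split: prog.split)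
  ultimately show ?thesis
    using Cons finite_subset by blast
qed

lemma ntm_machine: "ntm (machine P)"
proof -
  let ?f = "\<lambda>((K, a, K'), i, g, h, d, (g', m), (h', n)).
    (state_no P K, i :: icell, [cell_no g, cell_no h], state_no P K', d :: move,
     [(cell_no g', m :: move), (cell_no h', n :: move)])"
  let ?E = "SIGMA K : conts P []. {(a, K'). ctrl K a K'}"
  have "ntm_instrs (machine P) \<subseteq> ?f ` (?E \<times> UNIV)"
  proof
    fix x
    assume "x \<in> ntm_instrs (machine P)"
    then obtain K a K' i g h d g' m h' n where "x = ?f ((K, a, K'), i, g, h, d, (g', m), (h', n))"
      and "((K, a, K'), i, g, h, d, (g', m), (h', n)) \<in> ?E \<times> UNIV"
      by (auto simp: machine_def)
    then show "x \<in> ?f ` (?E \<times> UNIV)"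
      by (rule image_eqI)
  qed
  moreover have "finite (?f ` (?E \<times> UNIV))"
    using finite_conts finite_ctrl by (intro finite_imageI finite_cartesian_product finite_SigmaI) auto
  ultimately have "finite (ntm_instrs (machine P))"
    using finite_subset by blast
  then show ?thesis
    by (auto simp: ntm_def machine_def)
qed

definition tape_of :: "cell zip \<Rightarrow> work_tape" where
  "tape_of = (\<lambda>(l, r). (map cell_no (rev l @ r), length l))"

definition config_of :: "prog \<Rightarrow> prog list \<Rightarrow> cfg \<Rightarrow> config" where
  "config_of P K = (\<lambda>(z, t, s). (state_no P K, length (fst z), [tape_of t, tape_of s]))"

definition input_cells :: "'i list \<Rightarrow> 'i input_cell list" where
  "input_cells w = Left_End # map Cell w @ [Right_End]"

definition wf_cfg :: "symbol list \<Rightarrow> cfg \<Rightarrow> bool" where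
  "wf_cfg w = (\<lambda>((l, r), (l1, r1), (l2, r2)).
     rev l @ r = input_cells w \<and> r \<noteq> [] \<and> r1 \<noteq> [] \<and> r2 \<noteq> [])"

definition init_cfg :: "symbol list \<Rightarrow> cfg" where
  "init_cfg w = (([], input_cells w), ([], [Blank]), ([], [Blank]))"

lemma input_read_nth: "k \<le> Suc (length w) \<Longrightarrow> input_read w k = input_cells w ! k"
  by (auto simp: input_read_def input_cells_def nth_Cons' nth_append)

lemma input_read_zip:
  assumes "rev l @ r = input_cells w" "r \<noteq> []"
  shows "input_read w (length l) = hd r"
proof -
  have "length l + length r = length w + 2"
    using arg_cong[OF assms(1), of length] by (simp add: input_cells_def)
  moreover have "length r > 0"
    using assms by simp
  ultimately have "length l \<le> Suc (length w)"
    by linarith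
  then show ?thesis
    using assms input_read_nth by (metis hd_conv_nth length_rev nth_append_length_plus add_0_right)
qed

lemma input_move_zip:
  assumes "rev l @ r = input_cells w" "r \<noteq> []"
  shows "input_move w d (length l) = length (fst (go d (l, r)))"
proof -
  have len: "length l + length r = length w + 2"
    using arg_cong[OF assms(1), of length] by (simp add: input_cells_def)
  show ?thesis
  proof (cases d)
    case Right
    have "length (tl r) = length r - 1"
      by simp
    then show ?thesis
      using Right len assms(2) by (cases r; cases "tl r") auto
  qed (auto split: list.split)
qed

lemma go_wf: "rev l @ r = c \<Longrightarrow> r \<noteq> [] \<Longrightarrow> go d (l, r) = (l', r') \<Longrightarrow> rev l' @ r' = c \<and> r' \<noteq> []"
  by (cases d; cases r) (auto split: list.splits if_splits)

lemma work_read_tape: "r \<noteq> [] \<Longrightarrow> work_read (tape_of (l, r)) = cell_no (hd r)"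
  by (cases r) (auto simp: tape_of_def nth_append)

lemma work_step_tape:
  assumes "r \<noteq> []"
  shows "work_step (cell_no g, m) (tape_of (l, r)) = tape_of (upd (g, m) (l, r))"
proof -
  obtain x r' where "r = x # r'"
    using assms by (cases r) auto
  then show ?thesis
    by (cases m) (auto simp: tape_of_def list_update_append split: list.split)
qed

lemma upd_wf: "r \<noteq> [] \<Longrightarrow> snd (upd gm (l, r)) \<noteq> []"
  by (cases gm; cases "snd gm") (auto split: list.splits)

lemma post_Prim_wf: "wf_cfg w c \<Longrightarrow> c' \<in> post (Prim a) c \<Longrightarrow> wf_cfg w c'"
proof -
  assume wf: "wf_cfg w c" and c': "c' \<in> post (Prim a) c"
  obtain il ir l1 r1 l2 r2 where c: "c = ((il, ir), (l1, r1), (l2, r2))"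
    by (metis prod.exhaust)
  from c' obtain d gm hm where "c' = (go d (il, ir), upd gm (l1, r1), upd hm (l2, r2))"
    unfolding c by auto
  then show ?thesis
    using wf go_wf[of il ir "input_cells w" d] upd_wf[of r1 gm l1] upd_wf[of r2 hm l2]
    unfolding c wf_cfg_def by (auto split: prod.splits)
qed

text \<open>The simulation is exact because \<open>state_no P\<close> is injective on
  \<open>conts P []\<close>: the number of the control state determines the stack.\<close>

lemma machine_step_iff:
  assumes wf: "wf_cfg w c" and K: "K \<in> conts P []"
  shows "ntm_step (machine P) w (config_of P K c) x \<longleftrightarrow>
    (\<exists>a K' c'. ctrl K a K' \<and> c' \<in> post (Prim a) c \<and> x = config_of P K' c')"
proof -
  obtain il ir l1 r1 l2 r2 where c: "c = ((il, ir), (l1, r1), (l2, r2))"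
    by (metis prod.exhaust)
  have w: "rev il @ ir = input_cells w" "ir \<noteq> []" "r1 \<noteq> []" "r2 \<noteq> []"
    using wf unfolding c wf_cfg_def by auto
  show ?thesis
  proof
    assume "ntm_step (machine P) w (config_of P K c) x"
    then obtain s' d ws where instr: "(state_no P K, input_read w (length il),
        map work_read [tape_of (l1, r1), tape_of (l2, r2)], s', d, ws) \<in> ntm_instrs (machine P)"
      and x: "x = (s', input_move w d (length il), map2 work_step ws [tape_of (l1, r1), tape_of (l2, r2)])"
      unfolding c config_of_def by (auto elim: ntm_step.cases)
    from instr obtain K1 a K' g h g' m h' n where k: "K1 \<in> conts P []" "state_no P K1 = state_no P K"
      "ctrl K1 a K'" "cell_no g = cell_no (hd r1)" "cell_no h = cell_no (hd r2)"
      "(d, (g', m), (h', n)) \<in> a (hd ir) g h"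
      "s' = state_no P K'" "ws = [(cell_no g', m), (cell_no h', n)]"
      using w by (auto simp: machine_def work_read_tape input_read_zip)
    have "K1 = K"
      using k K state_no_inj by (metis inj_onD)
    moreover have "g = hd r1" "h = hd r2"
      using k cell_no_inj by (metis injD)+
    moreover have "x = config_of P K' (go d (il, ir), upd (g', m) (l1, r1), upd (h', n) (l2, r2))"
      using w k unfolding x config_of_def
      by (simp add: work_step_tape input_move_zip)
    moreover have "(go d (il, ir), upd (g', m) (l1, r1), upd (h', n) (l2, r2)) \<in> post (Prim a) c"
      if "g = hd r1" "h = hd r2"
      unfolding c post.simps snd_conv using k(6) that by blast
    ultimately show "\<exists>a K' c'. ctrl K a K' \<and> c' \<in> post (Prim a) c \<and> x = config_of P K' c'"
      using k(3) by blast
  next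
    assume "\<exists>a K' c'. ctrl K a K' \<and> c' \<in> post (Prim a) c \<and> x = config_of P K' c'"
    then obtain a K' d g' m h' n where k: "ctrl K a K'" "(d, (g', m), (h', n)) \<in> a (hd ir) (hd r1) (hd r2)"
      "x = config_of P K' (go d (il, ir), upd (g', m) (l1, r1), upd (h', n) (l2, r2))"
      unfolding c by auto
    have "(state_no P K, input_read w (length il), map work_read [tape_of (l1, r1), tape_of (l2, r2)],
       state_no P K', d, [(cell_no g', m), (cell_no h', n)]) \<in> ntm_instrs (machine P)"
      using k K w by (simp add: machine_def work_read_tape input_read_zip) blast
    from ntm_step.intros[OF this] show "ntm_step (machine P) w (config_of P K c) x"
      unfolding k(3) c config_of_def using w by (simp add: work_step_tape input_move_zip)
  qed
qed

lemma init_config: "ntm_init (machine P) = config_of P [P] (init_cfg w)"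
  by (simp add: ntm_init_def machine_def config_of_def init_cfg_def tape_of_def numeral_2_eq_2)

lemma wf_init: "wf_cfg w (init_cfg w)"
  by (simp add: wf_cfg_def init_cfg_def input_cells_def)

fun post_all :: "prog list \<Rightarrow> cfg \<Rightarrow> cfg set" where
  "post_all [] c = {c}"
| "post_all (P # K) c = (\<Union>c'\<in>post P c. post_all K c')"

fun safe_all :: "cfg set \<Rightarrow> prog list \<Rightarrow> cfg \<Rightarrow> bool" where
  "safe_all S [] c \<longleftrightarrow> c \<in> S"
| "safe_all S (P # K) c \<longleftrightarrow> safe S P c \<and> (\<forall>c'\<in>post P c. safe_all S K c')"

lemma safe_all_start: "safe_all S K c \<Longrightarrow> c \<in> S"
  by (cases K) (auto dest: safe_start)

lemma post_nop: "wf_cfg w c \<Longrightarrow> post (Prim nop) c = {c}"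
  by (auto simp: nop_def wf_cfg_def split: prod.splits)

text \<open>Along a computation the outcomes still possible can only shrink, and safety persists.
  Both together form the invariant for all reachable configurations.\<close>

lemma ctrl_invariant:
  assumes "ctrl K a K'" "wf_cfg w c" "c' \<in> post (Prim a) c"
  shows "post_all K' c' \<subseteq> post_all K c \<and> (safe_all S K c \<longrightarrow> safe_all S K' c')"
  using assms
proof (induction rule: ctrl.induct)
  case (5 P K)
  then have [simp]: "c' = c"
    using post_nop by blast
  have "post (Seq P (Star P)) c \<subseteq> post (Star P) c"
    using post_Star_unfold[of P c] by auto
  moreover have "c \<in> post (Star P) c"
    by simp
  moreover have "post (Star P) d \<subseteq> post (Star P) c" if "d \<in> post P c" for d
    using calculation that by auto
  ultimately show ?case
    by (auto simp del: post.simps(4) simp: subset_eq)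
next
  case (6 P K)
  then have [simp]: "c' = c"
    using post_nop by blast
  have "c \<in> post (Star P) c"
    by simp
  then show ?case
    by (auto simp del: post.simps(4))
qed (auto simp: post_nop simp del: post.simps(1,4))

definition prog_step :: "prog list \<times> cfg \<Rightarrow> prog list \<times> cfg \<Rightarrow> bool" where
  "prog_step = (\<lambda>(K, c) (K', c'). \<exists>a. ctrl K a K' \<and> c' \<in> post (Prim a) c)"

lemma prog_stepI: "ctrl K a K' \<Longrightarrow> c' \<in> post (Prim a) c \<Longrightarrow> prog_step (K, c) (K', c')"
  by (auto simp: prog_step_def simp del: post.simps)

lemma prog_step_nop: "ctrl K nop K' \<Longrightarrow> wf_cfg w c \<Longrightarrow> prog_step (K, c) (K', c)"
  using prog_stepI post_nop by blast

lemma ctrl_complete: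
  assumes "c' \<in> post P c" "wf_cfg w c"
  shows "wf_cfg w c' \<and> prog_step\<^sup>*\<^sup>* (P # K, c) (K, c')"
  using assms(1,2)
proof (induction P arbitrary: c c' K)
  case (Prim a)
  then show ?case
    using post_Prim_wf prog_stepI[OF ctrl.intros(1)] by blast
next
  case (Seq P Q)
  then obtain d where d: "d \<in> post P c" "c' \<in> post Q d"
    by auto
  have "prog_step (Seq P Q # K, c) (P # Q # K, c)"
    using prog_step_nop[OF _ Seq.prems(2)] ctrl.intros(2) by blast+
  moreover have "prog_step\<^sup>*\<^sup>* (P # Q # K, c) (Q # K, d)" "wf_cfg w d"
    using Seq.IH(1) d Seq.prems by blast+
  moreover have "prog_step\<^sup>*\<^sup>* (Q # K, d) (K, c')" "wf_cfg w c'"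
    using Seq.IH(2) d calculation by blast+
  ultimately show ?case
    by (meson converse_rtranclp_into_rtranclp rtranclp_trans)
next
  case (Alt P Q)
  have "prog_step (Alt P Q # K, c) (P # K, c)" "prog_step (Alt P Q # K, c) (Q # K, c)"
    using prog_step_nop[OF _ Alt.prems(2)] ctrl.intros(3,4) by blast+
  moreover have "c' \<in> post P c \<or> c' \<in> post Q c"
    using Alt.prems by simp
  then have "wf_cfg w c' \<and> (prog_step\<^sup>*\<^sup>* (P # K, c) (K, c') \<or> prog_step\<^sup>*\<^sup>* (Q # K, c) (K, c'))"
    using Alt.IH Alt.prems(2) by blast
  ultimately show ?case
    by (meson converse_rtranclp_into_rtranclp)
next
  case (Star P)
  have "(c, c') \<in> {(x, y). y \<in> post P x}\<^sup>*"
    using Star.prems by simp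
  then show ?case
    using Star.prems(2)
  proof (induction rule: converse_rtrancl_induct)
    case base
    have "prog_step (Star P # K, c') (K, c')"
      using prog_step_nop[OF _ base] ctrl.intros(6) by blast+
    then show ?case
      using base by blast
  next
    case (step x y)
    have "prog_step (Star P # K, x) (P # Star P # K, x)"
      using prog_step_nop[OF _ step.prems] ctrl.intros(5) by blast+
    moreover have "prog_step\<^sup>*\<^sup>* (P # Star P # K, x) (Star P # K, y)" "wf_cfg w y"
      using Star.IH step by blast+
    moreover have "prog_step\<^sup>*\<^sup>* (Star P # K, y) (K, c')" "wf_cfg w c'"
      using step.IH calculation by blast+
    ultimately show ?case
      by (meson converse_rtranclp_into_rtranclp rtranclp_trans)
  qed
qed

lemma machine_reachable:
  assumes "ntm_reachable (machine P) w x" "safe_all S [P] (init_cfg w)"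
  shows "\<exists>K c. x = config_of P K c \<and> K \<in> conts P [] \<and> wf_cfg w c \<and>
    post_all K c \<subseteq> post P (init_cfg w) \<and> safe_all S K c"
  using assms(1) unfolding ntm_reachable_def
proof (induction rule: rtranclp_induct)
  case base
  have "post_all [P] (init_cfg w) \<subseteq> post P (init_cfg w)"
    by simp
  then show ?case
    using assms(2) init_config[of P w] conts_start[of P "[]"] wf_init by blast
next
  case (step x y)
  then obtain K c where x: "x = config_of P K c" "K \<in> conts P []" "wf_cfg w c"
    "post_all K c \<subseteq> post P (init_cfg w)" "safe_all S K c"
    by blast
  then obtain a K' c' where y: "ctrl K a K'" "c' \<in> post (Prim a) c" "y = config_of P K' c'"
    using machine_step_iff step.hyps by blast
  have "K \<noteq> []"
    using y(1) by (auto elim: ctrl.cases)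
  then have "K' \<in> conts P []"
    using conts_closed y(1) x(2) by blast
  then show ?case
    using y x ctrl_invariant[OF y(1) x(3) y(2)] post_Prim_wf by blast
qed

lemma machine_accepts_iff:
  "ntm_accepts (machine P) w \<longleftrightarrow> post P (init_cfg w) \<noteq> {}"
proof
  assume "ntm_accepts (machine P) w"
  then obtain k ts where "ntm_reachable (machine P) w (state_no P [], k, ts)"
    unfolding ntm_accepts_def by (auto simp: machine_def)
  \<comment> \<open>Safety with respect to \<open>UNIV\<close> is trivial; it is supplied only so
    that the invariant on outcomes becomes available.\<close>
  moreover have "safe UNIV P c" for c
    by (induction P arbitrary: c) auto
  then have "safe_all UNIV [P] (init_cfg w)"
    by simp
  ultimately obtain K c where K: "(state_no P [], k, ts) = config_of P K c" "K \<in> conts P []"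
    "post_all K c \<subseteq> post P (init_cfg w)"
    using machine_reachable by blast
  then have "state_no P K = state_no P []"
    by (auto simp: config_of_def split: prod.splits)
  then have "K = []"
    using state_no_inj K(2) conts_end by (metis inj_onD)
  then show "post P (init_cfg w) \<noteq> {}"
    using K by auto
next
  assume "post P (init_cfg w) \<noteq> {}"
  then obtain c' where c': "c' \<in> post P (init_cfg w)"
    by blast
  have run: "prog_step\<^sup>*\<^sup>* ([P], init_cfg w) ([], c')"
    using ctrl_complete[OF c' wf_init] by blast
  have "K \<in> conts P [] \<and> wf_cfg w c \<and> ntm_reachable (machine P) w (config_of P K c)"
    if "prog_step\<^sup>*\<^sup>* ([P], init_cfg w) (K, c)" for K c
    using that unfolding ntm_reachable_def
  proof (induction "(K, c)" arbitrary: K c rule: rtranclp_induct)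
    case base
    then show ?case
      using init_config[of P w] conts_start[of P "[]"] wf_init by simp
  next
    case (step y)
    obtain L d where y: "y = (L, d)"
      by (rule prod.exhaust)
    then obtain a where a: "ctrl L a K" "c \<in> post (Prim a) d"
      using step.hyps by (auto simp: prog_step_def simp del: post.simps)
    have IH: "L \<in> conts P []" "wf_cfg w d"
      "(ntm_step (machine P) w)\<^sup>*\<^sup>* (ntm_init (machine P)) (config_of P L d)"
      using step.hyps y by blast+
    have "L \<noteq> []"
      using a(1) by (auto elim: ctrl.cases)
    then have "K \<in> conts P []"
      using conts_closed a IH by blast
    moreover have "ntm_step (machine P) w (config_of P L d) (config_of P K c)"
      using machine_step_iff[OF IH(2,1)] a by blast
    ultimately show ?case
      using IH post_Prim_wf[OF IH(2) a(2)] by (meson rtranclp.rtrancl_into_rtrancl)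
  qed
  then have "ntm_reachable (machine P) w (config_of P [] c')"
    using run by blast
  then show "ntm_accepts (machine P) w"
    unfolding ntm_accepts_def by (cases c') (auto simp: config_of_def machine_def)
qed

fun space :: "cfg \<Rightarrow> nat" where
  "space ((il, ir), (l1, r1), (l2, r2)) = length l1 + length r1 + length l2 + length r2"

lemma machine_space:
  assumes "ntm_reachable (machine P) w x" "safe_all {c. space c \<le> N} [P] (init_cfg w)"
  shows "config_space x \<le> N"
proof -
  obtain K c where x: "x = config_of P K c" and "safe_all {c. space c \<le> N} K c"
    using machine_reachable[OF assms] by blast
  then have "space c \<le> N"
    using safe_all_start by blast
  then show ?thesis
    unfolding x by (cases c rule: space.cases) (auto simp: config_of_def tape_of_def)
qed

section \<open>Programs for single head movements\<close>

definition onI :: "(icell \<Rightarrow> move set) \<Rightarrow> prog" where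
  "onI f = Prim (\<lambda>i g h. {(d, (g, Stay), (h, Stay)) | d. d \<in> f i})"

definition on1 :: "(cell \<Rightarrow> (cell \<times> move) set) \<Rightarrow> prog" where
  "on1 f = Prim (\<lambda>i g h. {(Stay, gm, (h, Stay)) | gm. gm \<in> f g})"

definition on2 :: "(cell \<Rightarrow> (cell \<times> move) set) \<Rightarrow> prog" where
  "on2 f = Prim (\<lambda>i g h. {(Stay, (g, Stay), hm) | hm. hm \<in> f h})"

definition onI1 :: "(icell \<Rightarrow> cell \<Rightarrow> (move \<times> cell \<times> move) set) \<Rightarrow> prog" where
  "onI1 f = Prim (\<lambda>i g h. {(d, gm, (h, Stay)) | d gm. (d, gm) \<in> f i g})"

definition onI2 :: "(icell \<Rightarrow> cell \<Rightarrow> (move \<times> cell \<times> move) set) \<Rightarrow> prog" where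
  "onI2 f = Prim (\<lambda>i g h. {(d, (g, Stay), hm) | d hm. (d, hm) \<in> f i h})"

definition ok :: "cell zip \<Rightarrow> bool" where
  "ok z \<longleftrightarrow> snd z \<noteq> []"

lemma ok_simp [simp]: "ok (l, r) \<longleftrightarrow> r \<noteq> []"
  by (simp add: ok_def)

lemma upd_ok: "ok z \<Longrightarrow> upd (hd (snd z), Stay) z = z"
  by (cases z) simp

lemma post_onI: "ok t \<Longrightarrow> ok s \<Longrightarrow> post (onI f) (z, t, s) = (\<lambda>d. (go d z, t, s)) ` f (hd (snd z))"
  by (force simp: onI_def upd_ok simp del: upd.simps)

lemma post_on1: "ok s \<Longrightarrow> post (on1 f) (z, t, s) = (\<lambda>gm. (z, upd gm t, s)) ` f (hd (snd t))"
  by (force simp: on1_def upd_ok simp del: upd.simps)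

lemma post_on2: "ok t \<Longrightarrow> post (on2 f) (z, t, s) = (\<lambda>hm. (z, t, upd hm s)) ` f (hd (snd s))"
  by (force simp: on2_def upd_ok simp del: upd.simps)

lemma post_onI1: "ok s \<Longrightarrow> post (onI1 f) (z, t, s) =
    (\<lambda>(d, gm). (go d z, upd gm t, s)) ` f (hd (snd z)) (hd (snd t))"
  by (force simp: onI1_def upd_ok simp del: upd.simps)

lemma post_onI2: "ok t \<Longrightarrow> post (onI2 f) (z, t, s) =
    (\<lambda>(d, hm). (go d z, t, upd hm s)) ` f (hd (snd z)) (hd (snd s))"
  by (force simp: onI2_def upd_ok simp del: upd.simps)

lemmas post_on = post_onI post_on1 post_on2 post_onI1 post_onI2

declare post.simps(1,4) [simp del]

definition home1 :: prog where
  "home1 = Seq (Star (on1 (\<lambda>g. if g = Margin then {} else {(g, Left)})))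
    (on1 (\<lambda>g. if g = Margin then {(g, Stay)} else {}))"

definition home2 :: prog where
  "home2 = Seq (Star (on2 (\<lambda>g. if g = Margin then {} else {(g, Left)})))
    (on2 (\<lambda>g. if g = Margin then {(g, Stay)} else {}))"

lemma post_home1:
  assumes "Margin \<notin> set xs" "ok s"
  shows "rev l @ r = Margin # xs \<Longrightarrow> r \<noteq> [] \<Longrightarrow> post home1 (z, (l, r), s) = {(z, ([], Margin # xs), s)}"
proof (induction l arbitrary: r)
  case Nil
  then show ?case
    using assms(2) unfolding home1_def by (subst post_Seq_Star) (simp add: post_on)
next
  case (Cons y l)
  have "rev l @ y # r = Margin # xs"
    using Cons.prems by simp
  then have "hd r \<in> set xs"
    using Cons.prems by (cases "rev l") auto
  then have "hd r \<noteq> Margin"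
    using assms by metis
  then have "post home1 (z, (y # l, r), s) = post home1 (z, (l, y # r), s)"
    using assms(2) Cons.prems(2) unfolding home1_def by (subst post_Seq_Star) (simp add: post_on)
  then show ?case
    using Cons by simp
qed

lemma post_home2:
  assumes "Margin \<notin> set xs" "ok t"
  shows "rev l @ r = Margin # xs \<Longrightarrow> r \<noteq> [] \<Longrightarrow> post home2 (z, t, (l, r)) = {(z, t, ([], Margin # xs))}"
proof (induction l arbitrary: r)
  case Nil
  then show ?case
    using assms(2) unfolding home2_def by (subst post_Seq_Star) (simp add: post_on)
next
  case (Cons y l)
  have "rev l @ y # r = Margin # xs"
    using Cons.prems by simp
  then have "hd r \<in> set xs"
    using Cons.prems by (cases "rev l") auto
  then have "hd r \<noteq> Margin"
    using assms by metis
  then have "post home2 (z, t, (y # l, r)) = post home2 (z, t, (l, y # r))"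
    using assms(2) Cons.prems(2) unfolding home2_def by (subst post_Seq_Star) (simp add: post_on)
  then show ?case
    using Cons by simp
qed

definition sweep1 :: "(cell \<Rightarrow> cell set) \<Rightarrow> (cell \<Rightarrow> (cell \<times> move) set) \<Rightarrow> prog" where
  "sweep1 F f = Seq (Star (on1 (\<lambda>g. (\<lambda>g'. (g', Right)) ` F g))) (on1 f)"

definition sweep2 :: "(cell \<Rightarrow> cell set) \<Rightarrow> (cell \<Rightarrow> (cell \<times> move) set) \<Rightarrow> prog" where
  "sweep2 F f = Seq (Star (on2 (\<lambda>g. (\<lambda>g'. (g', Right)) ` F g))) (on2 f)"

text \<open>Cells of \<open>xs\<close> offer no exit and \<open>b\<close> offers no rewriting, so
  every run rewrites exactly \<open>xs\<close> and leaves the loop at \<open>b\<close>.\<close>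

lemma post_sweep1:
  assumes "F b = {}" "ok s"
  shows "\<forall>x\<in>set xs. f x = {} \<Longrightarrow> post (sweep1 F f) (z, (l, xs @ b # bs), s) =
    {(z, upd gm (rev ys @ l, b # bs), s) | ys gm. list_all2 (\<lambda>x y. y \<in> F x) xs ys \<and> gm \<in> f b}"
proof (induction xs arbitrary: l)
  case Nil
  then show ?case
    using assms unfolding sweep1_def by (subst post_Seq_Star) (auto simp: post_on)
next
  case (Cons x xs)
  have "post (sweep1 F f) (z, (l, (x # xs) @ b # bs), s) =
    (\<Union>y\<in>F x. post (sweep1 F f) (z, (y # l, xs @ b # bs), s))"
    using assms Cons.prems unfolding sweep1_def by (subst post_Seq_Star) (simp add: post_on)
  also have "\<dots> = (\<Union>y\<in>F x. {(z, upd gm (rev ys @ y # l, b # bs), s) | ys gm.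
      list_all2 (\<lambda>x y. y \<in> F x) xs ys \<and> gm \<in> f b})"
    using Cons by simp
  also have "\<dots> = {(z, upd gm (rev ys @ l, b # bs), s) | ys gm.
      list_all2 (\<lambda>x y. y \<in> F x) (x # xs) ys \<and> gm \<in> f b}"
    (is "?L = ?R")
  proof (intro set_eqI iffI)
    fix c
    assume "c \<in> ?L"
    then obtain y ys gm where "y \<in> F x" "list_all2 (\<lambda>x y. y \<in> F x) xs ys" "gm \<in> f b"
      and "c = (z, upd gm (rev ys @ y # l, b # bs), s)"
      by blast
    then show "c \<in> ?R"
      by (intro CollectI exI[of _ "y # ys"] exI[of _ gm]) simp
  next
    fix c
    assume "c \<in> ?R"
    then show "c \<in> ?L"
    proof -
      obtain ys' gm where ys': "list_all2 (\<lambda>x y. y \<in> F x) (x # xs) ys'" "gm \<in> f b"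
        and c: "c = (z, upd gm (rev ys' @ l, b # bs), s)"
        using \<open>c \<in> ?R\<close> by blast
      from ys'(1) obtain y ys where "ys' = y # ys" "y \<in> F x" "list_all2 (\<lambda>x y. y \<in> F x) xs ys"
        by (auto simp: list_all2_Cons1)
      moreover from this(1) have "c = (z, upd gm (rev ys @ y # l, b # bs), s)"
        using c by simp
      ultimately show ?thesis
        using ys'(2) by blast
    qed
  qed
  finally show ?case .
qed

lemma post_sweep2:
  assumes "F b = {}" "ok t"
  shows "\<forall>x\<in>set xs. f x = {} \<Longrightarrow> post (sweep2 F f) (z, t, (l, xs @ b # bs)) =
    {(z, t, upd gm (rev ys @ l, b # bs)) | ys gm. list_all2 (\<lambda>x y. y \<in> F x) xs ys \<and> gm \<in> f b}"
proof (induction xs arbitrary: l)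
  case Nil
  then show ?case
    using assms unfolding sweep2_def by (subst post_Seq_Star) (auto simp: post_on)
next
  case (Cons x xs)
  have "post (sweep2 F f) (z, t, (l, (x # xs) @ b # bs)) =
    (\<Union>y\<in>F x. post (sweep2 F f) (z, t, (y # l, xs @ b # bs)))"
    using assms Cons.prems unfolding sweep2_def by (subst post_Seq_Star) (simp add: post_on)
  also have "\<dots> = (\<Union>y\<in>F x. {(z, t, upd gm (rev ys @ y # l, b # bs)) | ys gm.
      list_all2 (\<lambda>x y. y \<in> F x) xs ys \<and> gm \<in> f b})"
    using Cons by simp
  also have "\<dots> = {(z, t, upd gm (rev ys @ l, b # bs)) | ys gm.
      list_all2 (\<lambda>x y. y \<in> F x) (x # xs) ys \<and> gm \<in> f b}"
    (is "?L = ?R")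
  proof (intro set_eqI iffI)
    fix c
    assume "c \<in> ?L"
    then obtain y ys gm where "y \<in> F x" "list_all2 (\<lambda>x y. y \<in> F x) xs ys" "gm \<in> f b"
      and "c = (z, t, upd gm (rev ys @ y # l, b # bs))"
      by blast
    then show "c \<in> ?R"
      by (intro CollectI exI[of _ "y # ys"] exI[of _ gm]) simp
  next
    fix c
    assume "c \<in> ?R"
    then show "c \<in> ?L"
    proof -
      obtain ys' gm where ys': "list_all2 (\<lambda>x y. y \<in> F x) (x # xs) ys'" "gm \<in> f b"
        and c: "c = (z, t, upd gm (rev ys' @ l, b # bs))"
        using \<open>c \<in> ?R\<close> by blast
      from ys'(1) obtain y ys where "ys' = y # ys" "y \<in> F x" "list_all2 (\<lambda>x y. y \<in> F x) xs ys"
        by (auto simp: list_all2_Cons1)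
      moreover from this(1) have "c = (z, t, upd gm (rev ys @ y # l, b # bs))"
        using c by simp
      ultimately show ?thesis
        using ys'(2) by blast
    qed
  qed
  finally show ?case .
qed

section \<open>Searching the input\<close>

definition inz :: "symbol list \<Rightarrow> icell zip \<Rightarrow> bool" where
  "inz w z \<longleftrightarrow> rev (fst z) @ snd z = input_cells w \<and> snd z \<noteq> []"

text \<open>A nondeterministic jump. It replaces a stored pointer into the input, for which the
  space bound would have to provide room.\<close>

definition seek :: prog where
  "seek = Star (onI (\<lambda>_. {Left, Right}))"

lemma inz_go: "inz w z \<Longrightarrow> inz w (go d z)"
  using go_wf[of "fst z" "snd z" "input_cells w" d] unfolding inz_def by (metis prod.collapse)

lemma seek_step:
  assumes "ok t" "ok s" "d = Left \<or> d = Right"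
  shows "((z, t, s), (go d z, t, s)) \<in> {(x, y). y \<in> post (onI (\<lambda>_. {Left, Right})) x}"
  using assms by (auto simp: post_on)

text \<open>Every position is reached by going to the left end and then to the right.\<close>

lemma post_seek:
  assumes ok: "ok t" "ok s" and z: "inz w z"
  shows "post seek (z, t, s) = {(z', t, s) | z'. inz w z'}"
proof -
  let ?R = "{(x, y). y \<in> post (onI (\<lambda>_. {Left, Right})) x}"
  have "\<exists>z'. c = (z', t, s) \<and> inz w z'" if "((z, t, s), c) \<in> ?R\<^sup>*" for c
    using that
  proof (induction rule: rtrancl_induct)
    case (step x y)
    then obtain z' where z': "x = (z', t, s)" "inz w z'"
      by blast
    then obtain d where "y = (go d z', t, s)"
      using step.hyps ok by (auto simp: post_on simp del: go.simps)
    then show ?case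
      using inz_go z' by blast
  qed (use z in auto)
  moreover have "((z, t, s), (z', t, s)) \<in> ?R\<^sup>*" if z': "inz w z'" for z'
  proof -
    have left: "(((l, r), t, s), (([], rev l @ r), t, s)) \<in> ?R\<^sup>*" for l r
    proof (induction l arbitrary: r)
      case (Cons x l)
      have "(((x # l, r), t, s), ((l, x # r), t, s)) \<in> ?R"
        using seek_step[OF ok, of Left "(x # l, r)"] by simp
      then show ?case
        using Cons[of "x # r"] by (simp add: converse_rtrancl_into_rtrancl)
    qed auto
    have right: "((([], xs @ r), t, s), ((rev xs, r), t, s)) \<in> ?R\<^sup>*" if "r \<noteq> []" for xs r
      using that
    proof (induction xs arbitrary: r rule: rev_induct)
      case (snoc x xs)
      have "(((rev xs, x # r), t, s), ((x # rev xs, r), t, s)) \<in> ?R"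
        using seek_step[OF ok, of Right "(rev xs, x # r)"] snoc.prems by simp
      then show ?case
        using snoc.IH[of "x # r"] by (simp add: rtrancl_into_rtrancl)
    qed auto
    obtain l r l' r' where zz: "z = (l, r)" "z' = (l', r')"
      by (cases z, cases z')
    have "rev l @ r = rev l' @ r'" "r' \<noteq> []"
      using z z' by (simp_all add: zz inz_def)
    then show ?thesis
      using rtrancl_trans[OF left[of l r]] right[of r' "rev l'"] by (simp add: zz)
  qed
  ultimately show ?thesis
    unfolding seek_def post.simps(4) by blast
qed

lemma post_inz: "c' \<in> post P c \<Longrightarrow> inz w (fst c) \<Longrightarrow> inz w (fst c')"
proof (induction P arbitrary: c c')
  case (Prim a)
  then show ?case
    using inz_go by (cases c rule: prod_cases3) (auto simp: post.simps(1) simp del: go.simps)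
next
  case (Star P)
  from Star.prems(1) have "(c, c') \<in> {(x, y). y \<in> post P x}\<^sup>*"
    by (simp add: post.simps(4))
  then show ?case
    by (induction rule: rtrancl_induct) (use Star in auto)
qed auto

text \<open>The position of the input head is forgotten: every access to the input starts by moving the head to
  an arbitrary position.\<close>

definition gives :: "symbol list \<Rightarrow> prog \<Rightarrow> tapes \<Rightarrow> tapes set \<Rightarrow> bool" where
  "gives w P ts X \<longleftrightarrow> (\<forall>z. inz w z \<longrightarrow> snd ` post P (z, ts) = X)"

lemma gives_Seq:
  assumes "gives w P ts X" "\<And>ts'. ts' \<in> X \<Longrightarrow> gives w Q ts' (Y ts')"
  shows "gives w (Seq P Q) ts (\<Union>ts'\<in>X. Y ts')"
  unfolding gives_def
proof (intro allI impI)
  fix z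
  assume z: "inz w z"
  have "snd ` post (Seq P Q) (z, ts) = (\<Union>c\<in>post P (z, ts). snd ` post Q c)"
    by auto
  also have "\<dots> = (\<Union>c\<in>post P (z, ts). Y (snd c))"
  proof (rule SUP_cong[OF refl])
    fix c
    assume c: "c \<in> post P (z, ts)"
    have "snd c \<in> X"
      using assms(1) z c unfolding gives_def by blast
    moreover have "inz w (fst c)"
      using post_inz[OF c] z by simp
    ultimately show "snd ` post Q c = Y (snd c)"
      using assms(2) unfolding gives_def by (metis prod.collapse)
  qed
  also have "\<dots> = (\<Union>ts'\<in>snd ` post P (z, ts). Y ts')"
    by simp
  finally show "snd ` post (Seq P Q) (z, ts) = (\<Union>ts'\<in>X. Y ts')"
    using assms(1) z unfolding gives_def by simp
qed

lemma inz_start: "inz w ([], input_cells w)"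
  by (simp add: inz_def input_cells_def)

lemma gives_Seq_image:
  assumes P: "gives w P ts (\<sigma> ` A)" and Q: "\<And>y. y \<in> A \<Longrightarrow> gives w Q (\<sigma> y) (Y y)"
  shows "gives w (Seq P Q) ts (\<Union>y\<in>A. Y y)"
proof -
  define Z where "Z ts' = snd ` post Q (([], input_cells w), ts')" for ts'
  have Z: "Z (\<sigma> y) = Y y" if "y \<in> A" for y
    using Q[OF that] inz_start unfolding Z_def gives_def by blast
  have "gives w (Seq P Q) ts (\<Union>ts'\<in>\<sigma> ` A. Z ts')"
  proof (rule gives_Seq[OF P])
    fix ts'
    assume "ts' \<in> \<sigma> ` A"
    then show "gives w Q ts' (Z ts')"
      using Q Z by auto
  qed
  then show ?thesis
    using Z by simp
qed

definition impl :: "symbol list \<Rightarrow> ('x \<Rightarrow> tapes) \<Rightarrow> prog \<Rightarrow> ('x \<Rightarrow> 'y \<Rightarrow> bool) \<Rightarrow> ('y \<Rightarrow> tapes) \<Rightarrow> bool" where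
  "impl w \<rho> P R \<sigma> \<longleftrightarrow> (\<forall>x. gives w P (\<rho> x) (\<sigma> ` {y. R x y}))"

text \<open>Each round may leave the input head anywhere, but the outcome of a round is the same for
  all head positions. Hence exactness of one round carries over to the iteration.\<close>

lemma impl_Star:
  assumes "impl w \<rho> P R \<rho>"
  shows "impl w \<rho> (Star P) R\<^sup>*\<^sup>* \<rho>"
  unfolding impl_def gives_def
proof (intro allI impI)
  fix x z
  assume z: "inz w z"
  let ?S = "{(c, c'). c' \<in> post P c}"
  have sound: "\<exists>y. R\<^sup>*\<^sup>* x y \<and> snd c = \<rho> y \<and> inz w (fst c)" if "((z, \<rho> x), c) \<in> ?S\<^sup>*" for c
    using that
  proof (induction rule: rtrancl_induct)
    case base
    then show ?case
      using z by auto
  next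
    case (step c c')
    then obtain y where y: "R\<^sup>*\<^sup>* x y" "snd c = \<rho> y" "inz w (fst c)"
      by blast
    have c': "c' \<in> post P (fst c, \<rho> y)"
      using step.hyps y by (metis (no_types, lifting) case_prodD mem_Collect_eq prod.collapse)
    then have "snd c' \<in> \<rho> ` {y'. R y y'}"
      using assms y(3) unfolding impl_def gives_def by blast
    moreover have "inz w (fst c')"
      using post_inz[OF c'] y by simp
    ultimately show ?case
      using y(1) by (auto intro: rtranclp.rtrancl_into_rtrancl)
  qed
  have complete: "\<exists>c. ((z, \<rho> x), c) \<in> ?S\<^sup>* \<and> snd c = \<rho> y \<and> inz w (fst c)" if "R\<^sup>*\<^sup>* x y" for y
    using that
  proof (induction rule: rtranclp_induct)
    case base
    show ?case
      using z by (intro exI[of _ "(z, \<rho> x)"]) simp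
  next
    case (step y y')
    then obtain c where c: "((z, \<rho> x), c) \<in> ?S\<^sup>*" "snd c = \<rho> y" "inz w (fst c)"
      by blast
    have "\<rho> y' \<in> snd ` post P (fst c, \<rho> y)"
      using assms c(3) step.hyps unfolding impl_def gives_def by blast
    then obtain c' where c': "c' \<in> post P c" "snd c' = \<rho> y'"
      using c(2) by (metis imageE prod.collapse)
    then have "((z, \<rho> x), c') \<in> ?S\<^sup>*"
      using c(1) by (simp add: rtrancl_into_rtrancl)
    then show ?case
      using c' post_inz[OF c'(1) c(3)] by blast
  qed
  show "snd ` post (Star P) (z, \<rho> x) = \<rho> ` {y. R\<^sup>*\<^sup>* x y}"
    unfolding post.simps(4)
  proof (intro set_eqI iffI)
    fix ts
    assume "ts \<in> snd ` {c'. ((z, \<rho> x), c') \<in> ?S\<^sup>*}"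
    then show "ts \<in> \<rho> ` {y. R\<^sup>*\<^sup>* x y}"
      using sound by blast
  next
    fix ts
    assume "ts \<in> \<rho> ` {y. R\<^sup>*\<^sup>* x y}"
    then obtain y where "R\<^sup>*\<^sup>* x y" "ts = \<rho> y"
      by blast
    then obtain c where "((z, \<rho> x), c) \<in> ?S\<^sup>*" "ts = snd c"
      using complete by metis
    then show "ts \<in> snd ` {c'. ((z, \<rho> x), c') \<in> ?S\<^sup>*}"
      by blast
  qed
qed

section \<open>The contents of the work tapes\<close>

abbreviation pair_cell :: "bool \<times> bool \<Rightarrow> cell" where
  "pair_cell x \<equiv> Duo (fst x) (snd x)"

text \<open>The letter tape holds two words of equal shape on two tracks. The state tape holds a list of
  states, each with a flag that tells whether the state is in use.\<close>

definition letter_cells :: "(bool \<times> bool) list list \<Rightarrow> cell list" where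
  "letter_cells AB = concat (map (\<lambda>x. map pair_cell x @ [Separator]) AB)"

definition state_cells :: "(bool \<times> bool list) list \<Rightarrow> cell list" where
  "state_cells W = concat (map (\<lambda>(f, q). Flag f # map Digit q) W)"

definition tape1 :: "(bool \<times> bool) list list \<Rightarrow> cell zip" where
  "tape1 AB = ([], Margin # letter_cells AB @ [Blank])"

definition tape2 :: "(bool \<times> bool list) list \<Rightarrow> cell zip" where
  "tape2 W = ([], Margin # state_cells W @ [Blank])"

lemma letter_cells_simps [simp]:
  "letter_cells [] = []" "letter_cells (x # AB) = map pair_cell x @ Separator # letter_cells AB"
  "letter_cells (AB @ AB') = letter_cells AB @ letter_cells AB'"
  by (auto simp: letter_cells_def)

lemma state_cells_simps [simp]:
  "state_cells [] = []" "state_cells ((f, q) # W) = Flag f # map Digit q @ state_cells W"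
  "state_cells (W @ W') = state_cells W @ state_cells W'"
  by (auto simp: state_cells_def)

lemma ok_tape [simp]: "ok (tape1 AB)" "ok (tape2 W)"
  by (auto simp: tape1_def tape2_def)

lemma set_letter_cells: "set (letter_cells AB) \<subseteq> insert Separator (range pair_cell)"
  by (auto simp: letter_cells_def)

lemma set_state_cells: "set (state_cells W) \<subseteq> range Flag \<union> range Digit"
  by (auto simp: state_cells_def)

lemma Margin_notin [simp]:
  "Margin \<notin> set (letter_cells AB @ [Blank])" "Margin \<notin> set (state_cells W @ [Blank])"
  using set_letter_cells[of AB] set_state_cells[of W] by auto

lemma home1_tape1:
  assumes "rev l @ r = Margin # letter_cells AB @ [Blank]" "r \<noteq> []" "ok s"
  shows "post home1 (z, (l, r), s) = {(z, tape1 AB, s)}"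
  using post_home1[OF Margin_notin(1) assms(3) assms(1,2)] by (simp add: tape1_def)

lemma home2_tape2:
  assumes "rev l @ r = Margin # state_cells W @ [Blank]" "r \<noteq> []" "ok t"
  shows "post home2 (z, t, (l, r)) = {(z, t, tape2 W)}"
  using post_home2[OF Margin_notin(2) assms(3) assms(1,2)] by (simp add: tape2_def)

lemma gives_pure: "(\<And>z. post P (z, ts) = Pair z ` X) \<Longrightarrow> gives w P ts X"
  by (simp add: gives_def image_image)

definition stay :: "cell set \<Rightarrow> cell \<Rightarrow> (cell \<times> move) set" where
  "stay X g = (if g \<in> X then {(g, Stay)} else {})"

definition right :: "cell set \<Rightarrow> cell \<Rightarrow> (cell \<times> move) set" where
  "right X g = (if g \<in> X then {(g, Right)} else {})"

lemma stay_in [simp]: "g \<in> X \<Longrightarrow> stay X g = {(g, Stay)}"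
  and stay_notin [simp]: "g \<notin> X \<Longrightarrow> stay X g = {}"
  by (auto simp: stay_def)

lemma right_in [simp]: "g \<in> X \<Longrightarrow> right X g = {(g, Right)}"
  and right_notin [simp]: "g \<notin> X \<Longrightarrow> right X g = {}"
  by (auto simp: right_def)

section \<open>Rewriting the letter tape and the state tape\<close>

fun lift1 :: "(bool \<times> bool \<Rightarrow> (bool \<times> bool) set) \<Rightarrow> cell \<Rightarrow> cell set" where
  "lift1 R (Duo a b) = pair_cell ` R (a, b)"
| "lift1 R Separator = {Separator}"
| "lift1 R _ = {}"

definition rewrite1 :: "(bool \<times> bool \<Rightarrow> (bool \<times> bool) set) \<Rightarrow> prog" where
  "rewrite1 R = Seq (on1 (right {Margin})) (Seq (sweep1 (lift1 R) (stay {Blank})) home1)"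

lemma list_all2_append_iff:
  "list_all2 P (xs @ ys) zs \<longleftrightarrow> (\<exists>us vs. zs = us @ vs \<and> list_all2 P xs us \<and> list_all2 P ys vs)"
  by (metis list_all2_append1 list_all2_lengthD)

lemma list_all2_lift1_block:
  "list_all2 (\<lambda>g g'. g' \<in> lift1 R g) (map pair_cell x) ys \<longleftrightarrow>
    (\<exists>y. ys = map pair_cell y \<and> list_all2 (\<lambda>a b. b \<in> R a) x y)"
proof (induction x arbitrary: ys)
  case (Cons a x)
  have "list_all2 (\<lambda>g g'. g' \<in> lift1 R g) (map pair_cell (a # x)) ys \<longleftrightarrow>
      (\<exists>b\<in>R a. \<exists>y. ys = map pair_cell (b # y) \<and> list_all2 (\<lambda>a b. b \<in> R a) x y)"
    using Cons by (auto simp: list_all2_Cons1)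
  also have "\<dots> \<longleftrightarrow> (\<exists>y. ys = map pair_cell y \<and> list_all2 (\<lambda>a b. b \<in> R a) (a # x) y)"
    unfolding list_all2_Cons1 by blast
  finally show ?case .
qed auto

lemma list_all2_lift1:
  "list_all2 (\<lambda>g g'. g' \<in> lift1 R g) (letter_cells AB) ys \<longleftrightarrow>
    (\<exists>AB'. ys = letter_cells AB' \<and> list_all2 (list_all2 (\<lambda>a b. b \<in> R a)) AB AB')"
proof (induction AB arbitrary: ys)
  case (Cons x AB)
  have "list_all2 (\<lambda>g g'. g' \<in> lift1 R g) (letter_cells (x # AB)) ys \<longleftrightarrow>
      (\<exists>y AB'. ys = letter_cells (y # AB') \<and> list_all2 (\<lambda>a b. b \<in> R a) x y \<and>
        list_all2 (list_all2 (\<lambda>a b. b \<in> R a)) AB AB')"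
    using Cons by (auto simp: list_all2_append_iff list_all2_Cons1 list_all2_lift1_block)
  also have "\<dots> \<longleftrightarrow> (\<exists>AB'. ys = letter_cells AB' \<and> list_all2 (list_all2 (\<lambda>a b. b \<in> R a)) (x # AB) AB')"
    unfolding list_all2_Cons1 by blast
  finally show ?case .
qed auto

lemma gives_rewrite1:
  assumes "ok s"
  shows "gives w (rewrite1 R) (tape1 AB, s)
    ((\<lambda>AB'. (tape1 AB', s)) ` {AB'. list_all2 (list_all2 (\<lambda>a b. b \<in> R a)) AB AB'})"
proof (rule gives_pure)
  fix z
  have "post (rewrite1 R) (z, tape1 AB, s) =
      (\<Union>c\<in>post (sweep1 (lift1 R) (stay {Blank})) (z, ([Margin], letter_cells AB @ [Blank]), s). post home1 c)"
    using assms by (simp add: rewrite1_def tape1_def post_on)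
  also have "post (sweep1 (lift1 R) (stay {Blank})) (z, ([Margin], letter_cells AB @ [Blank]), s) =
      {(z, (rev ys @ [Margin], [Blank]), s) | ys. list_all2 (\<lambda>g g'. g' \<in> lift1 R g) (letter_cells AB) ys}"
    using assms set_letter_cells[of AB] by (subst post_sweep1) auto
  also have "(\<Union>c\<in>\<dots>. post home1 c) =
      (\<Union>AB'\<in>{AB'. list_all2 (list_all2 (\<lambda>a b. b \<in> R a)) AB AB'}.
        post home1 (z, (rev (letter_cells AB') @ [Margin], [Blank]), s))"
    unfolding list_all2_lift1 by blast
  also have "\<dots> = Pair z ` (\<lambda>AB'. (tape1 AB', s)) `
      {AB'. list_all2 (list_all2 (\<lambda>a b. b \<in> R a)) AB AB'}"
  proof -
    have "post home1 (z, (rev (letter_cells AB') @ [Margin], [Blank]), s) = {(z, tape1 AB', s)}" for AB'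
      using assms by (intro home1_tape1) auto
    then show ?thesis
      by auto
  qed
  finally show "post (rewrite1 R) (z, tape1 AB, s) = \<dots>" .
qed

text \<open>Guessing happens in place: flags and digits change only among themselves, so the
  division into blocks and the space in use are preserved. Guessed bits that are no state fail
  later, when a transition is looked up for them.\<close>

fun reguess :: "cell \<Rightarrow> cell set" where
  "reguess (Flag f) = range Flag"
| "reguess (Digit x) = range Digit"
| "reguess _ = {}"

definition guess_states :: prog where
  "guess_states = Seq (on2 (right {Margin})) (Seq (sweep2 reguess (stay {Blank})) home2)"

lemma list_all2_reguess_block:
  "list_all2 (\<lambda>g g'. g' \<in> reguess g) (map Digit q) ys \<longleftrightarrow> (\<exists>p. ys = map Digit p \<and> length p = length q)"
proof (induction q arbitrary: ys)
  case (Cons a q)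
  have "list_all2 (\<lambda>g g'. g' \<in> reguess g) (map Digit (a # q)) ys \<longleftrightarrow>
      (\<exists>b p. ys = map Digit (b # p) \<and> length p = length q)"
    using Cons by (auto simp: list_all2_Cons1)
  also have "\<dots> \<longleftrightarrow> (\<exists>p. ys = map Digit p \<and> length p = length (a # q))"
    unfolding length_Cons length_Suc_conv by blast
  finally show ?case .
qed auto

abbreviation same_shape :: "(bool \<times> bool list) list \<Rightarrow> (bool \<times> bool list) list \<Rightarrow> bool" where
  "same_shape \<equiv> list_all2 (\<lambda>x y. length (snd x) = length (snd y))"

lemma list_all2_reguess:
  "list_all2 (\<lambda>g g'. g' \<in> reguess g) (state_cells W) ys \<longleftrightarrow>
    (\<exists>W'. ys = state_cells W' \<and> same_shape W W')"
proof (induction W arbitrary: ys)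
  case (Cons fq W)
  obtain f q where fq: "fq = (f, q)"
    by force
  have "list_all2 (\<lambda>g g'. g' \<in> reguess g) (state_cells (fq # W)) ys \<longleftrightarrow>
      (\<exists>f' p W'. ys = Flag f' # map Digit p @ state_cells W' \<and> length p = length q \<and> same_shape W W')"
    using Cons unfolding fq
    by (simp add: list_all2_append_iff list_all2_Cons1 list_all2_reguess_block) blast
  also have "\<dots> \<longleftrightarrow> (\<exists>z W'. ys = state_cells (z # W') \<and> length (snd fq) = length (snd z) \<and> same_shape W W')"
    by (simp add: fq split_paired_Ex eq_commute)
  also have "\<dots> \<longleftrightarrow> (\<exists>W'. ys = state_cells W' \<and> same_shape (fq # W) W')"
    unfolding list_all2_Cons1 by blast
  finally show ?case .
qed auto

lemma gives_guess_states:
  assumes "ok t"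
  shows "gives w guess_states (t, tape2 W) ((\<lambda>W'. (t, tape2 W')) ` {W'. same_shape W W'})"
proof (rule gives_pure)
  fix z
  have "post guess_states (z, t, tape2 W) =
      (\<Union>c\<in>post (sweep2 reguess (stay {Blank})) (z, t, ([Margin], state_cells W @ [Blank])). post home2 c)"
    using assms by (simp add: guess_states_def tape2_def post_on)
  also have "post (sweep2 reguess (stay {Blank})) (z, t, ([Margin], state_cells W @ [Blank])) =
      {(z, t, (rev ys @ [Margin], [Blank])) | ys. list_all2 (\<lambda>g g'. g' \<in> reguess g) (state_cells W) ys}"
    using assms set_state_cells[of W] by (subst post_sweep2) auto
  also have "(\<Union>c\<in>\<dots>. post home2 c) =
      (\<Union>W'\<in>{W'. same_shape W W'}. post home2 (z, t, (rev (state_cells W') @ [Margin], [Blank])))"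
    unfolding list_all2_reguess by blast
  also have "\<dots> = Pair z ` (\<lambda>W'. (t, tape2 W')) ` {W'. same_shape W W'}"
  proof -
    have "post home2 (z, t, (rev (state_cells W') @ [Margin], [Blank])) = {(z, t, tape2 W')}" for W'
      using assms by (intro home2_tape2) auto
    then show ?thesis
      by auto
  qed
  finally show "post guess_states (z, t, tape2 W) = \<dots>" .
qed

section \<open>Comparing the two words\<close>

fun first_diff :: "cell list \<Rightarrow> cell" where
  "first_diff (Duo a b # r) = (if a = b then first_diff r else Duo a b)"
| "first_diff (Separator # r) = first_diff r"
| "first_diff r = hd r"

text \<open>\<open>D\<close> selects the results that pass: \<open>Blank\<close> for equal tracks,
  \<open>Duo True False\<close> for a larger first track, \<open>Duo False True\<close> for a larger
  second track.\<close>

definition compare :: "cell set \<Rightarrow> prog" where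
  "compare D = Seq (on1 (right {Margin})) (Seq (Seq
     (Star (on1 (right {Separator, Duo False False, Duo True True}))) (on1 (stay D))) home1)"

lemma post_compare_loop:
  assumes "D \<subseteq> {Blank, Duo False True, Duo True False}" "ok s"
  shows "rev l @ xs = letter_cells AB \<Longrightarrow>
    post (Seq (Seq (Star (on1 (right {Separator, Duo False False, Duo True True}))) (on1 (stay D))) home1)
      (z, (l @ [Margin], xs @ [Blank]), s) =
    (if first_diff (xs @ [Blank]) \<in> D then {(z, tape1 AB, s)} else {})"
proof (induction xs arbitrary: l)
  case Nil
  have "post home1 (z, (l @ [Margin], [Blank]), s) = {(z, tape1 AB, s)}"
    using assms Nil by (intro home1_tape1) auto
  then show ?case
    using assms by (subst post.simps(2), subst post_Seq_Star) (auto simp: post_on)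
next
  case (Cons c xs)
  have home: "post home1 (z, (l @ [Margin], (c # xs) @ [Blank]), s) = {(z, tape1 AB, s)}"
    using assms Cons.prems by (intro home1_tape1) auto
  have IH: "post (Seq (Seq (Star (on1 (right {Separator, Duo False False, Duo True True}))) (on1 (stay D))) home1)
      (z, (c # l @ [Margin], xs @ [Blank]), s) =
    (if first_diff (xs @ [Blank]) \<in> D then {(z, tape1 AB, s)} else {})"
    using Cons.IH[of "c # l"] Cons.prems by simp
  have "c \<in> set (letter_cells AB)"
    using Cons.prems by (metis in_set_conv_decomp)
  then consider "c = Separator" | a b where "c = Duo a b"
    using set_letter_cells[of AB] by auto
  then have c: "c \<in> {Separator, Duo False False, Duo True True} \<and> c \<notin> D \<and> first_diff (c # xs @ [Blank]) = first_diff (xs @ [Blank]) \<or>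
      c \<notin> {Separator, Duo False False, Duo True True} \<and> first_diff (c # xs @ [Blank]) = c"
    using assms(1) by cases auto
  then show ?case
  proof
    assume c: "c \<in> {Separator, Duo False False, Duo True True} \<and> c \<notin> D \<and> first_diff (c # xs @ [Blank]) = first_diff (xs @ [Blank])"
    then have "right {Separator, Duo False False, Duo True True} c = {(c, Right)}" "stay D c = {}"
      by auto
    then show ?thesis
      using IH assms(2) c by (subst post.simps(2), subst post_Seq_Star) (simp add: post_on)
  next
    assume c: "c \<notin> {Separator, Duo False False, Duo True True} \<and> first_diff (c # xs @ [Blank]) = c"
    then have "right {Separator, Duo False False, Duo True True} c = {}"
      by auto
    then show ?thesis
      using home assms(2) c by (subst post.simps(2), subst post_Seq_Star) (simp add: post_on stay_def)
  qed
qed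

lemma gives_compare:
  assumes "D \<subseteq> {Blank, Duo False True, Duo True False}" "ok s"
  shows "gives w (compare D) (tape1 AB, s)
    (if first_diff (letter_cells AB @ [Blank]) \<in> D then {(tape1 AB, s)} else {})"
proof (rule gives_pure)
  fix z
  have "post (compare D) (z, tape1 AB, s) =
      post (Seq (Seq (Star (on1 (right {Separator, Duo False False, Duo True True}))) (on1 (stay D))) home1)
        (z, ([] @ [Margin], letter_cells AB @ [Blank]), s)"
    using assms by (simp add: compare_def tape1_def post_on)
  also have "\<dots> = Pair z ` (if first_diff (letter_cells AB @ [Blank]) \<in> D then {(tape1 AB, s)} else {})"
    using assms by (subst post_compare_loop) auto
  finally show "post (compare D) (z, tape1 AB, s) = \<dots>" .
qed

lemma first_diff_block:
  "first_diff (map pair_cell x @ r) = (if map fst x = map snd x then first_diff r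
     else if map snd x < map fst x then Duo True False else Duo False True)"
  by (induction x) (auto simp del: map_eq_conv)

text \<open>Both tracks have the same block lengths and \<open>False < True\<close>, so the first
  differing bit decides the lexicographic order of the two lists of blocks.\<close>

lemma first_diff_letter_cells:
  "first_diff (letter_cells AB @ [Blank]) =
    (if map (map fst) AB = map (map snd) AB then Blank
     else if map (map snd) AB < map (map fst) AB then Duo True False else Duo False True)"
  by (induction AB) (auto simp: first_diff_block simp del: map_eq_conv)

section \<open>Applying one transition\<close>

type_synonym transition = "bool list \<times> bool list \<times> bool list \<times> bool list"

text \<open>A transition starts right after the left end marker or a semicolon. The position at
  \<open>Hash\<close> is also reached, but there the next program finds neither a bit nor a comma
  and fails.\<close>

definition trans_start :: prog where
  "trans_start = Seq seek (onI (\<lambda>i. if i = Left_End \<or> i = Cell Semicolon then {Right} else {}))"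

definition match_state :: prog where
  "match_state = Seq
     (Star (onI2 (\<lambda>i h. if \<exists>x. i = Cell (Bit x) \<and> h = Digit x then {(Right, h, Right)} else {})))
     (onI2 (\<lambda>i h. if i = Cell Comma \<and> h \<notin> range Digit then {(Right, h, Left)} else {}))"

text \<open>One input cell shows a bit of the letter read and the corresponding bit of the letter
  written. So a single pass checks the first track and overwrites it, while the second track is
  kept.\<close>

definition step_letter :: prog where
  "step_letter = Seq
     (Star (onI1 (\<lambda>i g. {(Right, Duo y b, Right) | x y b. i = Cell (Bit2 x y) \<and> g = Duo x b})))
     (onI1 (\<lambda>i g. if i = Cell Comma \<and> g = Separator then {(Right, g, Right)} else {}))"

definition write_state :: prog where
  "write_state = Seq
     (Star (onI2 (\<lambda>i h. {(Right, Digit x, Right) | x y. i = Cell (Bit x) \<and> h = Digit y})))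
     (onI2 (\<lambda>i h. if i = Cell Semicolon \<and> h \<notin> range Digit then {(Right, h, Left)} else {}))"

definition to_flag :: "(cell \<Rightarrow> (cell \<times> move) set) \<Rightarrow> prog" where
  "to_flag f = Seq (Star (on2 (\<lambda>h. if h \<in> range Digit then {(h, Left)} else {}))) (on2 f)"

definition take_transition :: prog where
  "take_transition = Seq match_state (Seq (to_flag (right (range Flag)))
     (Seq step_letter (Seq write_state (to_flag (stay (range Flag))))))"

definition apply_transition :: prog where
  "apply_transition = Seq trans_start (Seq (on2 (right (range Flag))) take_transition)"

lemma post_match_state:
  assumes "ok t" "h \<notin> range Digit" "ir \<noteq> []"
  shows "post match_state ((il, map (\<lambda>x. Cell (Bit x)) q' @ Cell Comma # ir), t, (l, map Digit q @ h # hs)) =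
    (if q = q' then {((Cell Comma # rev (map (\<lambda>x. Cell (Bit x)) q') @ il, ir), t, upd (h, Left) (rev (map Digit q) @ l, h # hs))}
     else {})"
proof (induction q' arbitrary: q il l)
  case Nil
  show ?case
    using assms unfolding match_state_def
    by (cases q; subst post_Seq_Star) (auto simp: post_on simp del: upd.simps)
next
  case (Cons x q')
  show ?case
  proof (cases q)
    case Nil
    then show ?thesis
      using assms unfolding match_state_def
      by (subst post_Seq_Star) (auto simp: post_on simp del: upd.simps)
  next
    case q: (Cons y q2)
    have "post match_state ((il, map (\<lambda>x. Cell (Bit x)) (x # q') @ Cell Comma # ir), t, (l, map Digit q @ h # hs)) =
      (if x = y then post match_state ((Cell (Bit x) # il, map (\<lambda>x. Cell (Bit x)) q' @ Cell Comma # ir), t,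
         (Digit x # l, map Digit q2 @ h # hs)) else {})"
      using assms q unfolding match_state_def
      by (subst post_Seq_Star) (auto simp: post_on)
    then show ?thesis
      using q by (auto simp: Cons.IH simp del: upd.simps)
  qed
qed

lemma post_match_state_fail:
  assumes "ok t" "ok s" "hd r \<notin> Cell ` (range Bit)" "hd r \<noteq> Cell Comma"
  shows "post match_state ((il, r), t, s) = {}"
  using assms unfolding match_state_def by (subst post_Seq_Star) (auto simp: post_on)

text \<open>The tape has the form \<open>upd (h, Left)\<close> because \<open>match_state\<close>
  and \<open>write_state\<close> leave it so. Unfolding would require a case distinction: with a
  single state, a block has no digits and the head is already on the flag.\<close>

lemma post_to_flag:
  assumes "ok t" "\<And>x. f (Digit x) = {}"
  shows "post (to_flag f) (z, t, upd (h, Left) (rev (map Digit q) @ Flag b # l, h # hs)) =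
    post (on2 f) (z, t, (l, Flag b # map Digit q @ h # hs))"
proof (induction q arbitrary: h hs rule: rev_induct)
  case Nil
  show ?case
    using assms unfolding to_flag_def by (subst post_Seq_Star) (auto simp: post_on)
next
  case (snoc x q)
  have "post (to_flag f) (z, t, upd (h, Left) (rev (map Digit (q @ [x])) @ Flag b # l, h # hs)) =
      post (to_flag f) (z, t, upd (Digit x, Left) (rev (map Digit q) @ Flag b # l, Digit x # h # hs))"
    using assms unfolding to_flag_def by (subst post_Seq_Star) (auto simp: post_on)
  then show ?case
    using snoc.IH[of "Digit x" "h # hs"] by simp
qed

lemma post_step_letter:
  assumes "ok s" "ir \<noteq> []" "r \<noteq> []"
  shows "length a = length b \<Longrightarrow>
    post step_letter ((il, map Cell (map2 Bit2 a b) @ Cell Comma # ir), (l, map pair_cell x @ Separator # r), s) =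
    (if map fst x = a then {((Cell Comma # rev (map Cell (map2 Bit2 a b)) @ il, ir),
       (Separator # rev (map pair_cell (zip b (map snd x))) @ l, r), s)}
     else {})"
proof (induction a b arbitrary: x il l rule: list_induct2')
  case 1
  show ?case
    using assms unfolding step_letter_def
    by (cases x; subst post_Seq_Star) (auto simp: post_on)
next
  case (4 c a d b)
  show ?case
  proof (cases x)
    case Nil
    then show ?thesis
      using assms unfolding step_letter_def
      by (subst post_Seq_Star) (auto simp: post_on)
  next
    case x: (Cons y x2)
    have "post step_letter ((il, map Cell (map2 Bit2 (c # a) (d # b)) @ Cell Comma # ir), (l, map pair_cell x @ Separator # r), s) =
      (if fst y = c then post step_letter ((Cell (Bit2 c d) # il, map Cell (map2 Bit2 a b) @ Cell Comma # ir),
         (Duo d (snd y) # l, map pair_cell x2 @ Separator # r), s) else {})"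
      using assms x unfolding step_letter_def
      by (subst post_Seq_Star) (auto simp: post_on)
    then show ?thesis
      using x 4 by auto
  qed
qed auto

lemma post_write_state:
  assumes "ok t" "h \<notin> range Digit" "ir \<noteq> []"
  shows "length p = length q \<Longrightarrow>
    post write_state ((il, map (\<lambda>x. Cell (Bit x)) p @ Cell Semicolon # ir), t, (l, map Digit q @ h # hs)) =
    {((Cell Semicolon # rev (map (\<lambda>x. Cell (Bit x)) p) @ il, ir), t, upd (h, Left) (rev (map Digit p) @ l, h # hs))}"
proof (induction p q arbitrary: il l rule: list_induct2)
  case Nil
  show ?case
    using assms unfolding write_state_def
    by (subst post_Seq_Star) (auto simp: post_on simp del: upd.simps)
next
  case (Cons x p y q)
  have "post write_state ((il, map (\<lambda>x. Cell (Bit x)) (x # p) @ Cell Semicolon # ir), t, (l, map Digit (y # q) @ h # hs)) =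
      post write_state ((Cell (Bit x) # il, map (\<lambda>x. Cell (Bit x)) p @ Cell Semicolon # ir), t,
         (Digit x # l, map Digit q @ h # hs))"
    using assms unfolding write_state_def
    by (subst post_Seq_Star) (auto simp: post_on)
  then show ?case
    using Cons.IH by (simp del: upd.simps)
qed

fun enc_trans :: "transition \<Rightarrow> symbol list" where
  "enc_trans (q, a, b, p) =
    map Bit q @ [Comma] @ map2 Bit2 a b @ [Comma] @ map Bit p @ [Semicolon]"

lemma post_take_transition:
  assumes "ir \<noteq> []" "r1 \<noteq> []" "h \<notin> range Digit" "length a = length b" "length p = length q'"
  shows "snd ` post take_transition ((il, map Cell (enc_trans (q', a, b, p)) @ ir),
      (l1, map pair_cell x @ Separator # r1), (Flag f # l2, map Digit q @ h # hs)) =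
    (if q = q' \<and> map fst x = a
     then {((Separator # rev (map pair_cell (zip b (map snd x))) @ l1, r1), (l2, Flag f # map Digit p @ h # hs))}
     else {})"
proof -
  define J where "J = map Cell (map2 Bit2 a b) @ Cell Comma # map (\<lambda>x. Cell (Bit x)) p @ Cell Semicolon # ir"
  define J' where "J' = map (\<lambda>x. Cell (Bit x)) p @ Cell Semicolon # ir"
  have I: "map Cell (enc_trans (q', a, b, p)) @ ir = map (\<lambda>x. Cell (Bit x)) q' @ Cell Comma # J"
    by (simp add: J_def comp_def)
  have J: "J = map Cell (map2 Bit2 a b) @ Cell Comma # J'" "J \<noteq> []" "J' \<noteq> []"
    by (simp_all add: J_def J'_def)
  have ok: "ok (l1, map pair_cell x @ Separator # r1)" "ok (Separator # rev (map pair_cell y) @ l1, r1)"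
    "ok (Flag f # l2, map Digit q @ h # hs)" for y
    using assms by auto
  have flag1: "right (range Flag) (Digit y) = {}" "stay (range Flag) (Digit y) = {}" for y
    by (simp_all add: right_def stay_def image_iff)
  note to_flag1 = post_to_flag[where f = "right (range Flag)", OF ok(1) flag1(1)]
  note to_flag2 = post_to_flag[where f = "stay (range Flag)", OF ok(2) flag1(2)]
  show ?thesis
  proof (cases "q = q'")
    case False
    then show ?thesis
      unfolding I take_transition_def by (simp add: post_match_state[OF ok(1) assms(3) J(2)])
  next
    case q: True
    have match: "post take_transition ((il, map (\<lambda>x. Cell (Bit x)) q' @ Cell Comma # J),
        (l1, map pair_cell x @ Separator # r1), (Flag f # l2, map Digit q @ h # hs)) =
      post (Seq step_letter (Seq write_state (to_flag (stay (range Flag)))))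
        ((Cell Comma # rev (map (\<lambda>x. Cell (Bit x)) q') @ il, J),
         (l1, map pair_cell x @ Separator # r1), (Flag f # l2, map Digit q @ h # hs))"
      unfolding take_transition_def using q ok
      by (simp add: post_match_state[OF ok(1) assms(3) J(2)] to_flag1 post_on del: upd.simps(1,2))
    show ?thesis
    proof (cases "map fst x = a")
      case False
      have "post step_letter ((Cell Comma # rev (map (\<lambda>x. Cell (Bit x)) q') @ il, J),
         (l1, map pair_cell x @ Separator # r1), (Flag f # l2, map Digit q @ h # hs)) = {}"
        unfolding J(1) using False post_step_letter[OF ok(3) J(3) assms(2,4)] by simp
      then show ?thesis
        unfolding I match using False by simp
    next
      case x: True
      have "post (Seq step_letter (Seq write_state (to_flag (stay (range Flag)))))
        ((Cell Comma # rev (map (\<lambda>x. Cell (Bit x)) q') @ il, J),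
         (l1, map pair_cell x @ Separator # r1), (Flag f # l2, map Digit q @ h # hs)) =
        post (Seq write_state (to_flag (stay (range Flag))))
          ((Cell Comma # rev (map Cell (map2 Bit2 a b)) @ Cell Comma # rev (map (\<lambda>x. Cell (Bit x)) q') @ il, J'),
           (Separator # rev (map pair_cell (zip b (map snd x))) @ l1, r1), (Flag f # l2, map Digit q @ h # hs))"
        unfolding J(1) post.simps(2)[of step_letter] post_step_letter[OF ok(3) J(3) assms(2,4)]
        using x by simp
      moreover have "snd ` \<dots> = {((Separator # rev (map pair_cell (zip b (map snd x))) @ l1, r1),
          (l2, Flag f # map Digit p @ h # hs))}"
        using ok assms(5) q unfolding J'_def
        by (simp add: post_write_state[OF ok(2) assms(3,1)] to_flag2 post_on del: upd.simps(2))
      ultimately show ?thesis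
        using q x unfolding I match by simp
    qed
  qed
qed

section \<open>Applying the states on the state tape to the word on the letter tape\<close>

definition enc_word :: "bool list list \<Rightarrow> symbol list" where
  "enc_word u = concat (map (\<lambda>a. map Bit a @ [Comma]) u)"

definition next_state :: prog where
  "next_state = Seq (on2 (right (range Flag)))
     (sweep2 (\<lambda>g. if g \<in> range Digit then {g} else {}) (\<lambda>g. if g \<in> range Digit then {} else {(g, Stay)}))"

definition skip_state :: prog where
  "skip_state = Seq (on2 (stay {Flag False})) next_state"

definition apply_transitions :: prog where
  "apply_transitions = Seq (Star (Seq (on1 (stay (- {Blank}))) apply_transition)) (on1 (stay {Blank}))"

definition apply_state :: prog where
  "apply_state = Seq (on2 (stay {Flag True})) (Seq (on1 (right {Margin}))
     (Seq apply_transitions (Seq home1 next_state)))"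

definition apply_states :: prog where
  "apply_states = Seq (on2 (right {Margin}))
     (Seq (Seq (Star (Alt skip_state apply_state)) (on2 (stay {Blank}))) home2)"

text \<open>Each block has \<open>s\<close> only as its last symbol and \<open>T\<close> has none,
  so an occurrence of \<open>s\<close> must be the end of a block. With semicolons for
  \<open>s\<close>, this identifies the possible starts of transitions.\<close>

lemma split_at_end:
  assumes E: "\<And>t. E t = F t @ [s]" "\<And>t. s \<notin> set (F t)" and T: "s \<notin> set T"
  shows "xs @ s # ys = concat (map E tr) @ T \<Longrightarrow> \<exists>tr1 tr2. tr = tr1 @ tr2 \<and> xs @ [s] = concat (map E tr1) \<and>
    ys = concat (map E tr2) @ T"
proof (induction tr arbitrary: xs)
  case Nil
  then have "T = xs @ s # ys"
    by simp
  then show ?case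
    using T by simp
next
  case (Cons t tr)
  let ?R = "concat (map E tr) @ T"
  have "xs @ s # ys = F t @ s # ?R"
    using Cons.prems by (simp add: E(1)[of t])
  then consider us where "xs = F t @ us" "us @ s # ys = s # ?R" | us where "xs @ us = F t" "s # ys = us @ s # ?R"
    by (auto simp: append_eq_append_conv2)
  then show ?case
  proof cases
    case 1
    show ?thesis
    proof (cases us)
      case Nil
      then have "xs @ [s] = concat (map E [t])" "ys = ?R" "t # tr = [t] @ tr"
        using 1 E(1) by auto
      then show ?thesis
        by blast
    next
      case (Cons s' us')
      then have "us' @ s # ys = ?R" "s' = s"
        using 1 by auto
      then obtain tr1 tr2 where "tr = tr1 @ tr2" "us' @ [s] = concat (map E tr1)" "ys = concat (map E tr2) @ T"
        using Cons.IH by blast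
      moreover from this have "t # tr = (t # tr1) @ tr2" "xs @ [s] = concat (map E (t # tr1))"
        using 1 Cons \<open>s' = s\<close> by (simp_all add: E(1)[of t])
      ultimately show ?thesis
        by blast
    qed
  next
    case 2
    have "us = []"
    proof (cases us)
      case (Cons s' us')
      then have "s \<in> set (F t)"
        using 2 by (metis append_eq_Cons_conv in_set_conv_decomp list.inject)
      then show ?thesis
        using E(2) by blast
    qed
    then have "xs @ [s] = concat (map E [t])" "ys = ?R" "t # tr = [t] @ tr"
      using 2 E(1) by auto
    then show ?thesis
      by blast
  qed
qed

lemma gives_pure_Seq: "(\<And>z. post P (z, ts) = {(z, ts')}) \<Longrightarrow> gives w Q ts' X \<Longrightarrow> gives w (Seq P Q) ts X"
  by (simp add: gives_def)

lemma gives_fail_Seq: "(\<And>z. post P (z, ts) = {}) \<Longrightarrow> gives w (Seq P Q) ts {}"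
  by (simp add: gives_def)

lemma gives_Seq_pure:
  assumes "gives w P ts (\<sigma> ` A)" "\<And>y z. y \<in> A \<Longrightarrow> post Q (z, \<sigma> y) = {(z, \<tau> y)}"
  shows "gives w (Seq P Q) ts (\<tau> ` A)"
proof -
  have "gives w (Seq P Q) ts (\<Union>y\<in>A. {\<tau> y})"
    using assms by (intro gives_Seq_image) (auto simp: gives_def)
  then show ?thesis
    by (simp add: UNION_singleton_eq_range)
qed

lemma gives_cong: "gives w P ts X \<Longrightarrow> X = Y \<Longrightarrow> gives w P ts Y"
  by simp

lemma state_cells_Blank:
  obtains h hs where "state_cells W @ [Blank] = h # hs" "h \<notin> range Digit"
proof (cases W)
  case (Cons fq W')
  then show ?thesis
    using that by (cases fq) auto
qed (use that in auto)

lemma post_next_state: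
  assumes "ok t"
  shows "post next_state (z, t, (l, Flag f # map Digit q @ state_cells W @ [Blank])) =
    {(z, t, (rev (Flag f # map Digit q) @ l, state_cells W @ [Blank]))}"
proof -
  obtain h hs where h: "state_cells W @ [Blank] = h # hs" "h \<notin> range Digit"
    by (rule state_cells_Blank)
  have id: "list_all2 (\<lambda>x y. y \<in> (if x \<in> range Digit then {x} else {})) (map Digit q) ys \<longleftrightarrow> ys = map Digit q" for ys
    by (induction q arbitrary: ys) (auto simp: list_all2_Cons1)
  have "post next_state (z, t, (l, Flag f # map Digit q @ h # hs)) = {(z, t, (rev (Flag f # map Digit q) @ l, h # hs))}"
    unfolding next_state_def using assms h(2)
    by (simp add: post_on) (subst post_sweep2, auto simp: id)
  then show ?thesis
    using h(1) by simp
qed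

lemma UN_image_if: "(\<Union>x\<in>A. f x ` (if C x then {d} else {})) = {f x d | x. x \<in> A \<and> C x}"
  by (auto split: if_splits)

lemma UN_setcompr: "(\<Union>c\<in>{f x | x. P x}. G c) = (\<Union>x\<in>{x. P x}. G (f x))"
  by auto

lemma UN_snd: "(\<Union>x\<in>Z. F x) = (\<Union>r\<in>snd ` Z. \<Union>l\<in>{l. (l, r) \<in> Z}. F (l, r))"
  by (force simp: image_iff)

text \<open>The programs depend only on the widths \<open>B\<close> of states and \<open>K\<close>
  of letters. That the transitions form a G-automaton enters later, in
  \<open>decision\<close>.\<close>

locale encoded =
  fixes tr :: "transition list" and u :: "bool list list" and B K :: nat
  assumes shape: "(q, a, b, p) \<in> set tr \<Longrightarrow> length q = B \<and> length a = K \<and> length b = K \<and> length p = B"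
begin

definition w :: "symbol list" where
  "w = concat (map enc_trans tr) @ Hash # enc_word u"

abbreviation rest :: "transition list \<Rightarrow> icell list" where
  "rest tr2 \<equiv> map Cell (concat (map enc_trans tr2)) @ Cell Hash # map Cell (enc_word u) @ [Right_End]"

lemma input_cells_w: "input_cells w = Left_End # rest tr"
  by (simp add: input_cells_def w_def)

lemma trans_start_position:
  "(\<exists>l. rev l @ r = input_cells w \<and> r \<noteq> [] \<and> l \<noteq> [] \<and> (hd l = Left_End \<or> hd l = Cell Semicolon)) \<longleftrightarrow>
    (\<exists>tr1 tr2. tr = tr1 @ tr2 \<and> r = rest tr2)"
proof
  assume "\<exists>l. rev l @ r = input_cells w \<and> r \<noteq> [] \<and> l \<noteq> [] \<and> (hd l = Left_End \<or> hd l = Cell Semicolon)"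
  then obtain c l where l: "rev l @ c # r = Left_End # rest tr" "c = Left_End \<or> c = Cell Semicolon"
    unfolding input_cells_w by (metis append.assoc append_Cons append_Nil list.collapse rev.simps(2))
  show "\<exists>tr1 tr2. tr = tr1 @ tr2 \<and> r = rest tr2"
  proof (cases "rev l")
    case Nil
    then show ?thesis
      using l by (intro exI[of _ "[]"] exI[of _ tr]) simp
  next
    case (Cons c' l')
    then have l': "l' @ c # r = rest tr"
      using l by simp
    have "Left_End \<notin> set (rest tr)"
      by auto
    then have "c = Cell Semicolon"
      using l(2) by (metis l' in_set_conv_decomp)
    moreover obtain F where F: "\<And>t. map Cell (enc_trans t) = F t @ [Cell Semicolon]" "\<And>t. Cell Semicolon \<notin> set (F t)"
    proof
      define F where "F t = map Cell (butlast (enc_trans t))" for t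
      show "map Cell (enc_trans t) = F t @ [Cell Semicolon]" for t
        by (cases t rule: enc_trans.cases) (simp add: F_def butlast_append)
      show "Cell Semicolon \<notin> set (F t)" for t
        by (cases t rule: enc_trans.cases) (auto simp add: F_def butlast_append)
    qed
    moreover have "rest tr = concat (map (\<lambda>t. map Cell (enc_trans t)) tr) @ Cell Hash # map Cell (enc_word u) @ [Right_End]"
      for tr
      by (simp add: map_concat comp_def)
    moreover have "Cell Semicolon \<notin> set (Cell Hash # map Cell (enc_word u) @ [Right_End])"
      by (auto simp: enc_word_def)
    ultimately obtain tr1 tr2 where "tr = tr1 @ tr2"
      "r = concat (map (\<lambda>t. map Cell (enc_trans t)) tr2) @ Cell Hash # map Cell (enc_word u) @ [Right_End]"
      using l' split_at_end[of "\<lambda>t. map Cell (enc_trans t)" F "Cell Semicolon" _ l' r tr] by metis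
    then show ?thesis
      by (auto simp: map_concat comp_def)
  qed
next
  assume "\<exists>tr1 tr2. tr = tr1 @ tr2 \<and> r = rest tr2"
  then obtain tr1 tr2 where tr: "tr = tr1 @ tr2" "r = rest tr2"
    by blast
  define l where "l = rev (Left_End # map Cell (concat (map enc_trans tr1)))"
  have "rev l @ r = input_cells w"
    unfolding input_cells_w l_def tr(2) using tr(1) by simp
  moreover have "hd l = Left_End \<or> hd l = Cell Semicolon"
  proof (cases tr1 rule: rev_cases)
    case (snoc ts t)
    then show ?thesis
      by (cases t rule: enc_trans.cases) (simp add: l_def)
  qed (simp add: l_def)
  moreover have "l \<noteq> []" "r \<noteq> []"
    by (auto simp: l_def tr)
  ultimately show "\<exists>l. rev l @ r = input_cells w \<and> r \<noteq> [] \<and> l \<noteq> [] \<and> (hd l = Left_End \<or> hd l = Cell Semicolon)"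
    by blast
qed

lemma post_trans_start:
  assumes "ok t" "ok s" "inz w z"
  shows "\<exists>Z. post trans_start (z, t, s) = {(z', t, s) | z'. z' \<in> Z} \<and>
    snd ` Z = {rest tr2 | tr1 tr2. tr = tr1 @ tr2}"
proof -
  define Z where "Z = {(l, r). rev l @ r = input_cells w \<and> r \<noteq> [] \<and> l \<noteq> [] \<and> (hd l = Left_End \<or> hd l = Cell Semicolon)}"
  have *: "(inz w z' \<and> (hd (snd z') = Left_End \<or> hd (snd z') = Cell Semicolon) \<and> z'' = go Right z') \<longleftrightarrow>
     (z'' \<in> Z \<and> z' = (tl (fst z''), hd (fst z'') # snd z''))" for z' z''
  proof
    assume a: "inz w z' \<and> (hd (snd z') = Left_End \<or> hd (snd z') = Cell Semicolon) \<and> z'' = go Right z'"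
    obtain l c r where z': "z' = (l, c # r)"
      using a by (cases z') (auto simp: inz_def neq_Nil_conv)
    have eq: "rev l @ c # r = input_cells w" "c = Left_End \<or> c = Cell Semicolon"
      using a by (auto simp: z' inz_def)
    \<comment> \<open>\<open>go Right\<close> would stay put on the last input cell; that cell is
      \<open>Right_End\<close>, hence not the scanned one.\<close>
    have "r \<noteq> []"
    proof
      assume "r = []"
      then have "c = Right_End"
        using arg_cong[OF eq(1), of last] by (simp add: input_cells_def)
      then show False
        using eq(2) by auto
    qed
    then show "z'' \<in> Z \<and> z' = (tl (fst z''), hd (fst z'') # snd z'')"
      using a eq by (simp add: z' Z_def)
  next
    assume "z'' \<in> Z \<and> z' = (tl (fst z''), hd (fst z'') # snd z'')"
    then obtain c l r where "z'' = (c # l, r)" "rev (c # l) @ r = input_cells w" "r \<noteq> []"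
      "c = Left_End \<or> c = Cell Semicolon" "z' = (l, c # r)"
      by (cases z'') (auto simp: Z_def neq_Nil_conv)
    then show "inz w z' \<and> (hd (snd z') = Left_End \<or> hd (snd z') = Cell Semicolon) \<and> z'' = go Right z'"
      by (simp add: inz_def)
  qed
  have "post trans_start (z, t, s) = {(go Right z', t, s) | z'. inz w z' \<and> (hd (snd z') = Left_End \<or> hd (snd z') = Cell Semicolon)}"
    unfolding trans_start_def post.simps(2) post_seek[OF assms] UN_setcompr post_onI[OF assms(1,2)]
      UN_image_if mem_Collect_eq ..
  also have "\<dots> = {(z', t, s) | z'. z' \<in> Z}"
    using * by blast
  finally have "post trans_start (z, t, s) = {(z', t, s) | z'. z' \<in> Z}" .
  moreover have "snd ` Z = {r. \<exists>l. rev l @ r = input_cells w \<and> r \<noteq> [] \<and> l \<noteq> [] \<and> (hd l = Left_End \<or> hd l = Cell Semicolon)}"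
    by (force simp: Z_def)
  then have "snd ` Z = {rest tr2 | tr1 tr2. tr = tr1 @ tr2}"
    unfolding trans_start_position by blast
  ultimately show ?thesis
    by blast
qed

text \<open>The union over all guessed positions on the input is a union over the list of
  transitions: looking up a transition costs one jump and no memory.\<close>

lemma gives_apply_transition:
  assumes "r1 \<noteq> []" "h \<notin> range Digit"
  shows "gives w apply_transition ((l1, map pair_cell x @ Separator # r1), (l2, Flag f # map Digit q @ h # hs))
    {((Separator # rev (map pair_cell x') @ l1, r1), (l2, Flag f # map Digit p @ h # hs)) | x' p.
      (q, map fst x, map fst x', p) \<in> set tr \<and> map snd x' = map snd x}"
  unfolding gives_def
proof (intro allI impI)
  fix z
  assume z: "inz w z"
  let ?t = "(l1, map pair_cell x @ Separator # r1)" and ?s = "(l2, Flag f # map Digit q @ h # hs)"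
  let ?s' = "(Flag f # l2, map Digit q @ h # hs)"
  define X where "X = (\<lambda>(q', a, b, p). if q = q' \<and> map fst x = a
     then {((Separator # rev (map pair_cell (zip b (map snd x))) @ l1, r1), (l2, Flag f # map Digit p @ h # hs))}
     else {})"
  have ok: "ok ?t" "ok ?s" "ok ?s'"
    using assms by auto
  obtain Z where Z: "post trans_start (z, ?t, ?s) = {(z', ?t, ?s) | z'. z' \<in> Z}"
    "snd ` Z = {rest tr2 | tr1 tr2. tr = tr1 @ tr2}"
    using post_trans_start[OF ok(1,2) z] by blast
  have take: "snd ` post take_transition ((il, rest tr2), ?t, ?s') = (case tr2 of [] \<Rightarrow> {} | t # _ \<Rightarrow> X t)"
    if "tr = tr1 @ tr2" for il tr1 tr2
  proof (cases tr2)
    case Nil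
    then show ?thesis
      using ok unfolding take_transition_def
      by (simp add: post_match_state_fail image_iff del: ok_simp)
  next
    case (Cons t tr3)
    obtain q' a b p where t: "t = (q', a, b, p)"
      by (metis prod.exhaust)
    then have "length a = length b" "length p = length q'"
      using shape[of q' a b p] that Cons by auto
    then have "snd ` post take_transition ((il, map Cell (enc_trans t) @ rest tr3), ?t, ?s') = X t"
      unfolding t using post_take_transition[OF _ assms, of "rest tr3" a b p q'] by (simp add: X_def)
    then show ?thesis
      using Cons by simp
  qed
  have "snd ` post apply_transition (z, ?t, ?s) = (\<Union>z'\<in>Z. snd ` post take_transition (z', ?t, ?s'))"
  proof -
    have "post (on2 (right (range Flag))) (z', ?t, ?s) = {(z', ?t, ?s')}" for z'
      using ok by (simp add: post_on)
    then show ?thesis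
      unfolding apply_transition_def post.simps(2) Z(1) UN_setcompr by (simp add: image_UN)
  qed
  also have "\<dots> = (\<Union>r\<in>snd ` Z. \<Union>il\<in>{il. (il, r) \<in> Z}. snd ` post take_transition ((il, r), ?t, ?s'))"
    by (rule UN_snd)
  also have "\<dots> = (\<Union>t\<in>set tr. X t)"
  proof (intro set_eqI iffI)
    fix y
    assume "y \<in> (\<Union>r\<in>snd ` Z. \<Union>il\<in>{il. (il, r) \<in> Z}. snd ` post take_transition ((il, r), ?t, ?s'))"
    then obtain tr1 tr2 il where "tr = tr1 @ tr2" "y \<in> snd ` post take_transition ((il, rest tr2), ?t, ?s')"
      unfolding Z(2) by blast
    then show "y \<in> (\<Union>t\<in>set tr. X t)"
      using take[of tr1 tr2 il] by (cases tr2) auto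
  next
    fix y
    assume "y \<in> (\<Union>t\<in>set tr. X t)"
    then obtain t tr1 tr2 where t: "y \<in> X t" "tr = tr1 @ t # tr2"
      by (metis UN_E in_set_conv_decomp)
    then have "rest (t # tr2) \<in> snd ` Z"
      unfolding Z(2) by blast
    then obtain z' where "z' \<in> Z" "rest (t # tr2) = snd z'"
      by (rule imageE)
    then obtain il where "(il, rest (t # tr2)) \<in> Z"
      by (cases z') simp
    moreover have "y \<in> snd ` post take_transition ((il, rest (t # tr2)), ?t, ?s')"
      using take[OF t(2)] t(1) by simp
    moreover note \<open>rest (t # tr2) \<in> snd ` Z\<close>
    ultimately show "y \<in> (\<Union>r\<in>snd ` Z. \<Union>il\<in>{il. (il, r) \<in> Z}. snd ` post take_transition ((il, r), ?t, ?s'))"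
      by blast
  qed
  also have "\<dots> = {((Separator # rev (map pair_cell x') @ l1, r1), (l2, Flag f # map Digit p @ h # hs)) | x' p.
      (q, map fst x, map fst x', p) \<in> set tr \<and> map snd x' = map snd x}" (is "?L = ?R")
  proof (intro set_eqI iffI)
    fix y
    assume "y \<in> ?L"
    then obtain b p where y: "(q, map fst x, b, p) \<in> set tr"
      "y = ((Separator # rev (map pair_cell (zip b (map snd x))) @ l1, r1), (l2, Flag f # map Digit p @ h # hs))"
      by (auto simp: X_def split: if_splits)
    then have "length b = length (map snd x)"
      using shape[OF y(1)] by simp
    then have "map fst (zip b (map snd x)) = b" "map snd (zip b (map snd x)) = map snd x"
      by simp_all
    then show "y \<in> ?R"
      using y by (intro CollectI exI[of _ "zip b (map snd x)"] exI[of _ p]) simp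
  next
    fix y
    assume "y \<in> ?R"
    then obtain x' p where y: "(q, map fst x, map fst x', p) \<in> set tr" "map snd x' = map snd x"
      "y = ((Separator # rev (map pair_cell x') @ l1, r1), (l2, Flag f # map Digit p @ h # hs))"
      by blast
    have "zip (map fst x') (map snd x) = x'"
      using y(2) by (metis zip_map_fst_snd)
    then show "y \<in> ?L"
      using y by (intro UN_I[OF y(1)]) (simp add: X_def)
  qed
  finally show "snd ` post apply_transition (z, ?t, ?s) = ?R" .
qed

text \<open>\<open>rows\<close> and \<open>feeds\<close> are \<open>aut_run\<close> and
  \<open>feed\<close> on tape contents, with the word on the first track and the second track
  carried along. On an empty word no transition is looked up, so arbitrary bits pass as a state;
  this is why nonempty words are required later.\<close>

inductive rows :: "bool list \<Rightarrow> (bool \<times> bool) list list \<Rightarrow> (bool \<times> bool) list list \<Rightarrow> bool list \<Rightarrow> bool" where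
  Nil: "rows q [] [] q"
| Cons: "(q, map fst x, map fst x', r) \<in> set tr \<Longrightarrow> map snd x' = map snd x \<Longrightarrow> rows r AB AB' p \<Longrightarrow>
    rows q (x # AB) (x' # AB') p"

inductive feeds :: "(bool \<times> bool list) list \<Rightarrow> (bool \<times> bool) list list \<Rightarrow>
    (bool \<times> bool list) list \<Rightarrow> (bool \<times> bool) list list \<Rightarrow> bool" where
  Nil: "feeds [] AB [] AB"
| Skip: "feeds W AB W' AB' \<Longrightarrow> feeds ((False, q) # W) AB ((False, q) # W') AB'"
| Run: "rows q AB AB' p \<Longrightarrow> feeds W AB' W' AB'' \<Longrightarrow> feeds ((True, q) # W) AB ((True, p) # W') AB''"

end

type_synonym row_config = "(bool \<times> bool) list list \<times> (bool \<times> bool) list list \<times> bool list"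
type_synonym list_config = "(bool \<times> bool list) list \<times> (bool \<times> bool list) list \<times> (bool \<times> bool) list list"

lemma image_setcompr2: "r ` {g x y | x y. P x y} = {r (g x y) | x y. P x y}"
  by blast

context encoded
begin

definition row_tapes :: "cell list \<Rightarrow> bool \<Rightarrow> (bool \<times> bool list) list \<Rightarrow>
    row_config \<Rightarrow> tapes" where
  "row_tapes l f W = (\<lambda>(AB1, AB2, q).
     ((rev (Margin # letter_cells AB1), letter_cells AB2 @ [Blank]),
      (l, Flag f # map Digit q @ state_cells W @ [Blank])))"

definition row_step :: "row_config \<Rightarrow>
    row_config \<Rightarrow> bool" where
  "row_step = (\<lambda>(AB1, AB2, q) (AB1', AB2', p). \<exists>x x'. AB2 = x # AB2' \<and> AB1' = AB1 @ [x'] \<and>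
     (q, map fst x, map fst x', p) \<in> set tr \<and> map snd x' = map snd x)"

lemma impl_row_step:
  "impl w (row_tapes l f W) (Seq (on1 (stay (- {Blank}))) apply_transition) row_step (row_tapes l f W)"
  unfolding impl_def
proof
  fix st :: row_config
  obtain AB1 AB2 q where st: "st = (AB1, AB2, q)"
    by (rule prod_cases3)
  show "gives w (Seq (on1 (stay (- {Blank}))) apply_transition) (row_tapes l f W st)
      (row_tapes l f W ` {st'. row_step st st'})"
  proof (cases AB2)
    case Nil
    have none: "{st'. row_step st st'} = {}"
      by (auto simp: row_step_def st Nil)
    have "post (on1 (stay (- {Blank}))) (z, row_tapes l f W st) = {}" for z
      by (simp add: row_tapes_def st Nil post_on)
    then show ?thesis
      unfolding none image_empty by (rule gives_fail_Seq)
  next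
    case (Cons x AB)
    obtain h hs where h: "state_cells W @ [Blank] = h # hs" "h \<notin> range Digit"
      by (rule state_cells_Blank)
    let ?r = "letter_cells AB @ [Blank]"
    have tapes: "row_tapes l f W st = ((rev (Margin # letter_cells AB1), map pair_cell x @ Separator # ?r),
        (l, Flag f # map Digit q @ h # hs))"
      by (simp add: row_tapes_def st Cons h(1))
    have "post (on1 (stay (- {Blank}))) (z, row_tapes l f W st) = {(z, row_tapes l f W st)}" for z
      unfolding tapes by (cases x) (simp_all add: post_on)
    moreover have "gives w apply_transition (row_tapes l f W st) (row_tapes l f W ` {st'. row_step st st'})"
    proof (rule gives_cong)
      show "gives w apply_transition (row_tapes l f W st)
        {((Separator # rev (map pair_cell x') @ rev (Margin # letter_cells AB1), ?r), (l, Flag f # map Digit p @ h # hs)) | x' p.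
          (q, map fst x, map fst x', p) \<in> set tr \<and> map snd x' = map snd x}"
        unfolding tapes using gives_apply_transition[OF _ h(2)] by blast
      have "row_tapes l f W (AB1 @ [x'], AB, p) =
          ((Separator # rev (map pair_cell x') @ rev (Margin # letter_cells AB1), ?r), (l, Flag f # map Digit p @ h # hs))"
        for x' p
        by (simp add: row_tapes_def h(1))
      moreover have "{st'. row_step st st'} = {(AB1 @ [x'], AB, p) | x' p.
          (q, map fst x, map fst x', p) \<in> set tr \<and> map snd x' = map snd x}"
        by (auto simp: row_step_def st Cons)
      ultimately show "{((Separator # rev (map pair_cell x') @ rev (Margin # letter_cells AB1), ?r), (l, Flag f # map Digit p @ h # hs)) | x' p.
          (q, map fst x, map fst x', p) \<in> set tr \<and> map snd x' = map snd x} = row_tapes l f W ` {st'. row_step st st'}"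
        by (simp only: image_setcompr2)
    qed
    ultimately show ?thesis
      by (rule gives_pure_Seq)
  qed
qed

lemma row_steps_iff:
  "row_step\<^sup>*\<^sup>* (AB1, AB2, q) (AB1', [], p) \<longleftrightarrow> (\<exists>AB. AB1' = AB1 @ AB \<and> rows q AB2 AB p)"
proof
  assume "row_step\<^sup>*\<^sup>* (AB1, AB2, q) (AB1', [], p)"
  then show "\<exists>AB. AB1' = AB1 @ AB \<and> rows q AB2 AB p"
  proof (induction "(AB1, AB2, q)" arbitrary: AB1 AB2 q rule: converse_rtranclp_induct)
    case base
    then show ?case
      using rows.Nil by blast
  next
    case (step st)
    obtain AB1'' AB2'' q'' where st: "st = (AB1'', AB2'', q'')"
      by (rule prod_cases3)
    then obtain x x' where x: "AB2 = x # AB2''" "AB1'' = AB1 @ [x']"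
      "(q, map fst x, map fst x', q'') \<in> set tr" "map snd x' = map snd x"
      using step.hyps(1) by (auto simp: row_step_def)
    obtain AB where "AB1' = AB1'' @ AB" "rows q'' AB2'' AB p"
      using step.hyps(3)[OF st] by blast
    then show ?case
      using x rows.Cons by (intro exI[of _ "x' # AB"]) simp
  qed
next
  assume "\<exists>AB. AB1' = AB1 @ AB \<and> rows q AB2 AB p"
  then obtain AB where "rows q AB2 AB p" "AB1' = AB1 @ AB"
    by blast
  then show "row_step\<^sup>*\<^sup>* (AB1, AB2, q) (AB1', [], p)"
  proof (induction arbitrary: AB1 rule: rows.induct)
    case (Cons q x x' r AB AB' p)
    then have "row_step (AB1, x # AB, q) (AB1 @ [x'], AB, r)"
      by (auto simp: row_step_def)
    moreover have "row_step\<^sup>*\<^sup>* (AB1 @ [x'], AB, r) (AB1', [], p)"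
      using Cons by simp
    ultimately show ?case
      by (rule converse_rtranclp_into_rtranclp)
  qed auto
qed

lemma gives_apply_transitions:
  "gives w apply_transitions (row_tapes l f W ([], AB, q))
    (row_tapes l f W ` {(AB', [], p) | AB' p. rows q AB AB' p})"
proof -
  define st where "st = ([] :: (bool \<times> bool) list list, AB, q)"
  have star: "gives w (Star (Seq (on1 (stay (- {Blank}))) apply_transition)) (row_tapes l f W st)
      (row_tapes l f W ` {st'. row_step\<^sup>*\<^sup>* st st'})"
    using impl_Star[OF impl_row_step] unfolding impl_def by blast
  have "gives w apply_transitions (row_tapes l f W st)
    (\<Union>st'\<in>{st'. row_step\<^sup>*\<^sup>* st st'}. if fst (snd st') = [] then {row_tapes l f W st'} else {})"
    unfolding apply_transitions_def
  proof (rule gives_Seq_image[OF star])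
    fix st' :: row_config
    obtain AB1 AB2 q where st': "st' = (AB1, AB2, q)"
      by (rule prod_cases3)
    show "gives w (on1 (stay {Blank})) (row_tapes l f W st') (if fst (snd st') = [] then {row_tapes l f W st'} else {})"
    proof (cases AB2)
      case Nil
      then show ?thesis
        unfolding gives_def st' row_tapes_def by (simp add: post_on)
    next
      case (Cons x AB)
      then show ?thesis
        unfolding gives_def st' row_tapes_def by (cases x) (simp_all add: post_on)
    qed
  qed
  moreover have "(\<Union>st'\<in>{st'. row_step\<^sup>*\<^sup>* st st'}. if fst (snd st') = [] then {row_tapes l f W st'} else {}) =
      row_tapes l f W ` {st'. row_step\<^sup>*\<^sup>* st st' \<and> fst (snd st') = []}"
    by auto
  moreover have "{st'. row_step\<^sup>*\<^sup>* st st' \<and> fst (snd st') = []} = {(AB', [], p) | AB' p. rows q AB AB' p}"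
    using row_steps_iff[of "[]" AB q] by (auto simp: st_def)
  ultimately show ?thesis
    unfolding st_def by simp
qed

definition list_tapes :: "list_config \<Rightarrow> tapes" where
  "list_tapes = (\<lambda>(W1, W2, AB). (tape1 AB, (rev (Margin # state_cells W1), state_cells W2 @ [Blank])))"

definition list_step :: "list_config \<Rightarrow>
    list_config \<Rightarrow> bool" where
  "list_step = (\<lambda>(W1, W2, AB) (W1', W2', AB'). \<exists>f q p. W2 = (f, q) # W2' \<and> W1' = W1 @ [(f, p)] \<and>
     (if f then rows q AB AB' p else p = q \<and> AB' = AB))"

lemma gives_apply_state:
  "gives w apply_state (list_tapes (W1, (True, q) # W2, AB))
    (list_tapes ` {(W1 @ [(True, p)], W2, AB') | AB' p. rows q AB AB' p})"
proof -
  let ?l = "rev (Margin # state_cells W1)"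
  let ?A = "{(AB', [], p) | AB' p. rows q AB AB' p} :: row_config set"
  let ?f = "\<lambda>(AB', AB2, p). (W1 @ [(True, p)], W2, AB')"
  let ?home = "\<lambda>(AB', AB2, p). (tape1 AB', (?l, Flag True # map Digit p @ state_cells W2 @ [Blank]))"
  have "gives w (Seq apply_transitions (Seq home1 next_state)) (row_tapes ?l True W2 ([], AB, q))
      (\<Union>st\<in>?A. {list_tapes (?f st)})"
  proof (rule gives_Seq_image)
    show "gives w apply_transitions (row_tapes ?l True W2 ([], AB, q)) (row_tapes ?l True W2 ` ?A)"
      by (rule gives_apply_transitions)
  next
    fix st
    assume "st \<in> ?A"
    then obtain AB' p where st: "st = (AB', [], p)"
      by blast
    have "post home1 (z, row_tapes ?l True W2 st) = {(z, ?home st)}" for z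
      unfolding row_tapes_def st by (simp add: home1_tape1)
    moreover have "post next_state (z, ?home st) = {(z, list_tapes (?f st))}" for z
      unfolding st by (simp add: post_next_state list_tapes_def)
    ultimately show "gives w (Seq home1 next_state) (row_tapes ?l True W2 st) {list_tapes (?f st)}"
      by (simp add: gives_def)
  qed
  moreover have "(\<Union>st\<in>?A. {list_tapes (?f st)}) = list_tapes ` {(W1 @ [(True, p)], W2, AB') | AB' p. rows q AB AB' p}"
    by force
  moreover have "post (on1 (right {Margin})) (z, list_tapes (W1, (True, q) # W2, AB)) =
      {(z, row_tapes ?l True W2 ([], AB, q))}" for z
    by (simp add: list_tapes_def row_tapes_def tape1_def post_on)
  moreover have "post (on2 (stay {Flag True})) (z, list_tapes (W1, (True, q) # W2, AB)) =
      {(z, list_tapes (W1, (True, q) # W2, AB))}" for z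
    by (simp add: list_tapes_def post_on)
  ultimately show ?thesis
    unfolding apply_state_def by (simp add: gives_def)
qed

lemma impl_list_step: "impl w list_tapes (Alt skip_state apply_state) list_step list_tapes"
  unfolding impl_def
proof
  fix st :: list_config
  obtain W1 W2 AB where st: "st = (W1, W2, AB)"
    by (rule prod_cases3)
  have skip: "post skip_state (z, list_tapes st) =
      (case W2 of (False, q) # W \<Rightarrow> {(z, list_tapes (W1 @ [(False, q)], W, AB))} | _ \<Rightarrow> {})" for z
  proof (cases W2)
    case Nil
    then show ?thesis
      by (simp add: st list_tapes_def skip_state_def post_on)
  next
    case (Cons fq W)
    obtain f q where fq: "fq = (f, q)"
      by force
    have "post next_state (z, list_tapes (W1, (False, q) # W, AB)) = {(z, list_tapes (W1 @ [(False, q)], W, AB))}"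
      by (simp add: list_tapes_def post_next_state)
    then show ?thesis
      by (cases f) (simp_all add: st Cons fq list_tapes_def skip_state_def post_on)
  qed
  show "gives w (Alt skip_state apply_state) (list_tapes st) (list_tapes ` {st'. list_step st st'})"
  proof (cases "\<exists>q W. W2 = (True, q) # W")
    case True
    then obtain q W where W2: "W2 = (True, q) # W"
      by blast
    have "{st'. list_step st st'} = {(W1 @ [(True, p)], W, AB') | AB' p. rows q AB AB' p}"
      by (auto simp: list_step_def st W2)
    then show ?thesis
      using gives_apply_state[of W1 q W AB] skip by (simp add: gives_def st W2)
  next
    case False
    have no: "post apply_state (z, list_tapes st) = {}" for z
    proof (cases W2)
      case Nil
      then show ?thesis
        by (simp add: st list_tapes_def apply_state_def post_on)
    next
      case (Cons fq W)
      then show ?thesis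
        using False by (cases fq) (simp add: st list_tapes_def apply_state_def post_on)
    qed
    have "{st'. list_step st st'} = (case W2 of (False, q) # W \<Rightarrow> {(W1 @ [(False, q)], W, AB)} | _ \<Rightarrow> {})"
      using False by (auto simp: list_step_def st split: list.splits bool.splits)
    then show ?thesis
      using no skip by (auto simp: gives_def split: list.splits bool.splits)
  qed
qed

lemma list_steps_iff:
  "list_step\<^sup>*\<^sup>* (W1, W2, AB) (W1', [], AB') \<longleftrightarrow> (\<exists>W. W1' = W1 @ W \<and> feeds W2 AB W AB')"
proof
  assume "list_step\<^sup>*\<^sup>* (W1, W2, AB) (W1', [], AB')"
  then show "\<exists>W. W1' = W1 @ W \<and> feeds W2 AB W AB'"
  proof (induction "(W1, W2, AB)" arbitrary: W1 W2 AB rule: converse_rtranclp_induct)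
    case base
    then show ?case
      using feeds.Nil by blast
  next
    case (step st)
    obtain W1'' W2'' AB'' where st: "st = (W1'', W2'', AB'')"
      by (rule prod_cases3)
    then obtain f q p where x: "W2 = (f, q) # W2''" "W1'' = W1 @ [(f, p)]"
      "if f then rows q AB AB'' p else p = q \<and> AB'' = AB"
      using step.hyps(1) by (auto simp: list_step_def)
    obtain W where "W1' = W1'' @ W" "feeds W2'' AB'' W AB'"
      using step.hyps(3)[OF st] by blast
    moreover from this(2) have "feeds W2 AB ((f, p) # W) AB'"
      using x by (cases f) (auto intro: feeds.intros)
    ultimately show ?case
      using x by (intro exI[of _ "(f, p) # W"]) simp
  qed
next
  assume "\<exists>W. W1' = W1 @ W \<and> feeds W2 AB W AB'"
  then obtain W where "feeds W2 AB W AB'" "W1' = W1 @ W"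
    by blast
  then show "list_step\<^sup>*\<^sup>* (W1, W2, AB) (W1', [], AB')"
  proof (induction arbitrary: W1 rule: feeds.induct)
    case (Skip W AB W' AB' q)
    have "list_step (W1, (False, q) # W, AB) (W1 @ [(False, q)], W, AB)"
      by (auto simp: list_step_def)
    moreover have "list_step\<^sup>*\<^sup>* (W1 @ [(False, q)], W, AB) (W1', [], AB')"
      using Skip by simp
    ultimately show ?case
      by (rule converse_rtranclp_into_rtranclp)
  next
    case (Run q AB AB' p W W' AB'')
    then have "list_step (W1, (True, q) # W, AB) (W1 @ [(True, p)], W, AB')"
      by (auto simp: list_step_def)
    moreover have "list_step\<^sup>*\<^sup>* (W1 @ [(True, p)], W, AB') (W1', [], AB'')"
      using Run by simp
    ultimately show ?case
      by (rule converse_rtranclp_into_rtranclp)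
  qed auto
qed

lemma gives_apply_states:
  "gives w apply_states (tape1 AB, tape2 W)
    ((\<lambda>(W', AB'). (tape1 AB', tape2 W')) ` {(W', AB'). feeds W AB W' AB'})"
proof -
  define st where "st = ([] :: (bool \<times> bool list) list, W, AB)"
  have star: "gives w (Star (Alt skip_state apply_state)) (list_tapes st) (list_tapes ` {st'. list_step\<^sup>*\<^sup>* st st'})"
    using impl_Star[OF impl_list_step] unfolding impl_def by blast
  have "gives w (Seq (Star (Alt skip_state apply_state)) (on2 (stay {Blank}))) (list_tapes st)
    (\<Union>st'\<in>{st'. list_step\<^sup>*\<^sup>* st st'}. if fst (snd st') = [] then {list_tapes st'} else {})"
  proof (rule gives_Seq_image[OF star])
    fix st' :: list_config
    obtain W1 W2 AB where st': "st' = (W1, W2, AB)"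
      by (rule prod_cases3)
    show "gives w (on2 (stay {Blank})) (list_tapes st') (if fst (snd st') = [] then {list_tapes st'} else {})"
    proof (cases W2)
      case Nil
      then show ?thesis
        unfolding gives_def st' list_tapes_def by (simp add: post_on)
    next
      case (Cons x W)
      then show ?thesis
        unfolding gives_def st' list_tapes_def by (cases x) (simp add: post_on)
    qed
  qed
  moreover have "(\<Union>st'\<in>{st'. list_step\<^sup>*\<^sup>* st st'}. if fst (snd st') = [] then {list_tapes st'} else {}) =
      list_tapes ` {st'. list_step\<^sup>*\<^sup>* st st' \<and> fst (snd st') = []}"
    by auto
  moreover have "{st'. list_step\<^sup>*\<^sup>* st st' \<and> fst (snd st') = []} = (\<lambda>(W', AB'). (W', [], AB')) ` {(W', AB'). feeds W AB W' AB'}"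
    using list_steps_iff[of "[]" W AB] by (auto simp: st_def image_iff)
  ultimately have "gives w (Seq (Star (Alt skip_state apply_state)) (on2 (stay {Blank}))) (list_tapes st)
      ((\<lambda>(W', AB'). list_tapes (W', [], AB')) ` {(W', AB'). feeds W AB W' AB'})"
    by (simp add: image_image case_prod_unfold)
  moreover have "post home2 (z, (\<lambda>(W', AB'). list_tapes (W', [], AB')) y) = {(z, (\<lambda>(W', AB'). (tape1 AB', tape2 W')) y)}"
    for y z
    by (cases y) (simp add: list_tapes_def home2_tape2)
  ultimately have all: "gives w (Seq (Seq (Star (Alt skip_state apply_state)) (on2 (stay {Blank}))) home2) (list_tapes st)
      ((\<lambda>(W', AB'). (tape1 AB', tape2 W')) ` {(W', AB'). feeds W AB W' AB'})"
    by (rule gives_Seq_pure)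
  have "post (on2 (right {Margin})) (z, tape1 AB, tape2 W) = {(z, list_tapes st)}" for z
    by (simp add: st_def list_tapes_def tape2_def post_on)
  then show ?thesis
    unfolding apply_states_def using all by (rule gives_pure_Seq)
qed

end

section \<open>Creating the contents of the work tapes\<close>

definition copy_width :: prog where
  "copy_width = Seq
     (Star (onI2 (\<lambda>i h. if i \<in> Cell ` range Bit \<and> h = Blank then {(Right, Digit False, Right)} else {})))
     (onI2 (\<lambda>i h. if i = Cell Comma then {(Stay, h, Stay)} else {}))"

text \<open>The machine does not know the width \<open>B\<close>. It measures it on the state block
  of some transition, writing one digit per bit; the new entry is idle.\<close>

definition add_state :: prog where
  "add_state = Seq (sweep2 (\<lambda>g. if g = Blank then {} else {g}) (\<lambda>g. if g = Blank then {(Flag False, Right)} else {}))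
     (Seq trans_start (Seq copy_width home2))"

definition copy_word :: prog where
  "copy_word = Seq
     (Star (onI1 (\<lambda>i g. if g = Blank then
        {(Right, g', Right) | g'. (\<exists>x. i = Cell (Bit x) \<and> g' = Duo x x) \<or> i = Cell Comma \<and> g' = Separator} else {})))
     (onI1 (\<lambda>i g. if i = Right_End then {(Stay, g, Stay)} else {}))"

definition write_margins :: prog where
  "write_margins = Prim (\<lambda>i g h. {(Stay, (Margin, Right), (Margin, Right))})"

definition past_hash :: prog where
  "past_hash = Seq seek (onI (\<lambda>i. if i = Cell Hash then {Right} else {}))"

definition setup_tapes :: prog where
  "setup_tapes = Seq write_margins (Seq past_hash (Seq (onI (\<lambda>i. if i = Right_End then {} else {Stay}))
     (Seq copy_word (Seq home1 home2))))"

text \<open>Different letters of a transition differ in a single two-track cell, so the test writes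
  nothing on the work tapes.\<close>

definition empty_case :: prog where
  "empty_case = Seq past_hash (Seq (onI (\<lambda>i. if i = Right_End then {Stay} else {}))
     (Seq seek (onI (\<lambda>i. if \<exists>x. i = Cell (Bit2 x (\<not> x)) then {Stay} else {}))))"

lemma post_copy_width:
  assumes "ok t"
  shows "post copy_width ((il, map (\<lambda>x. Cell (Bit x)) q @ Cell Comma # ir), t, (l, [Blank])) =
    {((rev (map (\<lambda>x. Cell (Bit x)) q) @ il, Cell Comma # ir), t, (replicate (length q) (Digit False) @ l, [Blank]))}"
proof (induction q arbitrary: il l)
  case Nil
  show ?case
    using assms unfolding copy_width_def by (subst post_Seq_Star) (auto simp: post_on)
next
  case (Cons x q)
  have "post copy_width ((il, map (\<lambda>x. Cell (Bit x)) (x # q) @ Cell Comma # ir), t, (l, [Blank])) =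
    post copy_width ((Cell (Bit x) # il, map (\<lambda>x. Cell (Bit x)) q @ Cell Comma # ir), t, (Digit False # l, [Blank]))"
    using assms unfolding copy_width_def by (subst post_Seq_Star) (simp add: post_on)
  then show ?case
    using Cons.IH by (simp add: replicate_app_Cons_same)
qed

lemma post_copy_width_fail:
  assumes "ok t" "ok s" "hd r = Cell Hash"
  shows "post copy_width ((il, r), t, s) = {}"
  using assms unfolding copy_width_def by (subst post_Seq_Star) (auto simp: post_on)

lemma post_sweep_end:
  assumes "ok t"
  shows "post (sweep2 (\<lambda>g. if g = Blank then {} else {g}) (\<lambda>g. if g = Blank then {(Flag False, Right)} else {}))
    (z, t, tape2 W) = {(z, t, (Flag False # rev (state_cells W) @ [Margin], [Blank]))}"
proof -
  have id: "list_all2 (\<lambda>x y. y \<in> (if x = Blank then {} else {x})) xs ys \<longleftrightarrow> ys = xs \<and> Blank \<notin> set xs" for xs ys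
    by (induction xs arbitrary: ys) (auto simp: list_all2_Cons1)
  have "tape2 W = ([], (Margin # state_cells W) @ [Blank])"
    by (simp add: tape2_def)
  moreover have "Blank \<notin> set (Margin # state_cells W)"
    using set_state_cells[of W] by auto
  ultimately show ?thesis
    using assms by (simp only:, subst post_sweep2) (auto simp: id simp del: list_all2_Cons)
qed

fun copy_cell :: "symbol \<Rightarrow> cell" where
  "copy_cell (Bit x) = Duo x x"
| "copy_cell _ = Separator"

lemma post_copy_word:
  assumes "ok s"
  shows "set xs \<subseteq> insert Comma (range Bit) \<Longrightarrow>
    post copy_word ((il, map Cell xs @ [Right_End]), (l, [Blank]), s) =
    {((rev (map Cell xs) @ il, [Right_End]), (rev (map copy_cell xs) @ l, [Blank]), s)}"
proof (induction xs arbitrary: il l)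
  case Nil
  show ?case
    using assms unfolding copy_word_def by (subst post_Seq_Star) (simp add: post_on)
next
  case (Cons x xs)
  have "post copy_word ((il, map Cell (x # xs) @ [Right_End]), (l, [Blank]), s) =
    post copy_word ((Cell x # il, map Cell xs @ [Right_End]), (copy_cell x # l, [Blank]), s)"
    using assms Cons.prems unfolding copy_word_def
    by (subst post_Seq_Star) (cases x; auto simp: post_on)
  then show ?case
    using Cons by simp
qed

definition both_tracks :: "bool list list \<Rightarrow> (bool \<times> bool) list list" where
  "both_tracks = map (map (\<lambda>x. (x, x)))"

lemma copy_enc_word: "map copy_cell (enc_word u) = letter_cells (both_tracks u)"
  by (induction u) (auto simp: enc_word_def both_tracks_def)

lemma set_enc_word: "set (enc_word u) \<subseteq> insert Comma (range Bit)"
  by (auto simp: enc_word_def)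

context encoded
begin

text \<open>All transitions begin with a state block of width \<open>B\<close>, so every successful
  jump leaves the same tapes.\<close>

lemma gives_add_state:
  assumes "ok t"
  shows "gives w add_state (t, tape2 W) (if tr = [] then {} else {(t, tape2 (W @ [(False, replicate B False)]))})"
  unfolding gives_def
proof (intro allI impI)
  fix z
  assume z: "inz w z"
  let ?s = "(Flag False # rev (state_cells W) @ [Margin], [Blank])"
  have ok: "ok ?s"
    by simp
  obtain Z where Z: "post trans_start (z, t, ?s) = {(z', t, ?s) | z'. z' \<in> Z}"
    "snd ` Z = {rest tr2 | tr1 tr2. tr = tr1 @ tr2}"
    using post_trans_start[OF assms ok z] by blast
  have copy: "snd ` post (Seq copy_width home2) ((il, rest tr2), t, ?s) =
      (if tr2 = [] then {} else {(t, tape2 (W @ [(False, replicate B False)]))})" if "tr = tr1 @ tr2" for il tr1 tr2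
  proof (cases tr2)
    case Nil
    then show ?thesis
      using assms by (simp add: post_copy_width_fail)
  next
    case (Cons t' tr3)
    obtain q a b p where t': "t' = (q, a, b, p)"
      by (metis prod.exhaust)
    have q: "length q = B"
      using shape[of q a b p] that Cons t' by simp
    define ir where "ir = map Cell (map2 Bit2 a b @ [Comma] @ map Bit p @ [Semicolon]) @ rest tr3"
    have r: "rest tr2 = map (\<lambda>x. Cell (Bit x)) q @ Cell Comma # ir"
      by (simp add: Cons t' ir_def comp_def)
    have "post home2 (z', t, (replicate B (Digit False) @ fst ?s, [Blank])) =
       {(z', t, tape2 (W @ [(False, replicate B False)]))}" for z'
      using assms by (intro home2_tape2) (simp_all add: map_replicate_const)
    then show ?thesis
      using post_copy_width[OF assms, of il q ir "fst ?s"] Cons unfolding r by (simp add: q)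
  qed
  have "snd ` post add_state (z, t, tape2 W) = (\<Union>z'\<in>Z. snd ` post (Seq copy_width home2) (z', t, ?s))"
  proof -
    have "post add_state (z, t, tape2 W) = post (Seq trans_start (Seq copy_width home2)) (z, t, ?s)"
      unfolding add_state_def post.simps(2)[of "sweep2 _ _"] post_sweep_end[OF assms] by simp
    then show ?thesis
      unfolding post.simps(2)[of trans_start] Z(1) UN_setcompr by (simp add: image_UN)
  qed
  also have "\<dots> = (\<Union>r\<in>snd ` Z. \<Union>il\<in>{il. (il, r) \<in> Z}. snd ` post (Seq copy_width home2) ((il, r), t, ?s))"
    by (rule UN_snd)
  also have "\<dots> = (if tr = [] then {} else {(t, tape2 (W @ [(False, replicate B False)]))})" (is "?L = ?R")
  proof (intro set_eqI iffI)
    fix y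
    assume "y \<in> ?L"
    then obtain tr1 tr2 il where "tr = tr1 @ tr2" "y \<in> snd ` post (Seq copy_width home2) ((il, rest tr2), t, ?s)"
      unfolding Z(2) by blast
    then show "y \<in> ?R"
      using copy[of tr1 tr2 il] by (auto split: if_splits)
  next
    fix y
    assume y: "y \<in> ?R"
    have "tr = [] @ tr"
      by simp
    then have "rest tr \<in> snd ` Z"
      unfolding Z(2) by blast
    moreover from this obtain z' where "z' \<in> Z" "rest tr = snd z'"
      by (rule imageE)
    then obtain il where "(il, rest tr) \<in> Z"
      by (cases z') simp
    moreover have "y \<in> snd ` post (Seq copy_width home2) ((il, rest tr), t, ?s)"
      using copy[of "[]" tr il] y by (auto split: if_splits)
    ultimately show "y \<in> ?L"
      by blast
  qed
  finally show "snd ` post add_state (z, t, tape2 W) = ?R" .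
qed

text \<open>\<open>Hash\<close> occurs exactly once on the input, so this jump has only one possible
  target.\<close>

lemma post_past_hash:
  assumes "ok t" "ok s" "inz w z"
  shows "post past_hash (z, t, s) =
    {((Cell Hash # rev (Left_End # map Cell (concat (map enc_trans tr))), map Cell (enc_word u) @ [Right_End]), t, s)}"
proof -
  let ?l = "Left_End # map Cell (concat (map enc_trans tr))" and ?r = "map Cell (enc_word u) @ [Right_End]"
  have "Hash \<notin> set (enc_trans t')" for t'
    by (cases t' rule: enc_trans.cases) auto
  then have notin: "Cell Hash \<notin> set ?l" "Cell Hash \<notin> set ?r"
    using set_enc_word[of u] by auto
  have *: "{z'. inz w z' \<and> hd (snd z') = Cell Hash} = {(rev ?l, Cell Hash # ?r)}"
  proof (intro set_eqI iffI)
    fix z'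
    assume z': "z' \<in> {z'. inz w z' \<and> hd (snd z') = Cell Hash}"
    then obtain l r where lr: "z' = (l, Cell Hash # r)"
      by (cases z') (auto simp: inz_def neq_Nil_conv)
    have "rev l @ Cell Hash # r = ?l @ Cell Hash # ?r"
      using z' by (simp add: lr inz_def input_cells_w)
    then have "rev l = ?l" "r = ?r"
      using append_Cons_eq_iff[OF notin] by metis+
    then show "z' \<in> {(rev ?l, Cell Hash # ?r)}"
      unfolding lr by (metis rev_rev_ident singletonI)
  qed (auto simp: inz_def input_cells_w)
  have "post past_hash (z, t, s) = {(go Right z', t, s) | z'. z' \<in> {z'. inz w z' \<and> hd (snd z') = Cell Hash}}"
    unfolding past_hash_def post.simps(2) post_seek[OF assms] UN_setcompr post_onI[OF assms(1,2)]
      UN_image_if mem_Collect_eq ..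
  also have "\<dots> = {(go Right (rev ?l, Cell Hash # ?r), t, s)}"
    unfolding * by blast
  finally show ?thesis
    by simp
qed

lemma post_setup_tapes:
  "snd ` post setup_tapes (init_cfg w) = (if u = [] then {} else {(tape1 (both_tracks u), tape2 [])})"
proof -
  let ?z = "(Cell Hash # rev (Left_End # map Cell (concat (map enc_trans tr))), map Cell (enc_word u) @ [Right_End])"
  have "post write_margins (init_cfg w) = {(([], input_cells w), ([Margin], [Blank]), ([Margin], [Blank]))}"
    by (simp add: write_margins_def init_cfg_def post.simps(1))
  then have start: "post setup_tapes (init_cfg w) = post (Seq (onI (\<lambda>i. if i = Right_End then {} else {Stay}))
     (Seq copy_word (Seq home1 home2))) (?z, ([Margin], [Blank]), ([Margin], [Blank]))"
    unfolding setup_tapes_def by (simp add: post_past_hash[OF _ _ inz_start])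
  show ?thesis
  proof (cases u)
    case Nil
    then show ?thesis
      unfolding start by (simp add: post_on enc_word_def)
  next
    case (Cons a v)
    have hd: "hd (map Cell (enc_word u) @ [Right_End]) \<noteq> Right_End"
      by (cases a) (simp_all add: Cons enc_word_def)
    have "post home1 (z, (rev (letter_cells (both_tracks u)) @ [Margin], [Blank]), ([Margin], [Blank])) =
        {(z, tape1 (both_tracks u), ([Margin], [Blank]))}" for z
      by (intro home1_tape1) auto
    moreover have "post home2 (z, tape1 (both_tracks u), ([Margin], [Blank])) = {(z, tape1 (both_tracks u), tape2 [])}" for z
      by (intro home2_tape2) auto
    ultimately show ?thesis
      unfolding start using hd Cons
      by (simp add: post_on post_copy_word[OF _ set_enc_word] copy_enc_word)
  qed
qed

lemma post_empty_case:
  "post empty_case (init_cfg w) \<noteq> {} \<longleftrightarrow> u = [] \<and> (\<exists>(q, a, b, p)\<in>set tr. a \<noteq> b)"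
proof -
  let ?z = "(Cell Hash # rev (Left_End # map Cell (concat (map enc_trans tr))), map Cell (enc_word u) @ [Right_End])"
  let ?t = "([], [Blank]) :: cell zip"
  have z: "inz w ?z"
    by (simp add: inz_def input_cells_w)
  have start: "post empty_case (init_cfg w) = post (Seq (onI (\<lambda>i. if i = Right_End then {Stay} else {}))
     (Seq seek (onI (\<lambda>i. if \<exists>x. i = Cell (Bit2 x (\<not> x)) then {Stay} else {})))) (?z, ?t, ?t)"
    unfolding empty_case_def init_cfg_def by (simp add: post_past_hash[OF _ _ inz_start])
  show ?thesis
  proof (cases u)
    case (Cons a v)
    have hd: "hd (map Cell (enc_word u) @ [Right_End]) \<noteq> Right_End"
      by (cases a) (simp_all add: Cons enc_word_def)
    then show ?thesis
      unfolding start using Cons by (simp add: post_on)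
  next
    case Nil
    have "post empty_case (init_cfg w) = (\<Union>c\<in>post seek (?z, ?t, ?t).
        post (onI (\<lambda>i. if \<exists>x. i = Cell (Bit2 x (\<not> x)) then {Stay} else {})) c)"
      unfolding start using Nil by (simp add: post_on enc_word_def)
    also have "\<dots> = (\<Union>z'\<in>{z'. inz w z'}. post (onI (\<lambda>i. if \<exists>x. i = Cell (Bit2 x (\<not> x)) then {Stay} else {})) (z', ?t, ?t))"
    proof -
      have "post seek (?z, ?t, ?t) = {(z', ?t, ?t) | z'. inz w z'}"
        using z by (intro post_seek) simp_all
      then show ?thesis
        by (simp only: UN_setcompr)
    qed
    also have "\<dots> \<noteq> {} \<longleftrightarrow> (\<exists>z'. inz w z' \<and> (\<exists>x. hd (snd z') = Cell (Bit2 x (\<not> x))))"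
    proof -
      have "post (onI f) (z', ?t, ?t) = (\<lambda>d. (go d z', ?t, ?t)) ` f (hd (snd z'))" for f z'
        by (rule post_onI) simp_all
      then show ?thesis
        by auto
    qed
    also have "\<dots> \<longleftrightarrow> (\<exists>x. Cell (Bit2 x (\<not> x)) \<in> set (input_cells w))"
    proof
      assume "\<exists>z'. inz w z' \<and> (\<exists>x. hd (snd z') = Cell (Bit2 x (\<not> x)))"
      then obtain l r x where "rev l @ r = input_cells w" "r \<noteq> []" "hd r = Cell (Bit2 x (\<not> x))"
        by (auto simp: inz_def)
      then show "\<exists>x. Cell (Bit2 x (\<not> x)) \<in> set (input_cells w)"
        by (metis Un_iff hd_in_set set_append)
    next
      assume "\<exists>x. Cell (Bit2 x (\<not> x)) \<in> set (input_cells w)"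
      then obtain x l r where "input_cells w = l @ Cell (Bit2 x (\<not> x)) # r"
        by (meson split_list)
      then show "\<exists>z'. inz w z' \<and> (\<exists>x. hd (snd z') = Cell (Bit2 x (\<not> x)))"
        by (intro exI[of _ "(rev l, Cell (Bit2 x (\<not> x)) # r)"]) (auto simp: inz_def)
    qed
    also have "\<dots> \<longleftrightarrow> (\<exists>t\<in>set tr. \<exists>x. Bit2 x (\<not> x) \<in> set (enc_trans t))"
    proof -
      have "Bit2 x y \<notin> set (enc_word u)" for x y
        using set_enc_word[of u] by auto
      then show ?thesis
        unfolding input_cells_w by auto
    qed
    also have "\<dots> \<longleftrightarrow> (\<exists>(q, a, b, p)\<in>set tr. a \<noteq> b)"
    proof -
      have key: "(\<exists>x. Bit2 x (\<not> x) \<in> set (enc_trans (q, a, b, p))) \<longleftrightarrow> a \<noteq> b" if "(q, a, b, p) \<in> set tr" for q a b p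
      proof -
        have "length a = length b"
          using shape[OF that] by simp
        then have "(\<exists>x. Bit2 x (\<not> x) \<in> set (map2 Bit2 a b)) \<longleftrightarrow> a \<noteq> b"
          by (induction a b rule: list_induct2) auto
        then show ?thesis
          by auto
      qed
      show ?thesis
      proof (rule bex_cong[OF refl])
        fix t
        assume "t \<in> set tr"
        then show "(\<exists>x. Bit2 x (\<not> x) \<in> set (enc_trans t)) \<longleftrightarrow> (case t of (q, a, b, p) \<Rightarrow> a \<noteq> b)"
          using key by (cases t rule: prod_cases4) (simp del: enc_trans.simps)
      qed
    qed
    finally show ?thesis
      using Nil by simp
  qed
qed

end

section \<open>Space\<close>

text \<open>A syntactic criterion for programs that use no new cells. A tape grows only by a move to
  the right from its last cell; that cell is blank, remains blank, and is never left to the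
  right.\<close>

fun keeping :: "prog \<Rightarrow> bool" where
  "keeping (Prim a) \<longleftrightarrow> (\<forall>i g h. \<forall>(d, (g', m), (h', n))\<in>a i g h.
     (g' = Blank \<longleftrightarrow> g = Blank) \<and> (m = Right \<longrightarrow> g \<noteq> Blank) \<and>
     (h' = Blank \<longleftrightarrow> h = Blank) \<and> (n = Right \<longrightarrow> h \<noteq> Blank))"
| "keeping (Seq P Q) \<longleftrightarrow> keeping P \<and> keeping Q"
| "keeping (Alt P Q) \<longleftrightarrow> keeping P \<and> keeping Q"
| "keeping (Star P) \<longleftrightarrow> keeping P"

definition ended :: "cell zip \<Rightarrow> bool" where
  "ended z \<longleftrightarrow> snd z \<noteq> [] \<and> last (snd z) = Blank"

definition size_of :: "cell zip \<Rightarrow> nat" where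
  "size_of z = length (fst z) + length (snd z)"

lemma space_eq: "space (z, t, s) = size_of t + size_of s"
  by (cases z; cases t; cases s) (simp add: size_of_def)

lemma upd_keeping:
  assumes "ended z" "g' = Blank \<longleftrightarrow> hd (snd z) = Blank" "m = Right \<Longrightarrow> hd (snd z) \<noteq> Blank"
  shows "ended (upd (g', m) z) \<and> size_of (upd (g', m) z) = size_of z"
proof -
  obtain l c r where z: "z = (l, c # r)"
    using assms(1) by (cases z) (auto simp: ended_def neq_Nil_conv)
  show ?thesis
    using assms by (cases m) (auto simp: z ended_def size_of_def split: list.splits)
qed

lemma post_keeping:
  assumes "keeping P" "ended (fst (snd c))" "ended (snd (snd c))" "c' \<in> post P c"
  shows "ended (fst (snd c')) \<and> ended (snd (snd c')) \<and> space c' = space c"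
  using assms
proof (induction P arbitrary: c c')
  case (Prim a)
  obtain z t s where c: "c = (z, t, s)"
    by (rule prod_cases3)
  obtain d g m h n where a: "(d, (g, m), (h, n)) \<in> a (hd (snd z)) (hd (snd t)) (hd (snd s))"
    and c': "c' = (go d z, upd (g, m) t, upd (h, n) s)"
    using Prim.prems(4) by (auto simp: c post.simps(1))
  have "(g = Blank \<longleftrightarrow> hd (snd t) = Blank) \<and> (m = Right \<longrightarrow> hd (snd t) \<noteq> Blank) \<and>
     (h = Blank \<longleftrightarrow> hd (snd s) = Blank) \<and> (n = Right \<longrightarrow> hd (snd s) \<noteq> Blank)"
    using Prim.prems(1) a by fastforce
  then show ?case
    using Prim.prems(2,3) upd_keeping[of t g m] upd_keeping[of s h n] unfolding c c' space_eq by auto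
next
  case (Seq P Q)
  from Seq.prems(4) obtain d where "d \<in> post P c" "c' \<in> post Q d"
    unfolding post.simps(2) by blast
  then show ?case
    using Seq.IH(1)[of c d] Seq.IH(2)[of d c'] Seq.prems by simp
next
  case (Star P)
  have "(c, c') \<in> {(x, y). y \<in> post P x}\<^sup>*"
    using Star.prems(4) by (simp add: post.simps(4))
  then show ?case
  proof (induction rule: rtrancl_induct)
    case (step x y)
    then show ?case
      using Star.IH[of x y] Star.prems(1) by simp
  qed (use Star.prems in auto)
next
  case (Alt P Q)
  from Alt.prems(4) have "c' \<in> post P c \<or> c' \<in> post Q c"
    by simp
  then show ?case
    using Alt.IH(1)[of c c'] Alt.IH(2)[of c c'] Alt.prems(1-3) by (elim disjE) simp_all
qed

lemma safe_keeping:
  assumes "keeping P" "ended (fst (snd c))" "ended (snd (snd c))" "space c \<le> N"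
  shows "safe {c. space c \<le> N} P c"
  using assms
proof (induction P arbitrary: c)
  case (Seq P Q)
  have "safe {c. space c \<le> N} Q c'" if "c' \<in> post P c" for c'
    using post_keeping[OF _ Seq.prems(2,3) that] Seq.IH(2)[of c'] Seq.prems by simp
  then show ?case
    using Seq.IH(1)[of c] Seq.prems by simp
next
  case (Star P)
  have "c' \<in> {c. space c \<le> N} \<and> safe {c. space c \<le> N} P c'" if "c' \<in> post (Star P) c" for c'
    using post_keeping[OF Star.prems(1-3) that] Star.IH[of c'] Star.prems by simp
  then show ?case
    by simp
qed simp_all

lemma keeping_onI [simp]: "keeping (onI f)"
  by (auto simp: onI_def)

lemma keeping_on:
  "keeping (on1 f2) \<longleftrightarrow> (\<forall>g. \<forall>(g', m)\<in>f2 g. (g' = Blank \<longleftrightarrow> g = Blank) \<and> (m = Right \<longrightarrow> g \<noteq> Blank))"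
  "keeping (on2 f3) \<longleftrightarrow> (\<forall>g. \<forall>(g', m)\<in>f3 g. (g' = Blank \<longleftrightarrow> g = Blank) \<and> (m = Right \<longrightarrow> g \<noteq> Blank))"
  "keeping (onI1 f4) \<longleftrightarrow> (\<forall>i g. \<forall>(d, g', m)\<in>f4 i g. (g' = Blank \<longleftrightarrow> g = Blank) \<and> (m = Right \<longrightarrow> g \<noteq> Blank))"
  "keeping (onI2 f4) \<longleftrightarrow> (\<forall>i g. \<forall>(d, g', m)\<in>f4 i g. (g' = Blank \<longleftrightarrow> g = Blank) \<and> (m = Right \<longrightarrow> g \<noteq> Blank))"
  by (fastforce simp: on1_def on2_def onI1_def onI2_def)+

lemma keeping_stay_right [simp]:
  "keeping (on1 (stay X))" "keeping (on2 (stay X))"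
  "Blank \<notin> X \<Longrightarrow> keeping (on1 (right X))" "Blank \<notin> X \<Longrightarrow> keeping (on2 (right X))"
  by (auto simp: keeping_on stay_def right_def)

lemma keeping_home [simp]: "keeping home1" "keeping home2"
  by (auto simp: keeping_on home1_def home2_def)

lemma keeping_seek [simp]: "keeping seek" "keeping past_hash" "keeping trans_start" "keeping empty_case"
  by (auto simp: seek_def past_hash_def trans_start_def empty_case_def)

lemma keeping_rewrite1 [simp]: "keeping (rewrite1 R)"
proof -
  have "g' \<in> lift1 R g \<Longrightarrow> g \<noteq> Blank \<and> g' \<noteq> Blank" for g g'
    by (cases g) auto
  then have "keeping (on1 (\<lambda>g. (\<lambda>g'. (g', Right)) ` lift1 R g))"
    by (fastforce simp: keeping_on)
  then show ?thesis
    by (simp add: rewrite1_def sweep1_def)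
qed

lemma keeping_guess_states [simp]: "keeping guess_states"
proof -
  have "g' \<in> reguess g \<Longrightarrow> g \<noteq> Blank \<and> g' \<noteq> Blank" for g g'
    by (cases g) auto
  then have "keeping (on2 (\<lambda>g. (\<lambda>g'. (g', Right)) ` reguess g))"
    by (fastforce simp: keeping_on)
  then show ?thesis
    by (simp add: guess_states_def sweep2_def)
qed

lemma keeping_compare [simp]: "keeping (compare D)"
  by (simp add: compare_def)

lemma keeping_apply_states [simp]: "keeping apply_states"
proof -
  have flag: "Blank \<notin> range Flag"
    by auto
  have "keeping next_state"
    using flag unfolding next_state_def sweep2_def by (simp, auto simp: keeping_on)
  moreover have "keeping (to_flag f)" if "keeping (on2 f)" for f
    using that unfolding to_flag_def by (auto simp: keeping_on split: if_splits)
  moreover have "keeping match_state" "keeping step_letter" "keeping write_state"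
    unfolding match_state_def step_letter_def write_state_def by (auto simp: keeping_on split: if_splits)
  ultimately have "keeping take_transition"
    using flag unfolding take_transition_def by simp
  then show ?thesis
    using flag \<open>keeping next_state\<close>
    unfolding apply_states_def apply_state_def skip_state_def apply_transitions_def apply_transition_def
    by simp
qed

lemma safe_on [simp]:
  "safe S (onI f) c \<longleftrightarrow> c \<in> S" "safe S (on1 g) c \<longleftrightarrow> c \<in> S" "safe S (on2 g) c \<longleftrightarrow> c \<in> S"
  "safe S (onI1 h) c \<longleftrightarrow> c \<in> S" "safe S (onI2 h) c \<longleftrightarrow> c \<in> S"
  by (simp_all add: onI_def on1_def on2_def onI1_def onI2_def)

lemma ended_simps [simp]: "ended (l, [Blank])" "ended (tape1 AB)" "ended (tape2 W)"
  by (simp_all add: ended_def tape1_def tape2_def)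

lemma ended_ok: "ended z \<Longrightarrow> ok z"
  by (simp add: ended_def ok_def)

lemma size_of_tape:
  "size_of (tape1 AB) = length (letter_cells AB) + 2" "size_of (tape2 W) = length (state_cells W) + 2"
  by (simp_all add: size_of_def tape1_def tape2_def)

text \<open>Outcomes say nothing about copies abandoned halfway, yet these occupy space too, so the
  partial results of the loop are bounded separately. The cell \<open>i\<close> may be
  \<open>Comma\<close> or \<open>Hash\<close>; the second covers a jump to the end of the list of
  transitions.\<close>

lemma post_copy_width_star:
  assumes "ok t"
  shows "c \<in> post (Star (onI2 (\<lambda>i h. if i \<in> Cell ` range Bit \<and> h = Blank then {(Right, Digit False, Right)} else {})))
      ((il, map (\<lambda>x. Cell (Bit x)) q @ i # ir), t, (l, [Blank])) \<Longrightarrow> i \<notin> Cell ` range Bit \<Longrightarrow>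
    \<exists>z k. k \<le> length q \<and> c = (z, t, (replicate k (Digit False) @ l, [Blank]))"
proof (induction q arbitrary: il l)
  case Nil
  then show ?case
    using assms by (subst (asm) post_Star_unfold) (force simp: post_on)
next
  case (Cons x q)
  let ?P = "onI2 (\<lambda>i h. if i \<in> Cell ` range Bit \<and> h = Blank then {(Right, Digit False, Right)} else {})"
  have "post ?P ((il, map (\<lambda>x. Cell (Bit x)) (x # q) @ i # ir), t, (l, [Blank])) =
      {((Cell (Bit x) # il, map (\<lambda>x. Cell (Bit x)) q @ i # ir), t, (Digit False # l, [Blank]))}"
    using assms by (simp add: post_on)
  then consider "c = ((il, map (\<lambda>x. Cell (Bit x)) (x # q) @ i # ir), t, (l, [Blank]))"
    | "c \<in> post (Star ?P) ((Cell (Bit x) # il, map (\<lambda>x. Cell (Bit x)) q @ i # ir), t, (Digit False # l, [Blank]))"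
    using Cons.prems(1) by (subst (asm) post_Star_unfold) auto
  then show ?case
  proof cases
    case 1
    then show ?thesis
      by (intro exI[of _ "(il, map (\<lambda>x. Cell (Bit x)) (x # q) @ i # ir)"] exI[of _ 0]) simp
  next
    case 2
    from Cons.IH[OF this Cons.prems(2)] obtain z k where "k \<le> length q"
      "c = (z, t, (replicate k (Digit False) @ Digit False # l, [Blank]))"
      by blast
    then show ?thesis
      by (intro exI[of _ z] exI[of _ "Suc k"]) (simp add: replicate_app_Cons_same)
  qed
qed

lemma post_copy_word_star:
  assumes "ok s"
  shows "c \<in> post (Star (onI1 (\<lambda>i g. if g = Blank then
        {(Right, g', Right) | g'. (\<exists>x. i = Cell (Bit x) \<and> g' = Duo x x) \<or> i = Cell Comma \<and> g' = Separator} else {})))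
      ((il, map Cell xs @ [Right_End]), (l, [Blank]), s) \<Longrightarrow> set xs \<subseteq> insert Comma (range Bit) \<Longrightarrow>
    \<exists>z l'. length l' \<le> length xs + length l \<and> c = (z, (l', [Blank]), s)"
proof (induction xs arbitrary: il l)
  case Nil
  then show ?case
    using assms by (subst (asm) post_Star_unfold) (force simp: post_on)
next
  case (Cons x xs)
  let ?P = "onI1 (\<lambda>i g. if g = Blank then
        {(Right, g', Right) | g'. (\<exists>x. i = Cell (Bit x) \<and> g' = Duo x x) \<or> i = Cell Comma \<and> g' = Separator} else {})"
  have "post ?P ((il, map Cell (x # xs) @ [Right_End]), (l, [Blank]), s) =
      {((Cell x # il, map Cell xs @ [Right_End]), (copy_cell x # l, [Blank]), s)}"
    using assms Cons.prems(2) by (cases x) (auto simp: post_on)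
  then consider "c = ((il, map Cell (x # xs) @ [Right_End]), (l, [Blank]), s)"
    | "c \<in> post (Star ?P) ((Cell x # il, map Cell xs @ [Right_End]), (copy_cell x # l, [Blank]), s)"
    using Cons.prems(1) by (subst (asm) post_Star_unfold) auto
  then show ?case
  proof cases
    case 1
    then show ?thesis
      by (intro exI[of _ "(il, map Cell (x # xs) @ [Right_End])"] exI[of _ l]) simp
  next
    case 2
    have "set xs \<subseteq> insert Comma (range Bit)"
      using Cons.prems(2) by simp
    from Cons.IH[OF 2 this] obtain z l' where "length l' \<le> length xs + length (copy_cell x # l)"
      "c = (z, (l', [Blank]), s)"
      by blast
    then show ?thesis
      by (intro exI[of _ z] exI[of _ l']) simp
  qed
qed

context encoded
begin

lemma safe_add_state:
  assumes t: "ended t" and z: "inz w z" and N: "size_of t + size_of (tape2 W) + B + 1 \<le> N"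
  shows "safe {c. space c \<le> N} add_state (z, t, tape2 W)"
proof -
  let ?S = "{c. space c \<le> N}"
  let ?l = "Flag False # rev (state_cells W) @ [Margin]"
  let ?s = "(?l, [Blank])"
  have t_ok: "ok t"
    using t by (rule ended_ok)
  have size_s: "size_of ?s = size_of (tape2 W) + 1"
    by (simp add: size_of_tape) (simp add: size_of_def)
  obtain Z where Z: "post trans_start (z, t, ?s) = {(z', t, ?s) | z'. z' \<in> Z}"
    "snd ` Z = {rest tr2 | tr1 tr2. tr = tr1 @ tr2}"
    using post_trans_start[OF t_ok _ z, of ?s] by auto
  have width: "safe ?S (Seq copy_width home2) (z', t, ?s)" if "z' \<in> Z" for z'
  proof -
    obtain tr1 tr2 where tr12: "tr = tr1 @ tr2" "snd z' = rest tr2"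
      using imageI[OF \<open>z' \<in> Z\<close>, of snd] unfolding Z(2) by blast
    have "\<exists>q i ir. length q \<le> B \<and> i \<notin> Cell ` range Bit \<and> rest tr2 = map (\<lambda>x. Cell (Bit x)) q @ i # ir"
    proof (cases tr2)
      case Nil
      then show ?thesis
        by (intro exI[of _ "[] :: bool list"] exI[of _ "Cell Hash"]) auto
    next
      case (Cons t' tr3)
      obtain q a b p where t': "t' = (q, a, b, p)"
        by (metis prod.exhaust)
      have q: "length q = B"
        using shape[of q a b p] tr12 Cons t' by simp
      show ?thesis
        using q by (intro exI[of _ q] exI[of _ "Cell Comma"]) (auto simp: Cons t' comp_def)
    qed
    then obtain q i ir where q: "length q \<le> B" "i \<notin> Cell ` range Bit" "rest tr2 = map (\<lambda>x. Cell (Bit x)) q @ i # ir"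
      by blast
    have z': "z' = (fst z', map (\<lambda>x. Cell (Bit x)) q @ i # ir)"
      using tr12(2) q(3) by (metis prod.collapse)
    have star: "\<exists>z k. k \<le> B \<and> c = (z, t, (replicate k (Digit False) @ ?l, [Blank]))"
      if "c \<in> post (Star (onI2 (\<lambda>i h. if i \<in> Cell ` range Bit \<and> h = Blank then {(Right, Digit False, Right)} else {}))) (z', t, ?s)" for c
    proof -
      have "c \<in> post (Star (onI2 (\<lambda>i h. if i \<in> Cell ` range Bit \<and> h = Blank then {(Right, Digit False, Right)} else {})))
          ((fst z', map (\<lambda>x. Cell (Bit x)) q @ i # ir), t, ?s)"
        using that z' by simp
      from post_copy_width_star[OF t_ok this q(2)] obtain z k where "k \<le> length q"
        "c = (z, t, (replicate k (Digit False) @ ?l, [Blank]))"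
        by blast
      then show ?thesis
        using q(1) by (intro exI[of _ z] exI[of _ k]) simp
    qed
    have size: "space (z, t, (replicate k (Digit False) @ ?l, [Blank])) \<le> N" if "k \<le> B" for z k
      using that N size_s unfolding space_eq by (simp add: size_of_def)
    have "safe ?S copy_width (z', t, ?s)"
      unfolding copy_width_def using star size by fastforce
    moreover have "safe ?S home2 c" if "c \<in> post copy_width (z', t, ?s)" for c
    proof -
      obtain c' where c': "c' \<in> post (Star (onI2 (\<lambda>i h. if i \<in> Cell ` range Bit \<and> h = Blank then {(Right, Digit False, Right)} else {}))) (z', t, ?s)"
        "c \<in> post (onI2 (\<lambda>i h. if i = Cell Comma then {(Stay, h, Stay)} else {})) c'"
        using \<open>c \<in> post copy_width (z', t, ?s)\<close> unfolding copy_width_def post.simps(2) by blast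
      obtain z k where k: "k \<le> B" "c' = (z, t, (replicate k (Digit False) @ ?l, [Blank]))"
        using star[OF c'(1)] by blast
      have "c = c'"
        using c'(2) t_ok unfolding k(2) by (auto simp: post_on split: if_splits)
      then show ?thesis
        using size[OF k(1), of z] t by (intro safe_keeping) (simp_all add: k(2) del: space.simps)
    qed
    ultimately show ?thesis
      by simp
  qed
  have "space (z, t, tape2 W) \<le> N"
    using N by (simp add: space_eq)
  then have "safe ?S (sweep2 (\<lambda>g. if g = Blank then {} else {g}) (\<lambda>g. if g = Blank then {(Flag False, Right)} else {}))
      (z, t, tape2 W)"
  proof -
    let ?P = "Star (on2 (\<lambda>g. (\<lambda>g'. (g', Right)) ` (if g = Blank then {} else {g})))"
    have keep: "keeping ?P"
      by (auto simp: keeping_on)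
    have "safe ?S ?P (z, t, tape2 W)"
      using keep t \<open>space (z, t, tape2 W) \<le> N\<close> by (intro safe_keeping) simp_all
    moreover have "c \<in> ?S" if "c \<in> post ?P (z, t, tape2 W)" for c
      using post_keeping[OF keep _ _ that] t \<open>space (z, t, tape2 W) \<le> N\<close> by simp
    ultimately show ?thesis
      unfolding sweep2_def safe.simps(2) by simp
  qed
  moreover have "safe {c. space c \<le> N} (Seq trans_start (Seq copy_width home2)) (z, t, ?s)"
  proof -
    have "safe ?S trans_start (z, t, ?s)"
      using t N size_s by (intro safe_keeping) (simp_all add: space_eq)
    then show ?thesis
      unfolding safe.simps(2)[of _ trans_start] Z(1) using width by blast
  qed
  ultimately show ?thesis
    unfolding add_state_def safe.simps(2)[of _ "sweep2 _ _"] post_sweep_end[OF t_ok] by blast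
qed

text \<open>The constant \<open>4\<close> counts \<open>Margin\<close> and \<open>Blank\<close> on
  both work tapes.\<close>

lemma safe_setup_tapes:
  assumes N: "length (enc_word u) + 4 \<le> N"
  shows "safe {c. space c \<le> N} setup_tapes (init_cfg w)"
proof -
  let ?S = "{c. space c \<le> N}"
  let ?z = "(Cell Hash # rev (Left_End # map Cell (concat (map enc_trans tr))), map Cell (enc_word u) @ [Right_End])"
  let ?t = "([Margin], [Blank])"
  let ?check = "onI (\<lambda>i. if i = Right_End then {} else {Stay})"
  have ok: "ok ?t"
    by simp
  have margins: "post write_margins (init_cfg w) = {(([], input_cells w), ?t, ?t)}"
    by (simp add: write_margins_def init_cfg_def post.simps(1))
  have init: "init_cfg w \<in> ?S"
    using N by (simp add: init_cfg_def input_cells_def)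
  have small: "space (z, ?t, ?t) \<le> N" for z
    using N by (simp add: space_eq size_of_def)
  have hash: "safe ?S past_hash (([], input_cells w), ?t, ?t)"
    by (rule safe_keeping[OF _ _ _ small]) simp_all
  have star: "\<exists>z l'. length l' \<le> length (enc_word u) + 1 \<and> c = (z, (l', [Blank]), ?t)"
    if "c \<in> post (Star (onI1 (\<lambda>i g. if g = Blank then
        {(Right, g', Right) | g'. (\<exists>x. i = Cell (Bit x) \<and> g' = Duo x x) \<or> i = Cell Comma \<and> g' = Separator} else {})))
        (?z, ?t, ?t)" for c
    using post_copy_word_star[OF ok that set_enc_word] by simp
  have size: "space (z, (l', [Blank]), ?t) \<le> N" if "length l' \<le> length (enc_word u) + 1" for z l'
    using that N by (simp add: space_eq size_of_def)
  have "safe ?S copy_word (?z, ?t, ?t)"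
    unfolding copy_word_def using star size by fastforce
  moreover have "safe ?S (Seq home1 home2) c" if "c \<in> post copy_word (?z, ?t, ?t)" for c
  proof -
    have "c = ((rev (map Cell (enc_word u)) @ fst ?z, [Right_End]), (rev (map copy_cell (enc_word u)) @ [Margin], [Blank]), ?t)"
      using that post_copy_word[OF ok set_enc_word[of u], where il = "fst ?z" and l = "[Margin]"] by simp
    then show ?thesis
      using size by (intro safe_keeping) (simp_all del: space.simps)
  qed
  ultimately have copy: "safe ?S (Seq copy_word (Seq home1 home2)) (?z, ?t, ?t)"
    by simp
  have "post ?check (?z, ?t, ?t) \<subseteq> {(?z, ?t, ?t)}"
    by (auto simp: post_on)
  then have "safe ?S (Seq ?check (Seq copy_word (Seq home1 home2))) (?z, ?t, ?t)"
    using copy small by auto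
  then have "safe ?S (Seq past_hash (Seq ?check (Seq copy_word (Seq home1 home2)))) (([], input_cells w), ?t, ?t)"
    using hash by (simp add: post_past_hash[OF ok ok inz_start])
  then show ?thesis
    unfolding setup_tapes_def using init margins by (simp add: write_margins_def)
qed

section \<open>Triples for all runs and existence of single runs\<close>

definition rep :: "(bool \<times> bool) list list \<times> (bool \<times> bool list) list \<Rightarrow> tapes" where
  "rep = (\<lambda>(AB, W). (tape1 AB, tape2 W))"

text \<open>Partial correctness for every run, combined with the space bound for its intermediate
  configurations. As the input head may stand anywhere, triples compose without any mention of its
  position.\<close>

definition hoare :: "nat \<Rightarrow> ((bool \<times> bool) list list \<times> (bool \<times> bool list) list) set \<Rightarrow> prog \<Rightarrow>
    ((bool \<times> bool) list list \<times> (bool \<times> bool list) list) set \<Rightarrow> bool" where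
  "hoare N A P A' \<longleftrightarrow> (\<forall>x\<in>A. \<forall>z. inz w z \<longrightarrow>
     safe {c. space c \<le> N} P (z, rep x) \<and> (\<forall>c\<in>post P (z, rep x). snd c \<in> rep ` A'))"

lemma hoareD:
  assumes "hoare N A P A'" "x \<in> A" "inz w z"
  shows "safe {c. space c \<le> N} P (z, rep x)" "c \<in> post P (z, rep x) \<Longrightarrow> snd c \<in> rep ` A'"
  using assms unfolding hoare_def by blast+

lemma givesD: "gives w P ts X \<Longrightarrow> inz w z \<Longrightarrow> snd ` post P (z, ts) = X"
  unfolding gives_def by blast

lemma hoare_Seq:
  assumes "hoare N A P A'" "hoare N A' Q A''"
  shows "hoare N A (Seq P Q) A''"
  unfolding hoare_def
proof (intro ballI allI impI)
  fix x z
  assume x: "x \<in> A" and z: "inz w z"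
  have "safe {c. space c \<le> N} Q c \<and> (\<forall>c'\<in>post Q c. snd c' \<in> rep ` A'')" if c: "c \<in> post P (z, rep x)" for c
  proof -
    obtain y where y: "y \<in> A'" "snd c = rep y"
      using assms(1) x z c unfolding hoare_def by blast
    have "inz w (fst c)"
      using post_inz[OF c] z by simp
    then have "safe {c. space c \<le> N} Q (fst c, snd c) \<and> (\<forall>c'\<in>post Q (fst c, snd c). snd c' \<in> rep ` A'')"
      using hoareD[OF assms(2) y(1), of "fst c"] unfolding y(2) by blast
    then show ?thesis
      by simp
  qed
  moreover have "safe {c. space c \<le> N} P (z, rep x)"
    using assms(1) x z unfolding hoare_def by blast
  ultimately show "safe {c. space c \<le> N} (Seq P Q) (z, rep x) \<and> (\<forall>c\<in>post (Seq P Q) (z, rep x). snd c \<in> rep ` A'')"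
    unfolding safe.simps(2) post.simps(2) by blast
qed

lemma hoare_Star:
  assumes "hoare N A P A"
  shows "hoare N A (Star P) A"
  unfolding hoare_def
proof (intro ballI allI impI)
  fix x z
  assume x: "x \<in> A" and z: "inz w z"
  have reach: "\<exists>y\<in>A. snd c = rep y \<and> inz w (fst c)" if "c \<in> post (Star P) (z, rep x)" for c
    using that unfolding post.simps(4) mem_Collect_eq
  proof (induction rule: rtrancl_induct)
    case base
    then show ?case
      using x z by auto
  next
    case (step c c')
    then obtain y where y: "y \<in> A" "snd c = rep y" "inz w (fst c)"
      by blast
    have c': "c' \<in> post P (fst c, rep y)"
      using step.hyps(2) unfolding y(2)[symmetric] by simp
    then have "snd c' \<in> rep ` A"
      using assms y unfolding hoare_def by blast
    moreover have "inz w (fst c')"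
      using post_inz[OF c'] y by simp
    ultimately show ?case
      by blast
  qed
  have "c \<in> {c. space c \<le> N} \<and> safe {c. space c \<le> N} P c" if c: "c \<in> post (Star P) (z, rep x)" for c
  proof -
    obtain y where y: "y \<in> A" "snd c = rep y" "inz w (fst c)"
      using reach[OF c] by blast
    then have "safe {c. space c \<le> N} P (fst c, snd c)"
      using hoareD(1)[OF assms y(1,3)] by simp
    then have "safe {c. space c \<le> N} P c"
      by simp
    then show ?thesis
      using safe_start by blast
  qed
  moreover have "snd c \<in> rep ` A" if "c \<in> post (Star P) (z, rep x)" for c
    using reach[OF that] by auto
  ultimately show "safe {c. space c \<le> N} (Star P) (z, rep x) \<and> (\<forall>c\<in>post (Star P) (z, rep x). snd c \<in> rep ` A)"
    by (simp only: safe.simps(4)) blast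
qed

lemma hoare_keeping:
  assumes "keeping P"
    and "\<And>AB W. (AB, W) \<in> A \<Longrightarrow> length (letter_cells AB) + length (state_cells W) + 4 \<le> N"
    and "\<And>AB W. (AB, W) \<in> A \<Longrightarrow> gives w P (tape1 AB, tape2 W) (rep ` X AB W)"
    and "\<And>AB W. (AB, W) \<in> A \<Longrightarrow> X AB W \<subseteq> A'"
  shows "hoare N A P A'"
  unfolding hoare_def
proof (intro ballI allI impI)
  fix x z
  assume x: "x \<in> A" and z: "inz w z"
  obtain AB W where AB: "x = (AB, W)"
    by force
  have "space (z, rep x) \<le> N"
    using assms(2)[of AB W] x unfolding AB rep_def prod.case space_eq size_of_tape by simp
  then have "safe {c. space c \<le> N} P (z, rep x)"
    by (rule safe_keeping[OF assms(1), rotated 2]) (simp_all add: AB rep_def)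
  moreover have "snd ` post P (z, rep x) = rep ` X AB W"
    using givesD[OF assms(3)[of AB W] z] x by (simp add: AB rep_def)
  ultimately show "safe {c. space c \<le> N} P (z, rep x) \<and> (\<forall>c\<in>post P (z, rep x). snd c \<in> rep ` A')"
    using assms(4)[of AB W] x AB by blast
qed

text \<open>The counterpart of \<open>hoare\<close>: soundness and space concern all runs,
  completeness needs a single one. So the exact set of outcomes of the whole search is never
  computed.\<close>

definition can :: "prog \<Rightarrow> (bool \<times> bool) list list \<times> (bool \<times> bool list) list \<Rightarrow>
    (bool \<times> bool) list list \<times> (bool \<times> bool list) list \<Rightarrow> bool" where
  "can P x y \<longleftrightarrow> (\<forall>z. inz w z \<longrightarrow> (\<exists>c\<in>post P (z, rep x). snd c = rep y))"

lemma can_gives: "gives w P (tape1 AB, tape2 W) (rep ` X) \<Longrightarrow> y \<in> X \<Longrightarrow> can P (AB, W) y"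
proof -
  assume P: "gives w P (tape1 AB, tape2 W) (rep ` X)" and y: "y \<in> X"
  have "rep y \<in> snd ` post P (z, rep (AB, W))" if "inz w z" for z
    using givesD[OF P that] y by (simp add: rep_def)
  then show "can P (AB, W) y"
    unfolding can_def by (metis imageE)
qed

lemma can_Seq:
  assumes "can P x y" "can Q y y'"
  shows "can (Seq P Q) x y'"
  unfolding can_def
proof (intro allI impI)
  fix z
  assume z: "inz w z"
  then obtain c where c: "c \<in> post P (z, rep x)" "snd c = rep y"
    using assms(1) unfolding can_def by blast
  have "inz w (fst c)"
    using post_inz[OF c(1)] z by simp
  then obtain c' where "c' \<in> post Q (fst c, rep y)" "snd c' = rep y'"
    using assms(2) unfolding can_def by blast
  moreover have "(fst c, rep y) = c"
    using c(2) by (metis prod.collapse)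
  ultimately show "\<exists>c\<in>post (Seq P Q) (z, rep x). snd c = rep y'"
    using c(1) by auto
qed

lemma can_Star_refl: "can (Star P) x x"
  unfolding can_def post.simps(4) by (intro allI impI bexI) auto

lemma can_Star_step:
  assumes "can P x y" "can (Star P) y y'"
  shows "can (Star P) x y'"
proof -
  have "can (Seq P (Star P)) x y'"
    using assms by (rule can_Seq)
  moreover have "post (Seq P (Star P)) c \<subseteq> post (Star P) c" for c
    using post_Star_unfold[of P c] by auto
  ultimately show ?thesis
    unfolding can_def by blast
qed

end

section \<open>The decision procedure\<close>

text \<open>Each round overwrites the list by a new guess before it is applied; only the number and
  the width of its entries survive. One active entry per round suffices to reach the whole
  orbit.\<close>

definition walk :: prog where
  "walk = Star (Seq guess_states apply_states)"

text \<open>The second track is the memory for comparisons: it holds the last word counted, and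
  later the base point of the cycle.\<close>

definition copy_track :: prog where
  "copy_track = rewrite1 (\<lambda>x. {(fst x, fst x)})"

definition guess_word :: prog where
  "guess_word = rewrite1 (\<lambda>x. range (\<lambda>y. (y, y)))"

definition count_orbit :: prog where
  "count_orbit = Star (Seq walk (Seq (compare {Duo True False}) (Seq copy_track add_state)))"

definition find_cycle :: prog where
  "find_cycle = Seq guess_states (Seq apply_states (compare {Blank}))"

text \<open>The pieces of \<open>x\<close> reuse the cells of the letter tape, so each has the
  length of \<open>u\<close>. Only the last piece is compared, since a run may stop at the first
  piece that is changed.\<close>

definition extend_cycle :: prog where
  "extend_cycle = Seq (Star (Seq guess_word apply_states)) (compare {Duo True False, Duo False True})"

text \<open>One entry is added before any counting, because a walk needs a slot for a state; it is
  justified by the orbit being nonempty. The walk before \<open>count_orbit\<close> lets the count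
  start at the least word, without which it could not be exhaustive.\<close>

definition search :: prog where
  "search = Seq add_state (Seq walk (Seq copy_track (Seq count_orbit (Seq walk (Seq copy_track
     (Seq find_cycle extend_cycle))))))"

definition decider :: prog where
  "decider = Alt empty_case (Seq setup_tapes search)"

abbreviation fsts :: "(bool \<times> bool) list list \<Rightarrow> bool list list" where
  "fsts \<equiv> map (map fst)"

abbreviation snds :: "(bool \<times> bool) list list \<Rightarrow> bool list list" where
  "snds \<equiv> map (map snd)"

lemma feed_length: "feed T W u W' v \<Longrightarrow> length v = length u"
  by (induction rule: feed.induct) (auto dest: aut_run_length)

text \<open>States and letters are the bit blocks themselves, so tape contents are words and states
  of \<open>T\<close> without any decoding. An arbitrary automaton is brought into this form by
  \<open>rename\<close>.\<close>

locale decision = encoded tr u B K + G_aut T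
  for tr u B K and T :: "(bool list, bool list) automaton" +
  assumes trans: "aut_trans T = set tr"
    and state_length: "q \<in> aut_states T \<Longrightarrow> length q = B"
    and letter_length: "a \<in> aut_alphabet T \<Longrightarrow> length a = K"
    and u_in: "u \<in> lists (aut_alphabet T)"
begin

abbreviation "orb \<equiv> orbit T u"

text \<open>The rank of \<open>v\<close> in the orbit. During the count it bounds the length of the
  list, and it is itself bounded by the size of the orbit.\<close>

definition below :: "bool list list \<Rightarrow> nat" where
  "below v = card {x \<in> orb. x \<le> v}"

lemma finite_orb: "finite orb"
  using finite_orbit u_in .

lemma below_le: "below v \<le> card orb"
  unfolding below_def by (intro card_mono finite_orb) auto

lemma below_self: "v \<in> orb \<Longrightarrow> below v \<ge> 1"
  unfolding below_def using finite_orb card_gt_0_iff[of "{x \<in> orb. x \<le> v}"] by (auto simp: Suc_le_eq)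

lemma below_less: "v < v' \<Longrightarrow> v' \<in> orb \<Longrightarrow> below v < below v'"
proof -
  assume less: "v < v'" "v' \<in> orb"
  then have "v' \<in> {x \<in> orb. x \<le> v'}" "v' \<notin> {x \<in> orb. x \<le> v}"
    by auto
  moreover have "{x \<in> orb. x \<le> v} \<subseteq> {x \<in> orb. x \<le> v'}"
    using less by auto
  ultimately have "{x \<in> orb. x \<le> v} \<subset> {x \<in> orb. x \<le> v'}"
    by blast
  then show "below v < below v'"
    unfolding below_def using finite_orb by (intro psubset_card_mono) auto
qed

definition wide :: "nat \<Rightarrow> (bool \<times> bool list) list \<Rightarrow> bool" where
  "wide k W \<longleftrightarrow> length W = k \<and> (\<forall>x\<in>set W. length (snd x) = B)"

definition shaped :: "(bool \<times> bool) list list \<Rightarrow> bool" where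
  "shaped AB \<longleftrightarrow> length AB = length u \<and> (\<forall>x\<in>set AB. length x = K)"

section \<open>Tape contents as runs of the automaton\<close>

lemma rows_sound:
  "rows q AB AB' p \<Longrightarrow> q \<in> Q \<Longrightarrow> aut_run T q (fsts AB) (fsts AB') p"
proof (induction rule: rows.induct)
  case (Cons q x x' r AB AB' p)
  then have "r \<in> Q"
    using trans_in trans by blast
  then show ?case
    using Cons trans by (auto intro: aut_run.Cons)
qed (auto intro: aut_run.Nil)

text \<open>A nonempty word forces a lookup, and the transition found certifies that the guessed
  bits \<open>q\<close> are a state. This is the origin of \<open>AB \<noteq> []\<close> in
  \<open>feeds_sound\<close>.\<close>

lemma rows_shape:
  "rows q AB AB' p \<Longrightarrow> snds AB' = snds AB \<and> (length q = B \<longrightarrow> length p = B) \<and> (AB \<noteq> [] \<longrightarrow> q \<in> Q)"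
proof (induction rule: rows.induct)
  case (Cons q x x' r AB AB' p)
  then have "length r = B" "q \<in> Q"
    using shape trans_in trans by blast+
  then show ?case
    using Cons by simp
qed auto

lemma rows_complete:
  "aut_run T q (fsts AB) v p \<Longrightarrow> \<forall>x\<in>set AB. length x = K \<Longrightarrow>
    \<exists>AB'. rows q AB AB' p \<and> fsts AB' = v \<and> snds AB' = snds AB"
proof (induction AB arbitrary: q v)
  case Nil
  then show ?case
    by (auto elim: aut_run_NilE intro: rows.Nil)
next
  case (Cons x AB)
  from Cons.prems(1) obtain b r v' where v: "v = b # v'" "(q, map fst x, b, r) \<in> aut_trans T" "aut_run T r (fsts AB) v' p"
    by (auto elim: aut_run_ConsE)
  obtain AB' where AB': "rows r AB AB' p" "fsts AB' = v'" "snds AB' = snds AB"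
    using Cons.IH[OF v(3)] Cons.prems(2) by auto
  have "length b = length (map snd x)"
    using letter_length trans_in[OF v(2)] Cons.prems(2) by simp
  then have "map fst (zip b (map snd x)) = b" "map snd (zip b (map snd x)) = map snd x"
    by simp_all
  then show ?case
    using rows.Cons[of q x "zip b (map snd x)" r AB AB' p] AB' v trans
    by (intro exI[of _ "zip b (map snd x) # AB'"]) simp
qed

lemma feeds_sound:
  "feeds W AB W' AB' \<Longrightarrow> AB \<noteq> [] \<Longrightarrow> feed T W (fsts AB) W' (fsts AB')"
proof (induction rule: feeds.induct)
  case (Run q AB AB' p W W' AB'')
  have "snds AB' = snds AB" "q \<in> Q"
    using rows_shape[OF Run.hyps(1)] Run.prems by auto
  then have "AB' \<noteq> []"
    using Run.prems by auto
  then show ?case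
    using rows_sound[OF Run.hyps(1) \<open>q \<in> Q\<close>] Run.IH by (auto intro: feed.Run)
qed (auto intro: feed.intros)

lemma feeds_shape:
  "feeds W AB W' AB' \<Longrightarrow> snds AB' = snds AB \<and> (wide k W \<longrightarrow> wide k W')"
proof (induction arbitrary: k rule: feeds.induct)
  case (Skip W AB W' AB' q)
  have "wide (length W) W \<longrightarrow> wide (length W) W'"
    using Skip.IH by blast
  then show ?case
    using Skip.IH by (auto simp: wide_def)
next
  case (Run q AB AB' p W W' AB'')
  have "wide (length W) W \<longrightarrow> wide (length W) W'"
    using Run.IH by blast
  then show ?case
    using Run.IH rows_shape[OF Run.hyps(1)] by (auto simp: wide_def)
qed auto

lemma feeds_complete:
  "feed T W A W' A' \<Longrightarrow> A = fsts AB \<Longrightarrow> \<forall>x\<in>set AB. length x = K \<Longrightarrow>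
    \<exists>AB'. feeds W AB W' AB' \<and> fsts AB' = A' \<and> snds AB' = snds AB"
proof (induction arbitrary: AB rule: feed.induct)
  case (Run q A v p W W' A')
  obtain AB1 where AB1: "rows q AB AB1 p" "fsts AB1 = v" "snds AB1 = snds AB"
    using rows_complete Run by blast
  \<comment> \<open>A block has the same length on both tracks, so the unchanged second track fixes
    the shape of \<open>AB1\<close>.\<close>
  have "map length (snds AB1) = map length (snds AB)"
    using AB1(3) by simp
  then have "map length AB1 = map length AB"
    by (simp add: comp_def)
  then have "length ` set AB1 = length ` set AB"
    by (metis list.set_map)
  moreover have "length ` set AB \<subseteq> {K}"
    using Run.prems(2) by auto
  ultimately have "\<forall>x\<in>set AB1. length x = K"
    by auto
  then obtain AB' where "feeds W AB1 W' AB'" "fsts AB' = A'" "snds AB' = snds AB1"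
    using Run.IH[of AB1] AB1(2) by blast
  then show ?case
    using AB1 feeds.Run by metis
qed (auto intro: feeds.intros)

lemma shaped_iff: "shaped AB \<longleftrightarrow> map length AB = replicate (length u) K"
proof
  assume "shaped AB"
  then have "map length AB = map (\<lambda>_. K) AB" "length AB = length u"
    by (simp_all add: shaped_def)
  then show "map length AB = replicate (length u) K"
    by (simp add: map_replicate_const)
next
  assume eq: "map length AB = replicate (length u) K"
  have "length x = K" if "x \<in> set AB" for x
  proof -
    have "length x \<in> set (map length AB)"
      using that by simp
    then show ?thesis
      unfolding eq by simp
  qed
  moreover have "length AB = length u"
    using arg_cong[OF eq, of length] by simp
  ultimately show "shaped AB"
    by (simp add: shaped_def)
qed

lemma shaped_snds: "snds AB' = snds AB \<Longrightarrow> shaped AB \<Longrightarrow> shaped AB'"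
proof -
  assume "snds AB' = snds AB"
  then have "map length (snds AB') = map length (snds AB)"
    by simp
  then show "shaped AB \<Longrightarrow> shaped AB'"
    by (simp add: shaped_iff comp_def)
qed

lemma feed_orb:
  assumes "feed T W A W' A'" "A \<in> orb"
  shows "A' \<in> orb"
proof -
  have "rev (active W) \<in> lists Q" "A' = act T (rev (active W)) A"
    using feed_act[OF assms(1)] by (auto simp: in_lists_conv_set)
  then have "A' \<in> orbit T A"
    using orbit_act by blast
  then show ?thesis
    using orbit_trans assms(2) by blast
qed

text \<open>\<open>4\<close> stands for the margins and final blanks of both tapes, the
  \<open>1\<close> in \<open>K + 1\<close> for a separator, the \<open>1\<close> in
  \<open>B + 1\<close> for a flag.\<close>

definition budget :: nat where
  "budget = 4 + length u * (K + 1) + card orb * (B + 1)"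

definition inv :: "((bool \<times> bool) list list \<times> (bool \<times> bool list) list) set" where
  "inv = {(AB, W). shaped AB \<and> (\<exists>k\<le>card orb. wide k W)}"

text \<open>\<open>P\<close> relates the length of the list to the word on the second track; its
  instances are the stages of the count.\<close>

definition counting :: "(nat \<Rightarrow> bool list list \<Rightarrow> bool) \<Rightarrow> ((bool \<times> bool) list list \<times> (bool \<times> bool list) list) set" where
  "counting P = {(AB, W)\<in>inv. fsts AB \<in> orb \<and> snds AB \<in> orb \<and> P (length W) (snds AB)}"

lemma length_letter_cells: "shaped AB \<Longrightarrow> length (letter_cells AB) = length u * (K + 1)"
proof -
  have "\<forall>x\<in>set AB. length x = K \<Longrightarrow> length (letter_cells AB) = length AB * (K + 1)"
    by (induction AB) auto
  then show "shaped AB \<Longrightarrow> length (letter_cells AB) = length u * (K + 1)"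
    by (simp add: shaped_def)
qed

lemma length_state_cells: "wide k W \<Longrightarrow> length (state_cells W) = k * (B + 1)"
proof -
  have "\<forall>x\<in>set W. length (snd x) = B \<Longrightarrow> length (state_cells W) = length W * (B + 1)"
    by (induction W) auto
  then show "wide k W \<Longrightarrow> length (state_cells W) = k * (B + 1)"
    by (auto simp: wide_def)
qed

lemma inv_budget:
  assumes "(AB, W) \<in> inv"
  shows "length (letter_cells AB) + length (state_cells W) + 4 \<le> budget"
proof -
  obtain k where k: "k \<le> card orb" "wide k W" "shaped AB"
    using assms by (auto simp: inv_def)
  have "k * (B + 1) \<le> card orb * (B + 1)"
    using k(1) by (rule mult_le_mono1)
  then show ?thesis
    using k length_letter_cells length_state_cells[OF k(2)] by (simp add: budget_def)
qed

lemma hoare_inv: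
  assumes "keeping P" "A \<subseteq> inv"
    and "\<And>AB W. (AB, W) \<in> A \<Longrightarrow> gives w P (tape1 AB, tape2 W) (rep ` X AB W)"
    and "\<And>AB W. (AB, W) \<in> A \<Longrightarrow> X AB W \<subseteq> A'"
  shows "hoare budget A P A'"
  by (rule hoare_keeping[OF assms(1) _ assms(3,4)]) (use assms(2) inv_budget in blast)+

lemma gives_guess: "gives w guess_states (tape1 AB, tape2 W) (rep ` {(AB, W') | W'. same_shape W W'})"
proof (rule gives_cong[OF gives_guess_states])
  have "{(AB, W') | W'. same_shape W W'} = Pair AB ` {W'. same_shape W W'}"
    by blast
  then show "(\<lambda>W'. (tape1 AB, tape2 W')) ` {W'. same_shape W W'} = rep ` {(AB, W') | W'. same_shape W W'}"
    by (simp add: rep_def image_image)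
qed simp

lemma wide_guess:
  assumes "wide k W" "same_shape W W'"
  shows "wide k W'"
proof -
  have "length (snd x) = B" if x: "x \<in> set W'" for x
  proof -
    obtain i where i: "i < length W'" "x = W' ! i"
      using x by (metis in_set_conv_nth)
    then have "length (snd (W ! i)) = length (snd x)" "W ! i \<in> set W"
      using assms(2) by (simp_all add: list_all2_conv_all_nth)
    then show ?thesis
      using assms(1) unfolding wide_def by metis
  qed
  then show ?thesis
    using assms list_all2_lengthD[OF assms(2)] by (simp add: wide_def)
qed


lemma gives_apply:
  "gives w apply_states (tape1 AB, tape2 W) (rep ` {(AB', W') | AB' W'. feeds W AB W' AB'})"
proof (rule gives_cong[OF gives_apply_states])
  have "{(AB', W') | AB' W'. feeds W AB W' AB'} = (\<lambda>(W', AB'). (AB', W')) ` {(W', AB'). feeds W AB W' AB'}"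
    by auto
  then show "(\<lambda>(W', AB'). (tape1 AB', tape2 W')) ` {(W', AB'). feeds W AB W' AB'} =
      rep ` {(AB', W') | AB' W'. feeds W AB W' AB'}"
    by (simp add: rep_def image_image case_prod_unfold)
qed

lemma gives_rewrite:
  "gives w (rewrite1 R) (tape1 AB, tape2 W) (rep ` {(AB', W) | AB'. list_all2 (list_all2 (\<lambda>x y. y \<in> R x)) AB AB'})"
proof (rule gives_cong[OF gives_rewrite1])
  have "{(AB', W) | AB'. list_all2 (list_all2 (\<lambda>x y. y \<in> R x)) AB AB'} =
      (\<lambda>AB'. (AB', W)) ` {AB'. list_all2 (list_all2 (\<lambda>x y. y \<in> R x)) AB AB'}"
    by blast
  then show "(\<lambda>AB'. (tape1 AB', tape2 W)) ` {AB'. list_all2 (list_all2 (\<lambda>x y. y \<in> R x)) AB AB'} =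
      rep ` {(AB', W) | AB'. list_all2 (list_all2 (\<lambda>x y. y \<in> R x)) AB AB'}"
    by (simp add: rep_def image_image)
qed simp

lemma gives_copy:
  "gives w copy_track (tape1 AB, tape2 W) (rep ` {(both_tracks (fsts AB), W)})"
proof -
  have inner: "list_all2 (\<lambda>x y. y \<in> {(fst x, fst x)}) x y \<longleftrightarrow> y = map (\<lambda>x. (x, x)) (map fst x)"
    for x y :: "(bool \<times> bool) list"
    by (induction x arbitrary: y) (auto simp: list_all2_Cons1)
  have "list_all2 (list_all2 (\<lambda>x y. y \<in> {(fst x, fst x)})) AB AB' \<longleftrightarrow> AB' = both_tracks (fsts AB)" for AB'
    unfolding inner both_tracks_def by (induction AB arbitrary: AB') (auto simp: list_all2_Cons1)
  then show ?thesis
    using gives_rewrite[of "\<lambda>x. {(fst x, fst x)}" AB W] by (simp add: copy_track_def)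
qed

lemma both_tracks_tracks: "fsts (both_tracks A) = A" "snds (both_tracks A) = A"
  by (simp_all add: both_tracks_def comp_def)

lemma guess_iff:
  "list_all2 (list_all2 (\<lambda>x y. y \<in> range (\<lambda>y. (y, y)))) AB AB' \<longleftrightarrow>
    (\<exists>A. AB' = both_tracks A \<and> map length A = map length AB)" for AB :: "(bool \<times> bool) list list"
proof -
  have inner: "list_all2 (\<lambda>x y. y \<in> range (\<lambda>y. (y, y))) x y \<longleftrightarrow>
      (\<exists>a. y = map (\<lambda>x. (x, x)) a \<and> length a = length x)" for x y :: "(bool \<times> bool) list"
  proof (induction x arbitrary: y)
    case (Cons b x)
    have "list_all2 (\<lambda>x y. y \<in> range (\<lambda>y. (y, y))) (b # x) y \<longleftrightarrow>
        (\<exists>c a. y = map (\<lambda>x. (x, x)) (c # a) \<and> length a = length x)"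
      using Cons by (auto simp: list_all2_Cons1)
    also have "\<dots> \<longleftrightarrow> (\<exists>a. y = map (\<lambda>x. (x, x)) a \<and> length a = length (b # x))"
      unfolding length_Cons length_Suc_conv by blast
    finally show ?case .
  qed auto
  show ?thesis
  proof (induction AB arbitrary: AB')
    case (Cons x AB)
    have "list_all2 (list_all2 (\<lambda>x y. y \<in> range (\<lambda>y. (y, y)))) (x # AB) AB' \<longleftrightarrow>
        (\<exists>a A. AB' = both_tracks (a # A) \<and> length a = length x \<and> map length A = map length AB)"
      unfolding list_all2_Cons1 Cons inner both_tracks_def list.map by blast
    also have "\<dots> \<longleftrightarrow> (\<exists>A. AB' = both_tracks A \<and> map length A = map length (x # AB))"
      unfolding list.map map_eq_Cons_conv by blast
    finally show ?case .
  qed (simp add: both_tracks_def)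
qed

lemma gives_guess_word:
  "gives w guess_word (tape1 AB, tape2 W) (rep ` {(both_tracks A, W) | A. map length A = map length AB})"
proof -
  have "{(AB', W) | AB'. list_all2 (list_all2 (\<lambda>x y. y \<in> range (\<lambda>y. (y, y)))) AB AB'} =
      {(both_tracks A, W) | A. map length A = map length AB}"
    unfolding guess_iff by blast
  then show ?thesis
    using gives_rewrite[of "\<lambda>x. range (\<lambda>y. (y, y))" AB W] by (simp add: guess_word_def)
qed

lemma gives_compare_rep:
  assumes "D \<subseteq> {Blank, Duo False True, Duo True False}"
  shows "gives w (compare D) (tape1 AB, tape2 W)
    (rep ` (if first_diff (letter_cells AB @ [Blank]) \<in> D then {(AB, W)} else {}))"
  by (rule gives_cong[OF gives_compare[OF assms]]) (simp_all add: rep_def)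

lemma gives_add:
  "gives w add_state (tape1 AB, tape2 W) (rep ` (if tr = [] then {} else {(AB, W @ [(False, replicate B False)])}))"
  by (rule gives_cong[OF gives_add_state]) (simp_all add: rep_def)

lemma keeping_copy_guess [simp]: "keeping copy_track" "keeping guess_word"
  by (simp_all add: copy_track_def guess_word_def)

lemma shaped_both_tracks: "shaped (both_tracks A) \<longleftrightarrow> map length A = replicate (length u) K"
  by (simp add: shaped_iff both_tracks_def comp_def)

lemma shaped_copy: "shaped AB \<Longrightarrow> shaped (both_tracks (fsts AB))"
  by (simp add: shaped_iff both_tracks_def comp_def)

lemma shaped_u: "shaped (both_tracks u)"
  using u_in letter_length by (auto simp: shaped_def both_tracks_def)

lemma counting_inv: "counting P \<subseteq> inv"
  by (auto simp: counting_def)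

section \<open>Soundness of the search and its space in all runs\<close>

lemma hoare_guess_counting: "hoare budget (counting P) guess_states (counting P)"
proof (rule hoare_inv[OF _ counting_inv gives_guess])
  fix AB W
  assume "(AB, W) \<in> counting P"
  moreover have "length W' = length W" if "same_shape W W'" for W'
    using list_all2_lengthD[OF that] by simp
  ultimately show "{(AB, W') | W'. same_shape W W'} \<subseteq> counting P"
    using wide_guess by (auto simp: counting_def inv_def)
qed simp

lemma inv_nonempty: "u \<noteq> [] \<Longrightarrow> (AB, W) \<in> inv \<Longrightarrow> AB \<noteq> []"
  by (auto simp: inv_def shaped_def)

lemma feeds_inv: "feeds W AB W' AB' \<Longrightarrow> (AB, W) \<in> inv \<Longrightarrow> (AB', W') \<in> inv \<and> length W' = length W"
  using feeds_shape[of W AB W' AB'] shaped_snds[of AB' AB] by (auto simp: inv_def wide_def)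

lemma hoare_apply_counting:
  assumes "u \<noteq> []"
  shows "hoare budget (counting P) apply_states (counting P)"
proof (rule hoare_inv[OF _ counting_inv gives_apply])
  fix AB W
  assume a: "(AB, W) \<in> counting P"
  show "{(AB', W') | AB' W'. feeds W AB W' AB'} \<subseteq> counting P"
  proof clarify
    fix AB' W'
    assume f: "feeds W AB W' AB'"
    have i: "(AB, W) \<in> inv" "fsts AB \<in> orb" "snds AB \<in> orb" "P (length W) (snds AB)"
      using a by (auto simp: counting_def)
    have "fsts AB' \<in> orb"
      using feed_orb[OF feeds_sound[OF f inv_nonempty[OF assms i(1)]] i(2)] .
    then show "(AB', W') \<in> counting P"
      using feeds_inv[OF f i(1)] feeds_shape[OF f] i by (simp add: counting_def)
  qed
qed simp

lemma hoare_walk: "u \<noteq> [] \<Longrightarrow> hoare budget (counting P) walk (counting P)"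
  unfolding walk_def
  by (intro hoare_Star hoare_Seq[OF hoare_guess_counting] hoare_apply_counting)

lemma hoare_copy:
  assumes "A \<subseteq> inv" "\<And>AB W. (AB, W) \<in> A \<Longrightarrow> fsts AB \<in> orb \<and> P (length W) (fsts AB)"
  shows "hoare budget A copy_track (counting P \<inter> {(AB, W). fsts AB = snds AB})"
proof (rule hoare_inv[OF _ assms(1) gives_copy])
  fix AB W
  assume a: "(AB, W) \<in> A"
  then have "(both_tracks (fsts AB), W) \<in> inv"
    using assms(1) shaped_copy by (auto simp: inv_def)
  then show "{(both_tracks (fsts AB), W)} \<subseteq> counting P \<inter> {(AB, W). fsts AB = snds AB}"
    using assms(2)[OF a] by (simp add: counting_def both_tracks_tracks del: map_map map_eq_conv)
qed simp

lemma hoare_compare: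
  assumes "A \<subseteq> inv" "D \<subseteq> {Blank, Duo False True, Duo True False}"
  shows "hoare budget A (compare D) {(AB, W) \<in> A. first_diff (letter_cells AB @ [Blank]) \<in> D}"
  by (rule hoare_inv[OF _ assms(1) gives_compare_rep[OF assms(2)]]) auto

lemma hoare_weaken: "hoare N A P A' \<Longrightarrow> B' \<subseteq> A \<Longrightarrow> A' \<subseteq> B'' \<Longrightarrow> hoare N B' P B''"
  unfolding hoare_def by blast

text \<open>Among the building blocks of \<open>search\<close> this is the one that is not
  \<open>keeping\<close>. Room for the new entry has to follow from \<open>P\<close> before the
  entry is written, since unfinished copies count as well.\<close>

lemma hoare_add:
  assumes "\<And>k v. v \<in> orb \<Longrightarrow> P k v \<Longrightarrow> Suc k \<le> card orb \<and> P' (Suc k) v"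
  shows "hoare budget (counting P) add_state (counting P')"
  unfolding hoare_def
proof (intro ballI allI impI)
  fix x z
  assume x: "x \<in> counting P" and z: "inz w z"
  obtain AB W where AB: "x = (AB, W)"
    by force
  have i: "(AB, W) \<in> inv" "snds AB \<in> orb" "P (length W) (snds AB)" "fsts AB \<in> orb"
    using x by (auto simp: AB counting_def)
  then obtain k where k: "wide k W" "shaped AB" "length W = k"
    by (auto simp: inv_def wide_def)
  have next_k: "Suc k \<le> card orb" "P' (Suc k) (snds AB)"
    using assms i k by auto
  then have "Suc k * (B + 1) \<le> card orb * (B + 1)"
    by (intro mult_le_mono1)
  then have "size_of (tape1 AB) + size_of (tape2 W) + B + 1 \<le> budget"
    unfolding size_of_tape budget_def length_letter_cells[OF k(2)] length_state_cells[OF k(1)] by simp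
  then have "safe {c. space c \<le> budget} add_state (z, rep x)"
    unfolding AB rep_def prod.case by (intro safe_add_state[OF _ z]) simp_all
  moreover have "snd c \<in> rep ` counting P'" if "c \<in> post add_state (z, rep x)" for c
  proof -
    have "snd c \<in> rep ` (if tr = [] then {} else {(AB, W @ [(False, replicate B False)])})"
      using givesD[OF gives_add z, of AB W] that by (force simp: AB rep_def)
    moreover have "(AB, W @ [(False, replicate B False)]) \<in> counting P'"
      using i k next_k by (auto simp: counting_def inv_def wide_def intro!: exI[of _ "Suc k"])
    ultimately show ?thesis
      by (auto split: if_splits)
  qed
  ultimately show "safe {c. space c \<le> budget} add_state (z, rep x) \<and>
      (\<forall>c\<in>post add_state (z, rep x). snd c \<in> rep ` counting P')"
    by blast
qed

definition counted :: "nat \<Rightarrow> bool list list \<Rightarrow> bool" where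
  "counted k v \<longleftrightarrow> k \<le> below v"

lemma first_diff_lt: "first_diff (letter_cells AB @ [Blank]) = Duo True False \<longleftrightarrow> snds AB < fsts AB"
  by (auto simp: first_diff_letter_cells simp del: map_eq_conv)

lemma first_diff_eq: "first_diff (letter_cells AB @ [Blank]) = Blank \<longleftrightarrow> fsts AB = snds AB"
  by (auto simp: first_diff_letter_cells simp del: map_eq_conv)

lemma first_diff_ne:
  "first_diff (letter_cells AB @ [Blank]) \<in> {Duo True False, Duo False True} \<longleftrightarrow> fsts AB \<noteq> snds AB"
  by (auto simp: first_diff_letter_cells simp del: map_eq_conv)

lemma hoare_count:
  assumes "u \<noteq> []"
  shows "hoare budget (counting counted) count_orbit (counting counted)"
  unfolding count_orbit_def
proof (intro hoare_Star hoare_Seq)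
  let ?less = "{(AB, W) \<in> counting counted. first_diff (letter_cells AB @ [Blank]) \<in> {Duo True False}}"
  show "hoare budget (counting counted) walk (counting counted)"
    by (rule hoare_walk[OF assms])
  show "hoare budget (counting counted) (compare {Duo True False}) ?less"
    by (rule hoare_compare[OF counting_inv]) simp
  \<comment> \<open>A strictly larger word of the orbit has a strictly larger rank; this pays for
    the next entry.\<close>
  have "Suc (length W) \<le> below (fsts AB)" if "(AB, W) \<in> ?less" for AB W
  proof -
    have "snds AB < fsts AB" "fsts AB \<in> orb" "length W \<le> below (snds AB)"
      using that by (simp_all add: first_diff_lt counting_def counted_def)
    then show ?thesis
      using below_less[of "snds AB" "fsts AB"] by simp
  qed
  then have "hoare budget ?less copy_track (counting (\<lambda>k v. Suc k \<le> below v) \<inter> {(AB, W). fsts AB = snds AB})"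
    by (intro hoare_copy) (auto simp: counting_def)
  then show "hoare budget ?less copy_track (counting (\<lambda>k v. Suc k \<le> below v))"
    by (rule hoare_weaken) auto
  show "hoare budget (counting (\<lambda>k v. Suc k \<le> below v)) add_state (counting counted)"
    using order_trans[OF _ below_le] by (intro hoare_add) (auto simp: counted_def)
qed

text \<open>\<open>W0\<close> is the list when the cycle began, \<open>x\<close> the concatenation
  of the pieces read so far and \<open>y\<close> its image; none of them is stored.
  \<open>trailing False\<close> describes the moment after a guess, with equal tracks, and
  \<open>trailing True\<close> the moment after a pass, when different tracks witness
  \<open>x \<noteq> y\<close>.\<close>

definition trailing :: "bool \<Rightarrow> ((bool \<times> bool) list list \<times> (bool \<times> bool list) list) set" where
  "trailing b = {(AB, W) \<in> inv. \<exists>v\<in>orb. \<exists>W0 x y. feed T W0 (v @ x) W (v @ y) \<and> length x = length y \<and>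
     (if b then fsts AB \<noteq> snds AB \<longrightarrow> x \<noteq> y else fsts AB = snds AB)}"

lemma trailing_inv: "trailing b \<subseteq> inv"
  by (auto simp: trailing_def)

lemma hoare_find_cycle:
  assumes "u \<noteq> []"
  shows "hoare budget (counting P \<inter> {(AB, W). fsts AB = snds AB}) find_cycle (trailing True)"
  unfolding find_cycle_def
proof (intro hoare_Seq)
  let ?E = "counting P \<inter> {(AB, W). fsts AB = snds AB}"
  let ?C = "{(AB, W) \<in> inv. snds AB \<in> orb \<and> (\<exists>W0. feed T W0 (snds AB) W (fsts AB))}"
  show "hoare budget ?E guess_states ({(AB, W) \<in> inv. snds AB \<in> orb \<and> fsts AB = snds AB})"
  proof (rule hoare_inv[OF _ _ gives_guess])
    fix AB W
    assume "(AB, W) \<in> ?E"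
    then show "{(AB, W') | W'. same_shape W W'} \<subseteq> {(AB, W) \<in> inv. snds AB \<in> orb \<and> fsts AB = snds AB}"
      using wide_guess by (auto simp: counting_def inv_def)
  qed (auto simp: counting_def)
  show "hoare budget {(AB, W) \<in> inv. snds AB \<in> orb \<and> fsts AB = snds AB} apply_states ?C"
  proof (rule hoare_inv[OF _ _ gives_apply])
    fix AB W
    assume a: "(AB, W) \<in> {(AB, W) \<in> inv. snds AB \<in> orb \<and> fsts AB = snds AB}"
    show "{(AB', W') | AB' W'. feeds W AB W' AB'} \<subseteq> ?C"
    proof clarify
      fix AB' W'
      assume f: "feeds W AB W' AB'"
      have "AB \<noteq> []"
        using inv_nonempty[OF assms] a by blast
      then have "feed T W (fsts AB) W' (fsts AB')"
        by (rule feeds_sound[OF f])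
      moreover have "fsts AB = snds AB"
        using a by (simp del: map_eq_conv)
      ultimately have "feed T W (snds AB) W' (fsts AB')"
        by (simp only:)
      then show "(AB', W') \<in> inv \<and> snds AB' \<in> orb \<and> (\<exists>W0. feed T W0 (snds AB') W' (fsts AB'))"
        using feeds_inv[OF f] feeds_shape[OF f] a by auto
    qed
  qed auto
  have "hoare budget ?C (compare {Blank}) {(AB, W) \<in> ?C. first_diff (letter_cells AB @ [Blank]) \<in> {Blank}}"
    by (rule hoare_compare) auto
  moreover have "(AB, W) \<in> trailing True"
    if a: "(AB, W) \<in> ?C" "first_diff (letter_cells AB @ [Blank]) \<in> {Blank}" for AB W
  proof -
    have eq: "fsts AB = snds AB"
      using a(2) by (simp add: first_diff_eq del: map_eq_conv)
    \<comment> \<open>At the start no piece has been read: \<open>x\<close> and \<open>y\<close> are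
      empty.\<close>
    then obtain W0 where "feed T W0 (snds AB @ []) W (snds AB @ [])" "snds AB \<in> orb" "(AB, W) \<in> inv"
      using a(1) by (auto simp del: map_eq_conv)
    then show ?thesis
      unfolding trailing_def using eq by (auto simp del: append_Nil2 map_eq_conv)
  qed
  ultimately show "hoare budget ?C (compare {Blank}) (trailing True)"
    by (elim hoare_weaken) auto
qed

lemma hoare_extend_cycle:
  assumes "u \<noteq> []"
  shows "hoare budget (trailing True) extend_cycle {x \<in> inv. expandable T u}"
proof -
  have guess: "hoare budget (trailing True) guess_word (trailing False)"
  proof (rule hoare_inv[OF _ trailing_inv gives_guess_word])
    fix AB W
    assume a: "(AB, W) \<in> trailing True"
    then obtain v W0 x y k where i: "v \<in> orb" "feed T W0 (v @ x) W (v @ y)" "length x = length y"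
      "shaped AB" "k \<le> card orb" "wide k W"
      by (auto simp: trailing_def inv_def)
    show "{(both_tracks A, W) | A. map length A = map length AB} \<subseteq> trailing False"
    proof clarify
      fix A :: "bool list list"
      assume "map length A = map length AB"
      then have "shaped (both_tracks A)"
        using i(4) unfolding shaped_both_tracks shaped_iff[of AB] by simp
      then have "(both_tracks A, W) \<in> inv"
        using i(5,6) by (auto simp: inv_def)
      then show "(both_tracks A, W) \<in> trailing False"
        unfolding trailing_def using i(1-3) by (simp add: both_tracks_tracks del: map_map map_eq_conv) blast
    qed
  qed simp
  have step: "hoare budget (trailing False) apply_states (trailing True)"
  proof (rule hoare_inv[OF _ trailing_inv gives_apply])
    fix AB W
    assume a: "(AB, W) \<in> trailing False"
    show "{(AB', W') | AB' W'. feeds W AB W' AB'} \<subseteq> trailing True"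
    proof clarify
      fix AB' W'
      assume f: "feeds W AB W' AB'"
      obtain v W0 x y where i: "(AB, W) \<in> inv" "v \<in> orb" "feed T W0 (v @ x) W (v @ y)" "length x = length y" "fsts AB = snds AB"
        using a by (auto simp: trailing_def simp del: map_eq_conv)
      have f': "feed T W (snds AB) W' (fsts AB')"
        using feeds_sound[OF f inv_nonempty[OF assms i(1)]] unfolding i(5) .
      have "feed T W0 (v @ x @ snds AB) W' (v @ y @ fsts AB')"
        using feed_append[OF i(3) f'] by simp
      moreover have "length (x @ snds AB) = length (y @ fsts AB')"
        using i(4) feed_length[OF f'] by simp
      \<comment> \<open>The second track still holds the guessed piece. As \<open>x\<close> and
        \<open>y\<close> have equal length, a change in the last piece separates the full words,
        whatever happened in earlier pieces.\<close>
      moreover have "fsts AB' \<noteq> snds AB' \<longrightarrow> x @ snds AB \<noteq> y @ fsts AB'"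
        using i(4) feeds_shape[OF f] by auto
      ultimately show "(AB', W') \<in> trailing True"
        unfolding trailing_def using feeds_inv[OF f i(1)] i(2) by fastforce
    qed
  qed simp
  have "hoare budget (trailing True) (compare {Duo True False, Duo False True})
      {(AB, W) \<in> trailing True. first_diff (letter_cells AB @ [Blank]) \<in> {Duo True False, Duo False True}}"
    by (rule hoare_compare[OF trailing_inv]) auto
  moreover have "expandable T u"
    if a: "(AB, W) \<in> trailing True" "first_diff (letter_cells AB @ [Blank]) \<in> {Duo True False, Duo False True}" for AB W
  proof -
    have "fsts AB \<noteq> snds AB"
      using a(2) unfolding first_diff_ne .
    then obtain v W0 x y where i: "v \<in> orb" "feed T W0 (v @ x) W (v @ y)" "length x = length y" "x \<noteq> y"
      using a(1) by (auto simp: trailing_def simp del: map_eq_conv)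
    let ?qs = "rev (active W0)"
    \<comment> \<open>Since \<open>x \<noteq> y\<close>, the word was changed, and the disjunction
      in \<open>feed_act\<close> shows that all guessed pieces were over the alphabet.\<close>
    have f: "v @ y = act T ?qs (v @ x)" "?qs \<in> lists Q" "v @ x \<in> lists \<Sigma>"
      using feed_act[OF i(2)] i(4) by (auto simp: in_lists_conv_set)
    have vx: "v \<in> lists \<Sigma>" "x \<in> lists \<Sigma>"
      using f(3) by simp_all
    have "length (act T ?qs v) = length v"
      using act_in[OF vx(1) f(2)] by simp
    moreover obtain y' where "act T ?qs (v @ x) = act T ?qs v @ y'"
      using act_prefix[OF vx f(2)] by blast
    ultimately have "act T ?qs v = v"
      using f(1) by (metis append_eq_append_conv)
    moreover have "act T ?qs (v @ x) \<noteq> v @ x"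
      using f(1) i(4) by (metis same_append_eq)
    ultimately show ?thesis
      using expandableI[OF u_in i(1) f(2) vx(2)] by blast
  qed
  ultimately have "hoare budget (trailing True) (compare {Duo True False, Duo False True}) {x \<in> inv. expandable T u}"
    using trailing_inv by (elim hoare_weaken) auto
  then show ?thesis
    unfolding extend_cycle_def by (rule hoare_Seq[OF hoare_Star[OF hoare_Seq[OF guess step]]])
qed

text \<open>The postcondition mentions expandability, which does not depend on the tapes: a single
  completed run proves it, and if \<open>u\<close> is not expandable, the set is empty and no run is
  completed.\<close>

lemma hoare_search:
  assumes "u \<noteq> []"
  shows "hoare budget {(both_tracks u, [])} search {x \<in> inv. expandable T u}"
  unfolding search_def
proof (intro hoare_Seq)
  have "(both_tracks u, []) \<in> counting (\<lambda>k v. k = 0)"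
    using orbit_self shaped_u by (auto simp: counting_def inv_def wide_def both_tracks_tracks simp del: map_map)
  moreover have "hoare budget (counting (\<lambda>k v. k = 0)) add_state (counting (\<lambda>k v. k = 1))"
    using below_self[OF orbit_self] below_le[of u] by (intro hoare_add) auto
  ultimately show "hoare budget {(both_tracks u, [])} add_state (counting (\<lambda>k v. k = 1))"
    by (elim hoare_weaken) auto
  show "hoare budget (counting (\<lambda>k v. k = 1)) walk (counting (\<lambda>k v. k = 1))"
    by (rule hoare_walk[OF assms])
  \<comment> \<open>Every word of the orbit has rank at least \<open>1\<close>, so one entry is
    admissible wherever the walk has stopped.\<close>
  have "hoare budget (counting (\<lambda>k v. k = 1)) copy_track (counting counted \<inter> {(AB, W). fsts AB = snds AB})"
    using below_self by (intro hoare_copy counting_inv) (auto simp: counting_def counted_def)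
  then show "hoare budget (counting (\<lambda>k v. k = 1)) copy_track (counting counted)"
    by (rule hoare_weaken) auto
  show "hoare budget (counting counted) count_orbit (counting counted)"
    by (rule hoare_count[OF assms])
  show "hoare budget (counting counted) walk (counting counted)"
    by (rule hoare_walk[OF assms])
  show "hoare budget (counting counted) copy_track (counting (\<lambda>_ _. True) \<inter> {(AB, W). fsts AB = snds AB})"
    by (intro hoare_copy counting_inv) (auto simp: counting_def)
  show "hoare budget (counting (\<lambda>_ _. True) \<inter> {(AB, W). fsts AB = snds AB}) find_cycle (trailing True)"
    by (rule hoare_find_cycle[OF assms])
  show "hoare budget (trailing True) extend_cycle {x \<in> inv. expandable T u}"
    by (rule hoare_extend_cycle[OF assms])
qed


section \<open>A completed run for every expandable word\<close>

definition flagged :: "nat \<Rightarrow> bool list list \<Rightarrow> (bool \<times> bool list) list" where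
  "flagged k qs = map (Pair True) qs @ replicate (k - length qs) (False, replicate B False)"

lemma active_flagged: "active (flagged k qs) = qs"
  by (simp add: flagged_def active_def comp_def)

lemma wide_flagged: "qs \<in> lists Q \<Longrightarrow> length qs \<le> k \<Longrightarrow> wide k (flagged k qs)"
  using state_length by (auto simp: flagged_def wide_def)

lemma wide_same_shape:
  assumes "wide k W" "wide k W'"
  shows "same_shape W W'"
  using assms unfolding wide_def list_all2_conv_all_nth by (metis nth_mem)

lemma can_pass:
  assumes "shaped AB" "wide k W" "qs \<in> lists Q" "length qs \<le> k" "feed T (flagged k qs) (fsts AB) W' A"
  shows "\<exists>AB'. can (Seq guess_states apply_states) (AB, W) (AB', W') \<and> fsts AB' = A \<and> snds AB' = snds AB \<and>
    shaped AB' \<and> wide k W'"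
proof -
  have wide: "wide k (flagged k qs)"
    by (rule wide_flagged[OF assms(3,4)])
  have "can guess_states (AB, W) (AB, flagged k qs)"
    using wide_same_shape[OF assms(2) wide] by (intro can_gives[OF gives_guess]) blast
  moreover obtain AB' where AB': "feeds (flagged k qs) AB W' AB'" "fsts AB' = A" "snds AB' = snds AB"
    using feeds_complete[OF assms(5)] assms(1) unfolding shaped_def by blast
  moreover have "can apply_states (AB, flagged k qs) (AB', W')"
    using AB'(1) by (intro can_gives[OF gives_apply]) blast
  ultimately show ?thesis
    using can_Seq feeds_shape[OF AB'(1)] wide shaped_snds assms(1) by blast
qed

text \<open>One state is applied per round, so a single slot is enough for sequences of any
  length.\<close>

lemma can_walk:
  assumes "k \<ge> 1" "qs \<in> lists Q"
  shows "shaped AB \<Longrightarrow> wide k W \<Longrightarrow> fsts AB \<in> lists \<Sigma> \<Longrightarrow>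
    \<exists>AB' W'. can walk (AB, W) (AB', W') \<and> fsts AB' = act T qs (fsts AB) \<and> snds AB' = snds AB \<and>
      shaped AB' \<and> wide k W'"
  using assms(2)
proof (induction qs arbitrary: AB W rule: rev_induct)
  case Nil
  then show ?case
    using can_Star_refl unfolding walk_def by (intro exI[of _ AB] exI[of _ W]) simp
next
  case (snoc q qs)
  have q: "[q] \<in> lists Q" "length [q] \<le> k" "qs \<in> lists Q"
    using snoc.prems(4) assms(1) by auto
  obtain W1 A where f: "feed T (flagged k [q]) (fsts AB) W1 A"
    using feed_ex[OF snoc.prems(3), of "flagged k [q]"] q(1) by (auto simp: active_flagged)
  have A: "A = act T [q] (fsts AB)"
    using feed_act[OF f] by (simp add: active_flagged)
  obtain AB1 where AB1: "can (Seq guess_states apply_states) (AB, W) (AB1, W1)" "fsts AB1 = A"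
    "snds AB1 = snds AB" "shaped AB1" "wide k W1"
    using can_pass[OF snoc.prems(1,2) q(1,2) f] by blast
  have "fsts AB1 \<in> lists \<Sigma>"
    using act_in[OF snoc.prems(3) q(1)] unfolding AB1(2) A by blast
  then obtain AB' W' where AB': "can walk (AB1, W1) (AB', W')" "fsts AB' = act T qs (fsts AB1)"
    "snds AB' = snds AB1" "shaped AB'" "wide k W'"
    using snoc.IH[OF AB1(4,5) _ q(3)] by blast
  have "can walk (AB, W) (AB', W')"
    using can_Star_step AB1(1) AB'(1) unfolding walk_def by blast
  moreover have "fsts AB' = act T (qs @ [q]) (fsts AB)"
    unfolding AB'(2) AB1(2) A by (simp only: act_append)
  ultimately show ?case
    using AB' AB1(3) by metis
qed

lemma can_walk_orb:
  assumes "k \<ge> 1" "shaped AB" "wide k W" "fsts AB \<in> orb" "A \<in> orb"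
  shows "\<exists>AB' W'. can walk (AB, W) (AB', W') \<and> fsts AB' = A \<and> snds AB' = snds AB \<and> shaped AB' \<and> wide k W'"
proof -
  have "A \<in> orbit T (fsts AB)"
    using orbit_eq[OF u_in assms(4)] assms(5) by simp
  then obtain qs where "qs \<in> lists Q" "A = act T qs (fsts AB)"
    by (auto simp: orbit_def)
  moreover have "fsts AB \<in> lists \<Sigma>"
    using orbit_in[OF u_in assms(4)] by blast
  ultimately show ?thesis
    using can_walk[OF assms(1) _ assms(2,3)] by blast
qed

lemma can_copy: "can copy_track (AB, W) (both_tracks (fsts AB), W)"
  by (rule can_gives[OF gives_copy]) simp

lemma can_compare:
  assumes "D \<subseteq> {Blank, Duo False True, Duo True False}" "first_diff (letter_cells AB @ [Blank]) \<in> D"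
  shows "can (compare D) (AB, W) (AB, W)"
  using assms(2) by (intro can_gives[OF gives_compare_rep[OF assms(1)]]) simp

lemma can_add: "tr \<noteq> [] \<Longrightarrow> can add_state (AB, W) (AB, W @ [(False, replicate B False)])"
  by (rule can_gives[OF gives_add]) simp

lemma wide_add: "wide k W \<Longrightarrow> wide (Suc k) (W @ [(False, replicate B False)])"
  by (simp add: wide_def)

text \<open>The least word of the orbit above \<open>v\<close> is the only new one among those up to
  it.\<close>

lemma below_next:
  assumes "v \<in> orb" "below v < card orb"
  shows "\<exists>v'\<in>orb. v < v' \<and> below v' = Suc (below v)"
proof -
  let ?A = "{x \<in> orb. v < x}"
  have fin: "finite ?A"
    using finite_orb by simp
  have "?A \<noteq> {}"
  proof
    assume "?A = {}"
    then have "{x \<in> orb. x \<le> v} = orb"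
      using not_le by blast
    then show False
      using assms(2) by (simp add: below_def)
  qed
  then have m: "Min ?A \<in> ?A"
    using Min_in fin by blast
  have "{x \<in> orb. x \<le> Min ?A} = insert (Min ?A) {x \<in> orb. x \<le> v}"
  proof (intro set_eqI iffI)
    fix x
    assume x: "x \<in> {x \<in> orb. x \<le> Min ?A}"
    show "x \<in> insert (Min ?A) {x \<in> orb. x \<le> v}"
    proof (cases "x \<le> v")
      case False
      then have "x \<in> ?A"
        using x by auto
      then have "Min ?A \<le> x"
        using fin Min_le by blast
      then show ?thesis
        using x by auto
    qed (use x in auto)
  next
    fix x
    assume "x \<in> insert (Min ?A) {x \<in> orb. x \<le> v}"
    then show "x \<in> {x \<in> orb. x \<le> Min ?A}"
      using m by auto
  qed
  moreover have "Min ?A \<notin> {x \<in> orb. x \<le> v}"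
    using m by auto
  ultimately have "below (Min ?A) = Suc (below v)"
    using finite_orb by (simp add: below_def)
  then show ?thesis
    using m by blast
qed

text \<open>The run visits the orbit in increasing order without skipping, so the length of the list
  equals the rank throughout and ends at \<open>card orb\<close>.\<close>

lemma can_count:
  assumes "tr \<noteq> []"
  shows "shaped AB \<Longrightarrow> fsts AB \<in> orb \<Longrightarrow> snds AB \<in> orb \<Longrightarrow> wide (below (snds AB)) W \<Longrightarrow>
    \<exists>AB' W'. can count_orbit (AB, W) (AB', W') \<and> shaped AB' \<and> fsts AB' \<in> orb \<and> wide (card orb) W'"
proof (induction "card orb - below (snds AB)" arbitrary: AB W)
  case 0
  then have "below (snds AB) = card orb"
    using below_le[of "snds AB"] by simp
  then show ?case
    using 0 can_Star_refl unfolding count_orbit_def by metis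
next
  case (Suc d)
  then have "below (snds AB) < card orb"
    by simp
  then obtain v where v: "v \<in> orb" "snds AB < v" "below v = Suc (below (snds AB))"
    using below_next Suc.prems(3) by blast
  have "below (snds AB) \<ge> 1"
    using below_self Suc.prems(3) by blast
  then obtain AB1 W1 where AB1: "can walk (AB, W) (AB1, W1)" "fsts AB1 = v" "snds AB1 = snds AB"
    "shaped AB1" "wide (below (snds AB)) W1"
    using can_walk_orb[OF _ Suc.prems(1,4,2) v(1)] by blast
  have "can (compare {Duo True False}) (AB1, W1) (AB1, W1)"
    using v(2) AB1(2,3) by (intro can_compare) (simp_all add: first_diff_lt del: map_eq_conv)
  moreover have "can copy_track (AB1, W1) (both_tracks v, W1)"
    using can_copy[of AB1 W1] AB1(2) by simp
  moreover have "can add_state (both_tracks v, W1) (both_tracks v, W1 @ [(False, replicate B False)])"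
    by (rule can_add[OF assms])
  ultimately have step: "can (Seq walk (Seq (compare {Duo True False}) (Seq copy_track add_state))) (AB, W)
      (both_tracks v, W1 @ [(False, replicate B False)])"
    using AB1(1) can_Seq by blast
  have "shaped (both_tracks v)"
    using shaped_copy[OF AB1(4)] AB1(2) by simp
  moreover have "wide (below (snds (both_tracks v))) (W1 @ [(False, replicate B False)])"
    using wide_add[OF AB1(5)] v(3) by (simp add: both_tracks_tracks del: map_map)
  moreover have "d = card orb - below (snds (both_tracks v))"
    using Suc.hyps(2) v(3) by (simp add: both_tracks_tracks del: map_map)
  ultimately obtain AB' W' where "can count_orbit (both_tracks v, W1 @ [(False, replicate B False)]) (AB', W')"
    "shaped AB'" "fsts AB' \<in> orb" "wide (card orb) W'"
    using Suc.hyps(1)[of "both_tracks v" "W1 @ [(False, replicate B False)]"] v(1)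
    by (auto simp: both_tracks_tracks simp del: map_map)
  then show ?case
    using can_Star_step[OF step] unfolding count_orbit_def by blast
qed

text \<open>Induction on the number of pieces: if the first piece is changed, the comparison passes
  at once; otherwise the remaining word is moved by the sections in \<open>W1\<close>.\<close>

lemma can_extend:
  assumes "u \<noteq> []"
  shows "shaped AB \<Longrightarrow> active W \<in> lists Q \<Longrightarrow> X \<in> lists \<Sigma> \<Longrightarrow> length X = m * length u \<Longrightarrow>
    act T (rev (active W)) X \<noteq> X \<Longrightarrow> \<exists>y. can extend_cycle (AB, W) y"
proof (induction m arbitrary: AB W X)
  case 0
  then have "length (act T (rev (active W)) X) = 0"
    using act_in[OF 0(3), of "rev (active W)"] by (auto simp: in_lists_conv_set)
  then show ?case
    using 0 by simp
next
  case (Suc m)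
  define x where "x = take (length u) X"
  define X' where "X' = drop (length u) X"
  have X: "X = x @ X'" "length x = length u" "length X' = m * length u"
    using Suc.prems(4) by (simp_all add: x_def X'_def)
  then have in_\<Sigma>: "x \<in> lists \<Sigma>" "X' \<in> lists \<Sigma>"
    using Suc.prems(3) by simp_all
  obtain W1 y where f: "feed T W x W1 y"
    using feed_ex[OF in_\<Sigma>(1) Suc.prems(2)] by blast
  have W1: "active W1 \<in> lists Q"
    using feed_act[OF f] by blast
  obtain W2 Y where f': "feed T W1 X' W2 Y"
    using feed_ex[OF in_\<Sigma>(2) W1] by blast
  have Y: "Y = act T (rev (active W1)) X'"
    using feed_act[OF f'] by blast
  have "act T (rev (active W)) X = y @ Y"
    using feed_act[OF feed_append[OF f f']] X(1) by simp
  then have ne: "y \<noteq> x \<or> Y \<noteq> X'"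
    using Suc.prems(5) X(1) by auto
  have "map length x = map (\<lambda>_. K) x"
    using in_\<Sigma>(1) letter_length by (intro map_cong) (auto simp: in_lists_conv_set)
  then have len: "map length x = replicate (length u) K"
    using X(2) by (simp add: map_replicate_const)
  moreover have "map length AB = replicate (length u) K"
    using Suc.prems(1) by (simp add: shaped_iff)
  ultimately have guess: "can guess_word (AB, W) (both_tracks x, W)"
    using len by (intro can_gives[OF gives_guess_word]) auto
  have shaped_x: "shaped (both_tracks x)"
    unfolding shaped_both_tracks by (rule len)
  obtain AB1 where AB1: "feeds W (both_tracks x) W1 AB1" "fsts AB1 = y" "snds AB1 = x"
    using feeds_complete[OF f, of "both_tracks x"] shaped_x unfolding shaped_def
    by (metis both_tracks_tracks)
  have "can apply_states (both_tracks x, W) (AB1, W1)"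
    using AB1(1) by (intro can_gives[OF gives_apply]) blast
  then have step: "can (Seq guess_word apply_states) (AB, W) (AB1, W1)"
    using guess can_Seq by blast
  have shaped1: "shaped AB1"
    using shaped_snds shaped_x AB1(3) both_tracks_tracks(2) by metis
  show ?case
  proof (cases "y = x")
    case False
    then have "first_diff (letter_cells AB1 @ [Blank]) \<in> {Duo True False, Duo False True}"
      unfolding first_diff_ne AB1(2,3) .
    then have "can (compare {Duo True False, Duo False True}) (AB1, W1) (AB1, W1)"
      by (intro can_compare) auto
    then show ?thesis
      using can_Seq[OF can_Star_step[OF step can_Star_refl]] unfolding extend_cycle_def by blast
  next
    case True
    then obtain y' where "can extend_cycle (AB1, W1) y'"
      using Suc.IH[OF shaped1 W1 in_\<Sigma>(2) X(3)] ne Y by blast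
    then have "can (Seq (Seq guess_word apply_states) extend_cycle) (AB, W) y'"
      using step can_Seq by blast
    moreover have "post (Seq (Seq guess_word apply_states) extend_cycle) c \<subseteq> post extend_cycle c" for c
      using post_Seq_Star[of "Seq guess_word apply_states" "compare {Duo True False, Duo False True}" c]
      unfolding extend_cycle_def post.simps(2)[of "Seq guess_word apply_states"] by blast
    ultimately show ?thesis
      unfolding can_def by blast
  qed
qed

lemma can_assoc: "can (Seq (Seq P1 P2) P3) x y \<Longrightarrow> can (Seq P1 (Seq P2 P3)) x y"
  unfolding can_def by simp

text \<open>\<open>add_state\<close> copies the width of a state from a transition, so the run to be
  constructed needs at least one.\<close>

lemma expandable_trans:
  assumes "u \<noteq> []" "expandable T u"
  shows "tr \<noteq> []"
proof -
  obtain v qs x where "qs \<in> lists Q" "act T qs (v @ x) \<noteq> v @ x"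
    using expandableD[OF u_in assms(2)] by blast
  then obtain q where "q \<in> Q"
    by (cases qs) auto
  moreover obtain a where "a \<in> \<Sigma>"
    using \<Sigma>_nonempty by blast
  ultimately show ?thesis
    using trans_ex trans by fastforce
qed

lemma can_search:
  assumes "u \<noteq> []" "expandable T u"
  shows "\<exists>y. can search (both_tracks u, []) y"
proof -
  obtain v qs x where v: "v \<in> orb" and qs: "qs \<in> lists Q" and x: "x \<in> lists \<Sigma>"
    and len: "length qs \<le> card orb" and cycle: "act T qs v = v" "act T qs (v @ x) \<noteq> v @ x"
    using expandable_short_cycle[OF u_in assms(2)] by blast
  have v_in: "v \<in> lists \<Sigma>"
    using orbit_in[OF u_in v] by blast
  have tr: "tr \<noteq> []"
    using expandable_trans assms by blast
  let ?one = "[(False, replicate B False)]"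
  have c1: "can add_state (both_tracks u, []) (both_tracks u, ?one)"
    using can_add[OF tr, of "both_tracks u" "[]"] by simp
  \<comment> \<open>At the least word, the single entry present so far is exactly the rank.\<close>
  have first: "below (Min orb) = 1" "Min orb \<in> orb"
  proof -
    show m: "Min orb \<in> orb"
      using finite_orb v by (intro Min_in) auto
    have "{x \<in> orb. x \<le> Min orb} = {Min orb}"
      using finite_orb m by (auto intro: antisym)
    then show "below (Min orb) = 1"
      by (simp add: below_def)
  qed
  have one: "wide 1 ?one"
    by (simp add: wide_def)
  obtain AB1 W1 where AB1: "can walk (both_tracks u, ?one) (AB1, W1)" "fsts AB1 = Min orb" "shaped AB1" "wide 1 W1"
    using can_walk_orb[OF _ shaped_u one _ first(2)] orbit_self by (auto simp: both_tracks_tracks simp del: map_map)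
  have c3: "can copy_track (AB1, W1) (both_tracks (Min orb), W1)"
    using can_copy[of AB1 W1] AB1(2) by simp
  obtain AB2 W2 where AB2: "can count_orbit (both_tracks (Min orb), W1) (AB2, W2)"
    "shaped AB2" "fsts AB2 \<in> orb" "wide (card orb) W2"
    using can_count[OF tr, of "both_tracks (Min orb)" W1] shaped_copy[OF AB1(3)] AB1(2,4) first
    by (auto simp: both_tracks_tracks simp del: map_map)
  obtain AB3 W3 where AB3: "can walk (AB2, W2) (AB3, W3)" "fsts AB3 = v" "shaped AB3" "wide (card orb) W3"
    using can_walk_orb[OF _ AB2(2,4,3) v] below_self[OF v] below_le[of v] by fastforce
  have c6: "can copy_track (AB3, W3) (both_tracks v, W3)"
    using can_copy[of AB3 W3] AB3(2) by simp
  have shaped3: "shaped (both_tracks v)"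
    using shaped_copy[OF AB3(3)] AB3(2) by simp
  \<comment> \<open>The list on the tape has the entry that acts first at its head, whereas in
    \<open>qs\<close> it comes last.\<close>
  have rev_qs: "rev qs \<in> lists Q" "length (rev qs) \<le> card orb"
    using qs len by auto
  obtain W4 v' where f: "feed T (flagged (card orb) (rev qs)) v W4 v'"
    using feed_ex[OF v_in, of "flagged (card orb) (rev qs)"] rev_qs(1) by (auto simp: active_flagged)
  have v': "v' = v" and W4: "active W4 \<in> lists Q"
    using feed_act[OF f] cycle(1) by (simp_all add: active_flagged)
  obtain AB4 where AB4: "can (Seq guess_states apply_states) (both_tracks v, W3) (AB4, W4)" "fsts AB4 = v"
    "snds AB4 = v" "shaped AB4"
    using can_pass[OF shaped3 AB3(4) rev_qs, of W4 v'] f v' by (auto simp: both_tracks_tracks simp del: map_map)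
  have "first_diff (letter_cells AB4 @ [Blank]) \<in> {Blank}"
    using AB4(2,3) by (simp add: first_diff_eq del: map_eq_conv)
  then have c8: "can (compare {Blank}) (AB4, W4) (AB4, W4)"
    by (intro can_compare) auto
  obtain a where a: "a \<in> \<Sigma>"
    using \<Sigma>_nonempty by blast
  \<comment> \<open>Padding brings the length to \<open>length x * length u\<close>, a multiple of
    the length of a piece. As the action respects prefixes, a word that extends \<open>x\<close> is
    moved as well.\<close>
  define X where "X = x @ replicate (length x * (length u - 1)) a"
  have X: "X \<in> lists \<Sigma>" "length X = length x * length u"
    using x a assms(1) by (auto simp: X_def algebra_simps) (cases u; simp)
  have "act T (rev (active W4)) X \<noteq> X"
  proof
    assume eq: "act T (rev (active W4)) X = X"
    obtain W5 Y where f': "feed T W4 X W5 Y"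
      using feed_ex[OF X(1) W4] by blast
    have "Y = X"
      using feed_act[OF f'] eq by simp
    then have "act T qs (v @ X) = v @ X"
      using feed_act[OF feed_append[OF f f']] v' by (simp add: active_flagged)
    moreover have "replicate (length x * (length u - 1)) a \<in> lists \<Sigma>"
      using a by (auto simp: in_lists_conv_set)
    then obtain z where "act T qs ((v @ x) @ replicate (length x * (length u - 1)) a) = act T qs (v @ x) @ z"
      using act_prefix[of "v @ x" "replicate (length x * (length u - 1)) a" qs] v_in x qs by auto
    moreover have "length (act T qs (v @ x)) = length (v @ x)"
      using act_in[of "v @ x" qs] v_in x qs by simp
    ultimately have "act T qs (v @ x) = v @ x"
      unfolding X_def by (metis append.assoc append_eq_append_conv)
    then show False
      using cycle(2) by simp
  qed
  then obtain y where "can extend_cycle (AB4, W4) y"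
    using can_extend[OF assms(1) AB4(4) W4 X(1,2)] by blast
  moreover have "can find_cycle (both_tracks v, W3) (AB4, W4)"
    unfolding find_cycle_def by (rule can_assoc[OF can_Seq[OF AB4(1) c8]])
  ultimately have "can (Seq find_cycle extend_cycle) (both_tracks v, W3) y"
    using can_Seq by blast
  from can_Seq[OF c1 can_Seq[OF AB1(1) can_Seq[OF c3 can_Seq[OF AB2(1) can_Seq[OF AB3(1) can_Seq[OF c6 this]]]]]]
  show ?thesis
    unfolding search_def by blast
qed

section \<open>Correctness and space of the decider\<close>

theorem decider_accepts: "post decider (init_cfg w) \<noteq> {} \<longleftrightarrow> expandable T u"
proof (cases "u = []")
  case True
  \<comment> \<open>The branches exclude each other: \<open>setup_tapes\<close> fails if nothing
    follows \<open>Hash\<close>, and \<open>empty_case\<close> fails if something does.\<close>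
  then have "post (Seq setup_tapes search) (init_cfg w) = {}"
    using post_setup_tapes by simp
  then have "post decider (init_cfg w) \<noteq> {} \<longleftrightarrow> post empty_case (init_cfg w) \<noteq> {}"
    by (simp add: decider_def)
  then show ?thesis
    using expandable_Nil_iff True unfolding post_empty_case trans by simp
next
  case False
  have filled: "snd ` post setup_tapes (init_cfg w) = {rep (both_tracks u, [])}"
    using post_setup_tapes False by (simp add: rep_def)
  have inz: "inz w (fst c)" if "c \<in> post setup_tapes (init_cfg w)" for c
    using post_inz[OF that] inz_start by (simp add: init_cfg_def)
  have "post empty_case (init_cfg w) = {}"
    using post_empty_case False by blast
  then have "post decider (init_cfg w) = (\<Union>c\<in>post setup_tapes (init_cfg w). post search c)"
    by (simp add: decider_def)
  moreover have "post search c = {}" if "\<not> expandable T u" "c \<in> post setup_tapes (init_cfg w)" for c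
  proof -
    have "c = (fst c, rep (both_tracks u, []))"
      using filled that(2) by (metis imageI prod.collapse singletonD)
    moreover have "c' \<notin> post search (fst c, rep (both_tracks u, []))" for c'
      using hoareD(2)[OF hoare_search[OF False] _ inz[OF that(2)]] that(1) by blast
    ultimately show ?thesis
      by (metis equals0I)
  qed
  moreover have "\<exists>c\<in>post setup_tapes (init_cfg w). post search c \<noteq> {}" if e: "expandable T u"
  proof -
    obtain c where c: "c \<in> post setup_tapes (init_cfg w)" "rep (both_tracks u, []) = snd c"
      using filled by (metis imageE insertI1)
    obtain y where "can search (both_tracks u, []) y"
      using can_search[OF False e] by blast
    then have "post search (fst c, rep (both_tracks u, [])) \<noteq> {}"
      using inz[OF c(1)] unfolding can_def by blast
    then show ?thesis
      using c by (metis prod.collapse)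
  qed
  ultimately show ?thesis
    by blast
qed

text \<open>Both branches are tried on every input, so each has to respect the bound also where it
  cannot succeed.\<close>

theorem decider_safe: "safe_all {c. space c \<le> budget} [decider] (init_cfg w)"
proof -
  let ?S = "{c. space c \<le> budget}"
  have init: "space (init_cfg w) \<le> budget" "ended (fst (snd (init_cfg w)))" "ended (snd (snd (init_cfg w)))"
    by (simp_all add: init_cfg_def input_cells_def budget_def)
  then have "safe ?S empty_case (init_cfg w)"
    by (intro safe_keeping) simp_all
  moreover have "post empty_case (init_cfg w) \<subseteq> ?S"
  proof
    fix c
    assume c: "c \<in> post empty_case (init_cfg w)"
    have "space c = space (init_cfg w)"
      using post_keeping[OF keeping_seek(4) init(2,3) c] by blast
    then show "c \<in> ?S"
      using init(1) by simp
  qed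
  moreover have "length (enc_word u) = length u * (K + 1)"
    using arg_cong[OF copy_enc_word[of u], of length] length_letter_cells[OF shaped_u] by simp
  then have "safe ?S setup_tapes (init_cfg w)"
    by (intro safe_setup_tapes) (simp add: budget_def)
  moreover have "safe ?S search c \<and> post search c \<subseteq> ?S" if c: "c \<in> post setup_tapes (init_cfg w)" for c
  proof -
    have "snd c \<in> (if u = [] then {} else {(tape1 (both_tracks u), tape2 [])})"
      using post_setup_tapes c by blast
    then have u: "u \<noteq> []" "snd c = rep (both_tracks u, [])"
      by (simp_all add: rep_def split: if_splits)
    have inz: "inz w (fst c)"
      using post_inz[OF c] inz_start by (simp add: init_cfg_def)
    have "safe ?S search (fst c, snd c)"
      unfolding u(2) using inz by (intro hoareD(1)[OF hoare_search[OF u(1)]]) simp_all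
    moreover have "space c' \<le> budget" if "c' \<in> post search (fst c, snd c)" for c'
    proof -
      have "snd c' \<in> rep ` {x \<in> inv. expandable T u}"
        using that unfolding u(2) by (intro hoareD(2)[OF hoare_search[OF u(1)] _ inz]) simp_all
      then obtain AB W where x: "(AB, W) \<in> inv" "snd c' = (tape1 AB, tape2 W)"
        by (auto simp: rep_def)
      have "space (fst c', snd c') \<le> budget"
        using inv_budget[OF x(1)] unfolding x(2) space_eq size_of_tape by simp
      then show ?thesis
        by simp
    qed
    moreover have "(fst c, snd c) = c"
      by simp
    ultimately show ?thesis
      unfolding subset_eq mem_Collect_eq by metis
  qed
  ultimately show ?thesis
    unfolding safe_all.simps decider_def safe.simps(2,3) post.simps(2,3) by blast
qed

end

section \<open>Inverse images of homomorphisms\<close>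

lemma concat_map_nth:
  assumes "k < length xs" "j < length (f (xs ! k))"
  shows "concat (map f xs) ! (length (concat (map f (take k xs))) + j) = f (xs ! k) ! j"
proof -
  have "concat (map f xs) = concat (map f (take k xs)) @ f (xs ! k) @ concat (map f (drop (Suc k) xs))"
    using id_take_nth_drop[OF assms(1)] by (metis concat.simps(2) concat_append list.simps(9) map_append)
  then show ?thesis
    using assms(2) by (simp only: nth_append_length_plus) (simp add: nth_append)
qed

text \<open>A machine for the words \<open>P @ concat (map h u)\<close> is run on the input \<open>u\<close>: the input head stands on
  the letter whose image is scanned, and the control state holds the position in the image. After
  a move to the left this position is the last one of an image that has not been scanned yet; it is
  coded by \<open>0\<close>, and position \<open>j\<close> by \<open>Suc j\<close>.\<close>

locale inverse_image =
  fixes M :: "'i ntm" and P :: "'i list" and h :: "'a \<Rightarrow> 'i list" and S :: "'a set"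
  assumes M: "ntm M" and fin: "finite S" and nonempty: "a \<in> S \<Longrightarrow> h a \<noteq> []"
begin

text \<open>The prefix \<open>P\<close> belongs to the image of the left end marker. Thus each cell
  of the simulated tape is one position in the image of exactly one cell of the real tape.\<close>

fun image_cells :: "'a input_cell \<Rightarrow> 'i input_cell list" where
  "image_cells Left_End = Left_End # map Cell P"
| "image_cells (Cell a) = map Cell (h a)"
| "image_cells Right_End = [Right_End]"

definition place :: "'a input_cell \<Rightarrow> nat \<Rightarrow> nat" where
  "place i c = (case c of 0 \<Rightarrow> length (image_cells i) - 1 | Suc j \<Rightarrow> j)"

fun shift :: "'a input_cell \<Rightarrow> nat \<Rightarrow> move \<Rightarrow> nat \<times> move" where
  "shift i j Stay = (Suc j, Stay)"
| "shift i j Right = (if Suc j < length (image_cells i) then (Suc (Suc j), Stay) else (Suc 0, Right))"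
| "shift i j Left = (if j > 0 then (j, Stay) else if i = Left_End then (Suc 0, Stay) else (0, Left))"

definition cells :: "'a input_cell set" where
  "cells = {Left_End, Right_End} \<union> Cell ` S"

text \<open>A machine has only one accepting state, so all positions of the original accepting state
  share the code \<open>0\<close>. The position is lost there, and \<open>pulled\<close> therefore
  simulates no instruction from that state.\<close>

definition code :: "nat \<Rightarrow> nat \<Rightarrow> nat" where
  "code s c = (if s = ntm_accept M then 0 else Suc (prod_encode (s, c)))"

definition pulled :: "'a ntm" where
  "pulled = \<lparr>ntm_tapes = ntm_tapes M, ntm_start = code (ntm_start M) (Suc 0), ntm_accept = 0,
     ntm_instrs = {(code s c, i, gs, code s' (fst (shift i (place i c) d)), snd (shift i (place i c) d), ws) |
       s c i gs s' d ws. s \<noteq> ntm_accept M \<and> i \<in> cells \<and> c \<le> length (image_cells i) \<and>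
       (s, image_cells i ! place i c, gs, s', d, ws) \<in> ntm_instrs M}\<rparr>"

lemma ntm_pulled: "ntm pulled"
proof -
  let ?C = "SIGMA i : cells. {..length (image_cells i)}"
  let ?f = "\<lambda>((i, c), (s, r, gs, s', d, ws)).
    (code s c, i, gs, code s' (fst (shift i (place i c) d)), snd (shift i (place i c) d), ws)"
  have "ntm_instrs pulled \<subseteq> ?f ` (?C \<times> ntm_instrs M)"
  proof
    fix x
    assume "x \<in> ntm_instrs pulled"
    then obtain s c i gs s' d ws where "x = ?f ((i, c), (s, image_cells i ! place i c, gs, s', d, ws))"
      and "((i, c), (s, image_cells i ! place i c, gs, s', d, ws)) \<in> ?C \<times> ntm_instrs M"
      by (auto simp: pulled_def)
    then show "x \<in> ?f ` (?C \<times> ntm_instrs M)"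
      by (rule image_eqI)
  qed
  moreover have "finite (?f ` (?C \<times> ntm_instrs M))"
    using M fin by (intro finite_imageI finite_cartesian_product finite_SigmaI) (auto simp: cells_def ntm_def)
  ultimately have "finite (ntm_instrs pulled)"
    using finite_subset by blast
  moreover have "\<forall>(s, i, gs, s', d, ws) \<in> ntm_instrs pulled. length gs = ntm_tapes pulled \<and> length ws = ntm_tapes pulled"
    using M by (fastforce simp: pulled_def ntm_def)
  ultimately show ?thesis
    by (simp add: ntm_def)
qed

context
  fixes u :: "'a list"
  assumes u: "u \<in> lists S"
begin

definition v :: "'i list" where
  "v = P @ concat (map h u)"

definition offset :: "nat \<Rightarrow> nat" where
  "offset k = length (concat (map image_cells (take k (input_cells u))))"

lemma cells_v: "concat (map image_cells (input_cells u)) = input_cells v"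
  by (simp add: input_cells_def v_def map_concat comp_def)

lemma length_input_cells: "length (input_cells w) = length w + 2"
  by (simp add: input_cells_def)

lemma input_cells_in: "k \<le> Suc (length u) \<Longrightarrow> input_cells u ! k \<in> cells"
proof -
  assume "k \<le> Suc (length u)"
  then have "input_cells u ! k \<in> set (input_cells u)"
    by (intro nth_mem) (simp add: length_input_cells)
  then show ?thesis
    using u by (auto simp: input_cells_def cells_def)
qed

lemma image_cells_nonempty: "i \<in> cells \<Longrightarrow> length (image_cells i) > 0"
  using nonempty by (auto simp: cells_def)

lemma offset_Suc: "k \<le> Suc (length u) \<Longrightarrow> offset (Suc k) = offset k + length (image_cells (input_cells u ! k))"
  by (simp add: offset_def take_Suc_conv_app_nth length_input_cells)

lemma offset_le: "k \<le> Suc (length u) \<Longrightarrow> offset k + length (image_cells (input_cells u ! k)) \<le> length v + 2"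
proof -
  assume k: "k \<le> Suc (length u)"
  have "input_cells u = take (Suc k) (input_cells u) @ drop (Suc k) (input_cells u)"
    by simp
  then have "length (concat (map image_cells (input_cells u))) \<ge> offset (Suc k)"
    unfolding offset_def by (metis concat_append length_append map_append le_add1)
  then show ?thesis
    using offset_Suc[OF k] unfolding cells_v length_input_cells by simp
qed

lemma read_image:
  assumes "k \<le> Suc (length u)" "j < length (image_cells (input_cells u ! k))"
  shows "input_read v (offset k + j) = image_cells (input_cells u ! k) ! j"
proof -
  have "input_read v (offset k + j) = input_cells v ! (offset k + j)"
    using offset_le[OF assms(1)] assms(2) by (intro input_read_nth) simp
  also have "\<dots> = image_cells (input_cells u ! k) ! j"
    unfolding cells_v[symmetric] offset_def using assms by (intro concat_map_nth) (simp_all add: length_input_cells)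
  finally show ?thesis .
qed

lemma cell_kinds:
  "k \<le> Suc (length u) \<Longrightarrow> input_cells u ! k = Left_End \<longleftrightarrow> k = 0"
  "k \<le> Suc (length u) \<Longrightarrow> k = Suc (length u) \<Longrightarrow> input_cells u ! k = Right_End"
  by (auto simp: input_cells_def nth_Cons' nth_append)

lemma shift_correct:
  assumes k: "k \<le> Suc (length u)" and j: "j < length (image_cells (input_cells u ! k))"
    and c: "(c', d') = shift (input_cells u ! k) j d"
  defines "k' \<equiv> input_move u d' k"
  shows "k' \<le> Suc (length u) \<and> c' \<le> length (image_cells (input_cells u ! k')) \<and>
    input_move v d (offset k + j) = offset k' + place (input_cells u ! k') c'"
proof (cases d)
  case Stay
  then show ?thesis
    using assms by (simp add: place_def)
next
  case Left
  show ?thesis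
  proof (cases "j > 0")
    case True
    then show ?thesis
      using assms Left by (cases j) (simp_all add: place_def)
  next
    case False
    show ?thesis
    proof (cases k)
      case 0
      then have "input_cells u ! k = Left_End"
        using cell_kinds(1)[OF k] by simp
      then show ?thesis
        using assms Left False 0 by (simp add: place_def offset_def)
    next
      case (Suc k0)
      then have ne: "input_cells u ! k \<noteq> Left_End" and k0: "k0 \<le> Suc (length u)"
        using cell_kinds(1)[OF k] k by simp_all
      have "length (image_cells (input_cells u ! k0)) > 0"
        by (rule image_cells_nonempty[OF input_cells_in[OF k0]])
      then obtain n where "length (image_cells (input_cells u ! k0)) = Suc n"
        using gr0_implies_Suc by blast
      then show ?thesis
        using c Left False ne Suc k0 offset_Suc[OF k0] by (simp add: place_def k'_def)
    qed
  qed
next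
  case Right
  have le: "offset k + length (image_cells (input_cells u ! k)) \<le> length v + 2"
    by (rule offset_le[OF k])
  show ?thesis
  proof (cases "Suc j < length (image_cells (input_cells u ! k))")
    case True
    then show ?thesis
      using c Right k le by (simp add: place_def k'_def)
  next
    case False
    then have last: "length (image_cells (input_cells u ! k)) = Suc j"
      using j by simp
    show ?thesis
    proof (cases "k = Suc (length u)")
      case True
      then have "input_cells u ! k = Right_End"
        using cell_kinds(2) by simp
      \<comment> \<open>The right end marker is the last cell on both tapes, so both heads stay
        where they are.\<close>
      moreover have "offset k + 1 = length v + 2"
      proof -
        have "offset (Suc k) = length (input_cells v)"
          unfolding cells_v[symmetric] offset_def using True by (simp add: length_input_cells)
        then show ?thesis
          using offset_Suc[OF k] calculation by (simp add: length_input_cells)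
      qed
      ultimately show ?thesis
        using c Right True last by (simp add: place_def k'_def)
    next
      case False
      then have Suc_k: "Suc k \<le> Suc (length u)"
        using k by simp
      have pos: "length (image_cells (input_cells u ! Suc k)) > 0"
        by (rule image_cells_nonempty[OF input_cells_in[OF Suc_k]])
      then have "Suc (offset k + j) \<le> Suc (length v)"
        using offset_le[OF Suc_k] offset_Suc[OF k] last by linarith
      moreover have "offset (Suc k) = Suc (offset k + j)"
        using offset_Suc[OF k] last by simp
      ultimately show ?thesis
        using c Right Suc_k last pos by (simp add: place_def k'_def Suc_le_eq)
    qed
  qed
qed

text \<open>The code \<open>c\<close> is not a function of the position: the last cell of an image
  is described both by \<open>0\<close> and by the successor of its index.\<close>

definition related :: "config \<Rightarrow> config \<Rightarrow> bool" where
  "related = (\<lambda>(s, p, ts) (s', k, ts'). ts' = ts \<and> k \<le> Suc (length u) \<and>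
     (\<exists>c \<le> length (image_cells (input_cells u ! k)). s' = code s c \<and> p = offset k + place (input_cells u ! k) c))"

lemma place_less: "i \<in> cells \<Longrightarrow> c \<le> length (image_cells i) \<Longrightarrow> place i c < length (image_cells i)"
  using image_cells_nonempty by (auto simp: place_def split: nat.split)

lemma code_eq: "code s c = code s' c' \<Longrightarrow> s = s' \<and> (s \<noteq> ntm_accept M \<longrightarrow> c = c')"
  by (auto simp: code_def split: if_splits)

lemma read_related:
  assumes "k \<le> Suc (length u)" "c \<le> length (image_cells (input_cells u ! k))"
  shows "input_read v (offset k + place (input_cells u ! k) c) = image_cells (input_cells u ! k) ! place (input_cells u ! k) c"
  by (rule read_image[OF assms(1) place_less[OF input_cells_in[OF assms(1)] assms(2)]])

lemma move_related:
  assumes "k \<le> Suc (length u)" "c \<le> length (image_cells (input_cells u ! k))"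
  shows "related (s, input_move v d (offset k + place (input_cells u ! k) c), ts)
    (code s (fst (shift (input_cells u ! k) (place (input_cells u ! k) c) d)),
     input_move u (snd (shift (input_cells u ! k) (place (input_cells u ! k) c) d)) k, ts)"
  using shift_correct[OF assms(1) place_less[OF input_cells_in[OF assms(1)] assms(2)], of
      "fst (shift (input_cells u ! k) (place (input_cells u ! k) c) d)"
      "snd (shift (input_cells u ! k) (place (input_cells u ! k) c) d)" d]
  unfolding related_def by auto

lemma read_u: "k \<le> Suc (length u) \<Longrightarrow> input_read u k = input_cells u ! k"
  by (rule input_read_nth)

lemma pulled_step:
  assumes "related x y" "ntm_step pulled u y y'"
  shows "\<exists>x'. ntm_step M v x x' \<and> related x' y'"
proof -
  obtain s p ts where x: "x = (s, p, ts)"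
    by (rule prod_cases3)
  then obtain k c where y: "y = (code s c, k, ts)" and k: "k \<le> Suc (length u)"
    and c: "c \<le> length (image_cells (input_cells u ! k))" and p: "p = offset k + place (input_cells u ! k) c"
    using assms(1) by (cases y rule: prod_cases3) (auto simp: related_def)
  from assms(2) obtain t d' ws where i: "(code s c, input_read u k, map work_read ts, t, d', ws) \<in> ntm_instrs pulled"
    and y': "y' = (t, input_move u d' k, map2 work_step ws ts)"
    unfolding y by (auto elim: ntm_step.cases)
  let ?i = "input_cells u ! k"
  obtain s1 c1 s' d where s1: "code s c = code s1 c1" "s1 \<noteq> ntm_accept M" "t = code s' (fst (shift ?i (place ?i c1) d))"
    "d' = snd (shift ?i (place ?i c1) d)" "(s1, image_cells ?i ! place ?i c1, map work_read ts, s', d, ws) \<in> ntm_instrs M"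
    using i read_u[OF k] by (auto simp: pulled_def)
  then have eq: "s1 = s" "c1 = c"
    using code_eq[OF s1(1)] by auto
  have "(s, input_read v p, map work_read ts, s', d, ws) \<in> ntm_instrs M"
    using s1(5) read_related[OF k c] unfolding p eq by simp
  then have "ntm_step M v x (s', input_move v d p, map2 work_step ws ts)"
    unfolding x by (rule ntm_step.intros)
  moreover have "related (s', input_move v d p, map2 work_step ws ts) y'"
    using move_related[OF k c] unfolding y' s1(3,4) eq p .
  ultimately show ?thesis
    by blast
qed

lemma original_step:
  assumes "related x y" "ntm_step M v x x'" "fst x \<noteq> ntm_accept M"
  shows "\<exists>y'. ntm_step pulled u y y' \<and> related x' y'"
proof -
  obtain s p ts where x: "x = (s, p, ts)"
    by (rule prod_cases3)
  then obtain k c where y: "y = (code s c, k, ts)" and k: "k \<le> Suc (length u)"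
    and c: "c \<le> length (image_cells (input_cells u ! k))" and p: "p = offset k + place (input_cells u ! k) c"
    using assms(1) by (cases y rule: prod_cases3) (auto simp: related_def)
  let ?i = "input_cells u ! k"
  from assms(2) obtain s' d ws where i: "(s, input_read v p, map work_read ts, s', d, ws) \<in> ntm_instrs M"
    and x': "x' = (s', input_move v d p, map2 work_step ws ts)"
    unfolding x by (auto elim: ntm_step.cases)
  have "(code s c, input_read u k, map work_read ts, code s' (fst (shift ?i (place ?i c) d)),
      snd (shift ?i (place ?i c) d), ws) \<in> ntm_instrs pulled"
    using i read_related[OF k c] read_u[OF k] input_cells_in[OF k] c assms(3) unfolding p x pulled_def
    by simp blast
  from ntm_step.intros[OF this] show ?thesis
    using move_related[OF k c] unfolding x' y p by blast
qed

lemma init_related: "related (ntm_init M) (ntm_init pulled)"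
proof -
  have "offset 0 = 0" "input_cells u ! 0 = Left_End"
    by (simp_all add: offset_def input_cells_def)
  then show ?thesis
    by (auto simp: related_def ntm_init_def pulled_def place_def intro!: exI[of _ "Suc 0"])
qed

lemma pulled_reachable:
  assumes "ntm_reachable pulled u y"
  shows "\<exists>x. ntm_reachable M v x \<and> related x y"
  using assms unfolding ntm_reachable_def
proof (induction rule: rtranclp_induct)
  case base
  then show ?case
    using init_related by blast
next
  case (step y y')
  then obtain x where "(ntm_step M v)\<^sup>*\<^sup>* (ntm_init M) x" "related x y"
    by blast
  then show ?case
    using pulled_step[OF _ step.hyps(2)] by (meson rtranclp.rtrancl_into_rtrancl)
qed

text \<open>The simulation stops at acceptance, so what the original machine does afterwards has no
  counterpart; the second alternative absorbs such computations.\<close>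

lemma original_reachable:
  assumes "ntm_reachable M v x"
  shows "(\<exists>y. ntm_reachable pulled u y \<and> related x y) \<or> ntm_accepts pulled u"
  using assms unfolding ntm_reachable_def
proof (induction rule: rtranclp_induct)
  case base
  then show ?case
    using init_related by blast
next
  case (step x x')
  show ?case
  proof (cases "ntm_accepts pulled u")
    case False
    then obtain y where y: "(ntm_step pulled u)\<^sup>*\<^sup>* (ntm_init pulled) y" "related x y"
      using step.IH by blast
    show ?thesis
    proof (cases "fst x = ntm_accept M")
      case True
      then have "fst y = ntm_accept pulled"
        using y(2) by (cases x rule: prod_cases3; cases y rule: prod_cases3)
          (auto simp: related_def code_def pulled_def)
      then have "ntm_accepts pulled u"
        unfolding ntm_accepts_def ntm_reachable_def using y(1) by (metis prod.collapse)
      then show ?thesis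
        using False by simp
    next
      case False
      then show ?thesis
        using original_step[OF y(2) step.hyps(2)] y(1) by (meson rtranclp.rtrancl_into_rtrancl)
    qed
  qed simp
qed

lemma pulled_accepts: "ntm_accepts pulled u \<longleftrightarrow> ntm_accepts M v"
proof
  assume "ntm_accepts pulled u"
  then obtain k ts where "ntm_reachable pulled u (0, k, ts)"
    by (auto simp: ntm_accepts_def pulled_def)
  then obtain x where x: "ntm_reachable M v x" "related x (0, k, ts)"
    using pulled_reachable by blast
  then have "fst x = ntm_accept M"
    by (cases x rule: prod_cases3) (auto simp: related_def code_def split: if_splits)
  then show "ntm_accepts M v"
    unfolding ntm_accepts_def using x(1) by (metis prod.collapse)
next
  assume "ntm_accepts M v"
  then obtain k ts where r: "ntm_reachable M v (ntm_accept M, k, ts)"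
    by (auto simp: ntm_accepts_def)
  have "ntm_accepts pulled u" if "ntm_reachable pulled u y" "related (ntm_accept M, k, ts) y" for y
  proof -
    have "fst y = ntm_accept pulled"
      using that(2) by (cases y rule: prod_cases3) (auto simp: related_def code_def pulled_def)
    then show ?thesis
      unfolding ntm_accepts_def using that(1) by (metis prod.collapse)
  qed
  then show "ntm_accepts pulled u"
    using original_reachable[OF r] by blast
qed

lemma pulled_space:
  assumes "ntm_reachable pulled u y"
  shows "\<exists>x. ntm_reachable M v x \<and> config_space x = config_space y"
proof -
  obtain x where "ntm_reachable M v x" "related x y"
    using pulled_reachable[OF assms] by blast
  then show ?thesis
    by (cases x rule: prod_cases3; cases y rule: prod_cases3) (auto simp: related_def)
qed

end

end

section \<open>Renaming states and letters\<close>

definition rename :: "('q \<Rightarrow> 'r) \<Rightarrow> ('a \<Rightarrow> 'b) \<Rightarrow> ('q, 'a) automaton \<Rightarrow> ('r, 'b) automaton" where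
  "rename e g T = \<lparr>aut_states = e ` aut_states T, aut_alphabet = g ` aut_alphabet T,
     aut_trans = (\<lambda>(q, a, b, p). (e q, g a, g b, e p)) ` aut_trans T\<rparr>"

locale renaming = G_aut T for T :: "('q, 'a) automaton" +
  fixes e :: "'q \<Rightarrow> 'r" and g :: "'a \<Rightarrow> 'b"
  assumes e: "inj_on e (aut_states T)" and g: "inj_on g (aut_alphabet T)"
begin

abbreviation "T' \<equiv> rename e g T"

lemma rename_trans: "t \<in> aut_trans T' \<longleftrightarrow> (\<exists>q a b p. (q, a, b, p) \<in> aut_trans T \<and> t = (e q, g a, g b, e p))"
  by (force simp: rename_def)

lemma e_eq: "q \<in> Q \<Longrightarrow> p \<in> Q \<Longrightarrow> e q = e p \<longleftrightarrow> q = p"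
  and g_eq: "a \<in> \<Sigma> \<Longrightarrow> b \<in> \<Sigma> \<Longrightarrow> g a = g b \<longleftrightarrow> a = b"
  using e g by (simp_all add: inj_on_eq_iff)

lemma G_rename: "G_automaton T'"
  unfolding G_automaton_def
proof (intro conjI ballI)
  show "automaton T'"
    unfolding automaton_def using finite_Q finite_\<Sigma> \<Sigma>_nonempty trans_in by (fastforce simp: rename_def)
next
  fix q' a'
  assume "q' \<in> aut_states T'" "a' \<in> aut_alphabet T'"
  then obtain q a where q: "q' = e q" "q \<in> Q" and a: "a' = g a" "a \<in> \<Sigma>"
    by (auto simp: rename_def)
  then obtain b p where bp: "(q, a, b, p) \<in> aut_trans T"
    using trans_ex by blast
  show "\<exists>!t. t \<in> aut_trans T' \<and> (\<exists>b p. t = (q', a', b, p))"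
  proof (rule ex1I[of _ "(e q, g a, g b, e p)"])
    show "(e q, g a, g b, e p) \<in> aut_trans T' \<and> (\<exists>b' p'. (e q, g a, g b, e p) = (q', a', b', p'))"
      using bp q a rename_trans by blast
  next
    fix t
    assume "t \<in> aut_trans T' \<and> (\<exists>b p. t = (q', a', b, p))"
    then obtain q1 a1 b1 p1 where t: "(q1, a1, b1, p1) \<in> aut_trans T" "t = (e q1, g a1, g b1, e p1)"
      "e q1 = e q" "g a1 = g a"
      using q a by (auto simp: rename_trans)
    then have "q1 = q" "a1 = a"
      using e_eq g_eq q a trans_in by metis+
    then show "t = (e q, g a, g b, e p)"
      using t trans_det[OF bp] by blast
  qed
next
  fix q' b'
  assume "q' \<in> aut_states T'" "b' \<in> aut_alphabet T'"
  then obtain q b where q: "q' = e q" "q \<in> Q" and b: "b' = g b" "b \<in> \<Sigma>"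
    by (auto simp: rename_def)
  show "\<exists>\<^sub>\<le>\<^sub>1t. t \<in> aut_trans T' \<and> (\<exists>a p. t = (q', a, b', p))"
    unfolding Uniq_def
  proof (intro allI impI)
    fix t t'
    assume "t \<in> aut_trans T' \<and> (\<exists>a p. t = (q', a, b', p))"
    then obtain q1 a1 b1 p1 where t: "(q1, a1, b1, p1) \<in> aut_trans T" "t = (e q1, g a1, g b1, e p1)"
      "e q1 = e q" "g b1 = g b"
      using q b by (auto simp: rename_trans)
    assume "t' \<in> aut_trans T' \<and> (\<exists>a p. t' = (q', a, b', p))"
    then obtain q2 a2 b2 p2 where t': "(q2, a2, b2, p2) \<in> aut_trans T" "t' = (e q2, g a2, g b2, e p2)"
      "e q2 = e q" "g b2 = g b"
      using q b by (auto simp: rename_trans)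
    have "q1 = q" "b1 = b" "q2 = q" "b2 = b"
      using e_eq g_eq q b trans_in t t' by metis+
    then show "t = t'"
      using t t' trans_inv by blast
  qed
qed

lemma run_rename: "aut_run T q u v p \<Longrightarrow> aut_run T' (e q) (map g u) (map g v) (e p)"
proof (induction rule: aut_run.induct)
  case (Nil q)
  then show ?case
    by (auto intro: aut_run.Nil simp: rename_def)
next
  case (Cons q a b r u v p)
  then have "(e q, g a, g b, e r) \<in> aut_trans T'"
    using rename_trans by blast
  then show ?case
    using Cons.IH by (auto intro: aut_run.Cons)
qed

sublocale R: G_aut T'
  by standard (rule G_rename)

lemma state_act_rename:
  assumes "q \<in> Q" "u \<in> lists \<Sigma>"
  shows "state_act T' (e q) (map g u) = map g (state_act T q u)"
proof -
  obtain p where "aut_run T q u (state_act T q u) p"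
    using state_act_run assms by blast
  then show ?thesis
    using R.state_act_eq run_rename by blast
qed

lemma act_rename:
  assumes "u \<in> lists \<Sigma>" "qs \<in> lists Q"
  shows "act T' (map e qs) (map g u) = map g (act T qs u)"
  using assms(2)
proof (induction qs)
  case (Cons q qs)
  then have "q \<in> Q" "qs \<in> lists Q"
    by simp_all
  then show ?case
    using Cons.IH state_act_rename[of q "act T qs u"] act_in[OF assms(1)] by (simp add: act_Cons R.act_Cons)
qed simp

lemma orbit_rename:
  assumes u: "u \<in> lists \<Sigma>"
  shows "orbit T' (map g u) = map g ` orbit T u"
proof -
  have "orbit T' (map g u) = {act T' qs (map g u) | qs. qs \<in> map e ` lists Q}"
    by (simp add: orbit_def rename_def lists_image)
  also have "\<dots> = (\<lambda>qs. act T' (map e qs) (map g u)) ` lists Q"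
    by blast
  also have "\<dots> = (\<lambda>qs. map g (act T qs u)) ` lists Q"
    using act_rename[OF u] by (intro image_cong refl)
  also have "\<dots> = map g ` orbit T u"
    by (auto simp: orbit_def)
  finally show ?thesis .
qed

lemma card_orbit_rename:
  assumes u: "u \<in> lists \<Sigma>"
  shows "card (orbit T' (map g u)) = card (orbit T u)"
proof -
  have "inj_on (map g) (lists \<Sigma>)"
    by (rule inj_on_map_lists[OF g])
  moreover have "orbit T u \<subseteq> lists \<Sigma>"
    using orbit_in[OF u] by blast
  ultimately show ?thesis
    unfolding orbit_rename[OF u] by (intro card_image) (rule inj_on_subset)
qed

lemma expandable_rename:
  assumes u: "u \<in> lists \<Sigma>"
  shows "expandable T' (map g u) \<longleftrightarrow> expandable T u"
proof -
  have "card (orbit T' (map g u @ map g x)) = card (orbit T (u @ x))" if "x \<in> lists \<Sigma>" for x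
    using card_orbit_rename[of "u @ x"] u that by simp
  then have "(\<exists>x\<in>map g ` lists \<Sigma>. card (orbit T' (map g u @ x)) > card (orbit T' (map g u))) \<longleftrightarrow>
      (\<exists>x\<in>lists \<Sigma>. card (orbit T (u @ x)) > card (orbit T u))"
    using card_orbit_rename[OF u] by simp
  then show ?thesis
    unfolding expandable_def by (simp add: rename_def lists_image)
qed

end

section \<open>Encoded instances\<close>

lemma length_binary: "length (binary m i) = ceillog2 m"
  by (simp add: binary_def)

text \<open>Numbers below \<open>m\<close> fit into \<open>ceillog2 m\<close> bits, so truncation to
  these bits loses nothing.\<close>

lemma binary_inj:
  assumes "i < m" "j < m" "binary m i = binary m j"
  shows "i = j"
proof -
  have "i < 2 ^ ceillog2 m" "j < 2 ^ ceillog2 m"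
    using assms(1,2) le_two_power_ceillog2[of m] by simp_all
  then have "take_bit (ceillog2 m) i = i" "take_bit (ceillog2 m) j = j"
    by (simp_all add: take_bit_nat_eq_self)
  moreover have "take_bit (ceillog2 m) i = take_bit (ceillog2 m) j"
  proof (rule bit_eqI)
    fix n
    have "n < ceillog2 m \<Longrightarrow> bit i n = bit j n"
      using arg_cong[OF assms(3), of "\<lambda>xs. xs ! n"] by (simp add: binary_def)
    then show "bit (take_bit (ceillog2 m) i) n = bit (take_bit (ceillog2 m) j) n"
      by (auto simp: bit_take_bit_iff)
  qed
  ultimately show ?thesis
    by argo
qed

lemma ceillog2_le_log: "real (ceillog2 m) \<le> 1 + log 2 (real m)"
proof (cases "m = 0")
  \<comment> \<open>An automaton may have no states. Here \<open>ceillog2 0 = 0\<close>, and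
    \<open>ln 0 = 0\<close> makes the logarithm vanish.\<close>
  case True
  then show ?thesis
    by (simp add: log_def)
next
  case False
  then show ?thesis
    using ceillog2_less_log[of m] by simp
qed

lemma log2_nonneg: "0 \<le> log 2 (real m)"
proof (cases "m = 0")
  case False
  then have "1 \<le> real m"
    by simp
  then show ?thesis
    by (subst zero_le_log_cancel_iff) simp_all
qed (simp add: log_def)

definition nspace_bound :: "('q, 'a) automaton \<Rightarrow> 'a list \<Rightarrow> real" where
  "nspace_bound T u = 6 * (real (card (orbit T u)) * (1 + log 2 (real (card (aut_states T)))) +
     real (length u) * (1 + log 2 (real (card (aut_alphabet T)))))"

text \<open>\<open>ceillog2 m + 1\<close> is at most \<open>2 + log 2 m\<close> and hence at most
  twice \<open>1 + log 2 m\<close>; likewise for \<open>k\<close>. The summand \<open>4\<close> is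
  absorbed by \<open>4 * n * (1 + log 2 m)\<close>, as \<open>n > 0\<close>. So
  \<open>6 = 4 + 2\<close>.\<close>

lemma budget_le:
  fixes n l m k :: nat
  assumes "n > 0"
  shows "real (4 + l * (ceillog2 k + 1) + n * (ceillog2 m + 1)) \<le>
    6 * (real n * (1 + log 2 (real m)) + real l * (1 + log 2 (real k)))"
proof -
  have m: "log 2 (real m) \<ge> 0" and k: "log 2 (real k) \<ge> 0"
    by (rule log2_nonneg)+
  have "real n \<ge> 1"
    using assms by simp
  then have "1 * 1 \<le> real n * (1 + log 2 (real m))"
    using m by (intro mult_mono) auto
  moreover have "real (n * (ceillog2 m + 1)) \<le> real n * (2 * (1 + log 2 (real m)))"
    using ceillog2_le_log[of m] m unfolding of_nat_mult by (intro mult_left_mono) auto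
  moreover have "real (l * (ceillog2 k + 1)) \<le> real l * (2 * (1 + log 2 (real k)))"
    using ceillog2_le_log[of k] k unfolding of_nat_mult by (intro mult_left_mono) auto
  moreover have "0 \<le> real l * (1 + log 2 (real k))"
    using k by simp
  ultimately show ?thesis
    by (simp add: algebra_simps)
qed

theorem decider_correct:
  assumes T: "G_automaton T" and u: "u \<in> lists (aut_alphabet T)" and code: "encodes (T, u) w"
  shows "(ntm_accepts (machine decider) w \<longleftrightarrow> expandable T u) \<and>
    (\<forall>c. ntm_reachable (machine decider) w c \<longrightarrow> real (config_space c) \<le> nspace_bound T u)"
proof -
  let ?m = "card (aut_states T)" and ?k = "card (aut_alphabet T)"
  obtain f g ts where f: "bij_betw f (aut_states T) {..<?m}" and g: "bij_betw g (aut_alphabet T) {..<?k}"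
    and ts: "set ts = aut_trans T"
    and w: "w = concat (map (\<lambda>(q, a, b, p). encode_trans ?m ?k (f q, g a, g b, f p)) ts) @ [Hash] @
         concat (map (\<lambda>a. encode_letter ?k (g a)) u)"
    using code by (auto simp: encodes_def Let_def)
  define e where "e q = binary ?m (f q)" for q
  define d where "d a = binary ?k (g a)" for a
  define tr where "tr = map (\<lambda>(q, a, b, p). (e q, d a, d b, e p)) ts"
  have "inj_on e (aut_states T)"
    using f unfolding bij_betw_def inj_on_def e_def by (metis binary_inj imageI lessThan_iff)
  moreover have "inj_on d (aut_alphabet T)"
    using g unfolding bij_betw_def inj_on_def d_def by (metis binary_inj imageI lessThan_iff)
  ultimately interpret renaming T e d
    using T by unfold_locales
  have trans: "aut_trans T' = set tr"
    by (simp add: rename_def tr_def ts)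
  interpret decision tr "map d u" "ceillog2 ?m" "ceillog2 ?k" T'
  proof
    show "length q = ceillog2 ?m \<and> length a = ceillog2 ?k \<and> length b = ceillog2 ?k \<and> length p = ceillog2 ?m"
      if "(q, a, b, p) \<in> set tr" for q a b p
      using that by (auto simp: tr_def e_def d_def length_binary)
    show "aut_trans T' = set tr"
      by (rule trans)
    show "length q = ceillog2 ?m" if "q \<in> aut_states T'" for q
      using that by (auto simp: rename_def e_def length_binary)
    show "length a = ceillog2 ?k" if "a \<in> aut_alphabet T'" for a
      using that by (auto simp: rename_def d_def length_binary)
    show "map d u \<in> lists (aut_alphabet T')"
      using u by (auto simp: rename_def)
  qed
  have word: "w = encoded.w tr (map d u)"
  proof -
    have enc: "(\<lambda>(q, a, b, p). encode_trans ?m ?k (f q, g a, g b, f p)) t =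
        enc_trans ((\<lambda>(q, a, b, p). (e q, d a, d b, e p)) t)" for t
      by (cases t rule: prod_cases4) (simp add: e_def d_def)
    have "map (\<lambda>(q, a, b, p). encode_trans ?m ?k (f q, g a, g b, f p)) ts = map enc_trans tr"
      unfolding tr_def map_map comp_def by (intro map_cong refl) (rule enc)
    moreover have "concat (map (\<lambda>a. encode_letter ?k (g a)) u) = enc_word (map d u)"
      by (simp add: encode_letter_def enc_word_def d_def comp_def)
    ultimately show ?thesis
      unfolding w w_def by (simp only: append_Cons append_Nil)
  qed
  have "ntm_accepts (machine decider) w \<longleftrightarrow> expandable T u"
    unfolding word machine_accepts_iff decider_accepts expandable_rename[OF u] ..
  moreover have "real (config_space c) \<le> nspace_bound T u" if "ntm_reachable (machine decider) w c" for c
  proof -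
    have "config_space c \<le> budget"
      using machine_space[OF that[unfolded word] decider_safe] .
    also have "budget = 4 + length u * (ceillog2 ?k + 1) + card (orbit T u) * (ceillog2 ?m + 1)"
      unfolding budget_def card_orbit_rename[OF u] by simp
    finally show ?thesis
      unfolding nspace_bound_def using budget_le[OF card_orbit_pos[OF u], of "length u" ?k ?m]
      by (meson of_nat_le_iff order_trans)
  qed
  ultimately show ?thesis
    by blast
qed

section \<open>The bound and the encoding for a fixed automaton\<close>

lemma affine_bigo: "(\<lambda>l :: nat. c + real l * d) \<in> O(\<lambda>l. real l)"
proof (rule bigoI[where c = "\<bar>c\<bar> + \<bar>d\<bar>"])
  have "norm (c + real l * d) \<le> (\<bar>c\<bar> + \<bar>d\<bar>) * norm (real l)" if "l \<ge> 1" for l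
  proof -
    have "\<bar>c + real l * d\<bar> \<le> \<bar>c\<bar> * 1 + \<bar>d\<bar> * real l"
      using abs_triangle_ineq[of c "real l * d"] by (simp add: abs_mult mult.commute)
    also have "\<dots> \<le> \<bar>c\<bar> * real l + \<bar>d\<bar> * real l"
      using that by (intro add_mono mult_left_mono) auto
    finally show ?thesis
      by (simp add: algebra_simps)
  qed
  then show "\<forall>\<^sub>F l in sequentially. norm (c + real l * d) \<le> (\<bar>c\<bar> + \<bar>d\<bar>) * norm (real l)"
    by (rule eventually_sequentiallyI)
qed

text \<open>With \<open>k\<close> letters and \<open>l\<close> the length of \<open>u\<close>, both
  \<open>k ^ l\<close> and \<open>l\<close> are at most \<open>(2 * k) ^ l\<close>; the factor
  \<open>2\<close> is what covers \<open>l\<close> when \<open>k = 1\<close>. All factors that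
  depend on \<open>T\<close> alone go into the constant term of the exponent.\<close>

lemma nspace_bound_exponential:
  assumes T: "G_automaton T"
  shows "\<exists>f\<in>O(\<lambda>l :: nat. real l). \<forall>u\<in>lists (aut_alphabet T). nspace_bound T u \<le> 2 powr f (length u)"
proof -
  interpret G_aut T
    by standard (rule T)
  let ?k = "card \<Sigma>"
  define a where "a = 1 + log 2 (real (card Q))"
  define b where "b = 1 + log 2 (real ?k)"
  define f where "f l = log 2 (12 * (a + b)) + real l * log 2 (2 * real ?k)" for l
  have ab: "a \<ge> 1" "b \<ge> 1"
    using log2_nonneg by (simp_all add: a_def b_def)
  have k: "?k \<ge> 1"
    using finite_\<Sigma> \<Sigma>_nonempty by (simp add: Suc_le_eq card_gt_0_iff)
  have "nspace_bound T u \<le> 2 powr f (length u)" if u: "u \<in> lists \<Sigma>" for u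
  proof -
    let ?l = "length u" and ?e = "(2 * real ?k) ^ length u"
    have "real (card (orbit T u)) \<le> real ?k ^ ?l"
      using card_orbit_le[OF u] by (metis of_nat_le_iff of_nat_power)
    also have "\<dots> \<le> ?e"
      by (intro power_mono) auto
    finally have orb: "real (card (orbit T u)) \<le> ?e" .
    have "real ?l \<le> 2 ^ ?l"
      by (rule less_imp_le[OF of_nat_less_two_power])
    also have "\<dots> \<le> ?e"
      using k by (intro power_mono) auto
    finally have len: "real ?l \<le> ?e" .
    have "nspace_bound T u \<le> 6 * (?e * a + ?e * b)"
      unfolding nspace_bound_def a_def[symmetric] b_def[symmetric]
      using orb len ab by (intro mult_left_mono add_mono mult_right_mono) auto
    also have "\<dots> \<le> 12 * (a + b) * ?e"
      using ab by (simp add: algebra_simps)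
    also have "\<dots> = 2 powr f ?l"
    proof -
      have "2 powr (real ?l * log 2 (2 * real ?k)) = (2 powr log 2 (2 * real ?k)) powr real ?l"
        unfolding powr_powr by (simp only: mult.commute)
      also have "\<dots> = (2 * real ?k) powr real ?l"
        using k by simp
      also have "\<dots> = ?e"
        using k by (intro powr_realpow) simp
      finally have "2 powr (real ?l * log 2 (2 * real ?k)) = ?e" .
      moreover have "2 powr log 2 (12 * (a + b)) = 12 * (a + b)"
        using ab by simp
      ultimately show ?thesis
        by (simp add: f_def powr_add)
    qed
    finally show ?thesis .
  qed
  moreover have "f \<in> O(\<lambda>l. real l)"
    unfolding f_def by (rule affine_bigo)
  ultimately show ?thesis
    by blast
qed

text \<open>Once the order of the transitions and the numberings are chosen, only the part after
  \<open>Hash\<close> depends on \<open>u\<close>, letter by letter. The comma that ends each letter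
  keeps \<open>h a\<close> nonempty even for an alphabet with one letter.\<close>

lemma encoding_exists:
  assumes T: "G_automaton T"
  shows "\<exists>P h. (\<forall>a. h a \<noteq> []) \<and> (\<forall>u. encodes (T, u) (P @ concat (map h u)))"
proof -
  interpret G_aut T
    by standard (rule T)
  let ?m = "card Q" and ?k = "card \<Sigma>"
  obtain f where f: "bij_betw f Q {..<?m}"
    using ex_bij_betw_finite_nat[OF finite_Q] by (auto simp: lessThan_atLeast0)
  obtain g where g: "bij_betw g \<Sigma> {..<?k}"
    using ex_bij_betw_finite_nat[OF finite_\<Sigma>] by (auto simp: lessThan_atLeast0)
  have "finite (aut_trans T)"
  proof (rule finite_subset)
    show "aut_trans T \<subseteq> Q \<times> \<Sigma> \<times> \<Sigma> \<times> Q"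
      using trans_in by auto
    show "finite (Q \<times> \<Sigma> \<times> \<Sigma> \<times> Q)"
      using finite_Q finite_\<Sigma> by simp
  qed
  then obtain ts where ts: "distinct ts" "set ts = aut_trans T"
    using finite_distinct_list by blast
  define P where "P = concat (map (\<lambda>(q, a, b, p). encode_trans ?m ?k (f q, g a, g b, f p)) ts) @ [Hash]"
  define h where "h a = encode_letter ?k (g a)" for a
  have "encodes (T, u) (P @ concat (map h u))" for u
    unfolding encodes_def prod.case Let_def using f g ts
    by (intro exI[of _ f] exI[of _ g] exI[of _ ts]) (simp add: P_def h_def[abs_def])
  moreover have "h a \<noteq> []" for a
    by (simp add: h_def encode_letter_def)
  ultimately show ?thesis
    by blast
qed

theorem theorem4p5:
  shows "(\<forall>(T :: (nat, nat) automaton) u. G_automaton T \<and> u \<in> lists (aut_alphabet T) \<longrightarrow>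
            card (orbit T u) \<le> card (aut_alphabet T) ^ length u) \<and>
         (\<exists>C :: real. decidable_in_nspace
            {(T :: (nat, nat) automaton, u). G_automaton T \<and> u \<in> lists (aut_alphabet T)}
            encodes
            (\<lambda>(T, u). expandable T u)
            (\<lambda>(T, u). C * (real (card (orbit T u)) * (1 + log 2 (real (card (aut_states T)))) +
                           real (length u) * (1 + log 2 (real (card (aut_alphabet T))))))) \<and>
         (\<forall>T :: ('q, 'a) automaton. G_automaton T \<longrightarrow>
            (\<exists>f \<in> O(\<lambda>l :: nat. real l). decidable_in_nspace
               (lists (aut_alphabet T))
               (\<lambda>u w. w = u)
               (expandable T)
               (\<lambda>u. 2 powr f (length u))))"
proof (intro conjI allI impI)
  fix T :: "(nat, nat) automaton" and u
  assume "G_automaton T \<and> u \<in> lists (aut_alphabet T)"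
  then show "card (orbit T u) \<le> card (aut_alphabet T) ^ length u"
    using G_aut.card_orbit_le[of T u] by (simp add: G_aut_def)
next
  show "\<exists>C :: real. decidable_in_nspace
      {(T :: (nat, nat) automaton, u). G_automaton T \<and> u \<in> lists (aut_alphabet T)}
      encodes
      (\<lambda>(T, u). expandable T u)
      (\<lambda>(T, u). C * (real (card (orbit T u)) * (1 + log 2 (real (card (aut_states T)))) +
                     real (length u) * (1 + log 2 (real (card (aut_alphabet T))))))"
  \<comment> \<open>\<open>6\<close> is the constant in \<open>nspace_bound\<close>; one machine
    serves all automata, since it reads them from its input.\<close>
  proof (rule exI[of _ 6])
    show "decidable_in_nspace
        {(T :: (nat, nat) automaton, u). G_automaton T \<and> u \<in> lists (aut_alphabet T)}
        encodes
        (\<lambda>(T, u). expandable T u)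
        (\<lambda>(T, u). 6 * (real (card (orbit T u)) * (1 + log 2 (real (card (aut_states T)))) +
                       real (length u) * (1 + log 2 (real (card (aut_alphabet T))))))"
      unfolding decidable_in_nspace_def
    proof (intro exI[of _ "machine decider"] conjI ballI allI impI)
      show "ntm (machine decider)"
        by (rule ntm_machine)
    next
      fix x :: "(nat, nat) automaton \<times> nat list" and w
      assume "x \<in> {(T, u). G_automaton T \<and> u \<in> lists (aut_alphabet T)}" "encodes x w"
      then obtain T u where x: "x = (T, u)" "G_automaton T" "u \<in> lists (aut_alphabet T)" "encodes (T, u) w"
        by (cases x) auto
      note correct = decider_correct[OF x(2-4), unfolded nspace_bound_def]
      show "ntm_accepts (machine decider) w \<longleftrightarrow> (case x of (T, u) \<Rightarrow> expandable T u)"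
        using correct x(1) by simp
      fix c
      assume "ntm_reachable (machine decider) w c"
      then show "real (config_space c) \<le> (case x of (T, u) \<Rightarrow>
          6 * (real (card (orbit T u)) * (1 + log 2 (real (card (aut_states T)))) +
               real (length u) * (1 + log 2 (real (card (aut_alphabet T))))))"
        using correct unfolding x(1) prod.case by blast
    qed
  qed
next
  fix T :: "('q, 'a) automaton"
  assume T: "G_automaton T"
  obtain f where f: "f \<in> O(\<lambda>l :: nat. real l)"
    and bound: "\<And>u. u \<in> lists (aut_alphabet T) \<Longrightarrow> nspace_bound T u \<le> 2 powr f (length u)"
    using nspace_bound_exponential[OF T] by blast
  obtain P and h :: "'a \<Rightarrow> symbol list" where h: "\<And>a. h a \<noteq> []"
    and code: "\<And>u. encodes (T, u) (P @ concat (map h u))"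
    using encoding_exists[OF T] by blast
  have fin: "finite (aut_alphabet T)"
    using T by (simp add: G_automaton_def automaton_def)
  \<comment> \<open>The simulation leaves the work tapes as they are, so the space bound of the
    decider on the encoding of \<open>T\<close> and \<open>u\<close> carries over to the input
    \<open>u\<close>.\<close>
  interpret inverse_image "machine decider" P h "aut_alphabet T"
    by standard (use ntm_machine fin h in auto)
  have "decidable_in_nspace (lists (aut_alphabet T)) (\<lambda>u w. w = u) (expandable T) (\<lambda>u. 2 powr f (length u))"
    unfolding decidable_in_nspace_def
  proof (intro exI[of _ pulled] conjI ballI allI impI)
    show "ntm pulled"
      by (rule ntm_pulled)
  next
    fix u w
    assume u: "u \<in> lists (aut_alphabet T)" and "w = u"
    then show "ntm_accepts pulled w \<longleftrightarrow> expandable T u"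
      using pulled_accepts[OF u] decider_correct[OF T u code] unfolding v_def[OF u] by simp
  next
    fix u w c
    assume u: "u \<in> lists (aut_alphabet T)" and "w = u" and c: "ntm_reachable pulled w c"
    then obtain x where x: "ntm_reachable (machine decider) (P @ concat (map h u)) x" "config_space x = config_space c"
      using pulled_space[OF u, of c] unfolding v_def[OF u] by blast
    have "real (config_space x) \<le> nspace_bound T u"
      using decider_correct[OF T u code] x(1) by blast
    then show "real (config_space c) \<le> 2 powr f (length u)"
      using bound[OF u] x(2) by simp
  qed
  then show "\<exists>f \<in> O(\<lambda>l :: nat. real l). decidable_in_nspace (lists (aut_alphabet T)) (\<lambda>u w. w = u)
      (expandable T) (\<lambda>u. 2 powr f (length u))"
    using f by blast
qed

end
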